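(* Let $V,W$ satisfy the standing assumptions (A1)--(A4) of the context. Let $n\ge2$, $T>0$, and let $(x^\circ,b^\circ)\in\mathbb{R}^n\times\{\pm1\}^n$ be such that $x_1^\circ<x_2^\circ<\dots<x_n^\circ$. Then there exists a unique solution $(x,b)$ on $[0,T]$ to the discrete problem with annihilation (see context). Moreover, the following properties are satisfied: (i) there exists $C>0$ independent of $n$ such that, for all $t\in[0,T]$, $M_2(x(t))\le Ct+M_2(x^\circ)$ and $M_4(x(t))\le Ct\,(M_2(x^\circ)+t)+M_4(x^\circ)$; (ii) $\displaystyle\inf_{0<t<T}\min\{|x_i(t)-x_j(t)|: i\ne j,\ b_i(t)b_j(t)=1\}>0$; (iii) the energy function $e:[0,T)\to\mathbb{R}$, $e(t):=E_n(x(t);b(t))$, is right-continuous on $[0,T)$, differentiable on $(0,T)\setminus T_{\mathrm{col}}$, and $e'(t)\le0$ for all $t\in(0,T)\setminus T_{\mathrm{col}}$. Moreover, denoting by $\llbracket e(t_k)\rrbracket:=e(t_k)-e(t_k-)$ the jump of $e$ at $t_k$, where $e(t_k-):=\lim_{s\uparrow t_k}e(s)$, $$\llbracket e(t_k)\rrbracket\le\frac Cn\Big(\gamma_kM_2(x(t_k))+\gamma_k+\sum_{i\in\Gamma_k}x_i^2(t_k)\Big)\quad\text{for every }k=1,\dots,K,$$ $$\sum_{k=1}^K\llbracket e(t_k)\rrbracket\le C\,(T+M_2(x^\circ)+1),$$ where $C>0$ is a constant independent of $n$; (iv) for all $t\in(0,T]$, $$E_n(x(t);b(t))-E_n(x^\circ;b^\circ)\le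 C\,(t+M_2(x^\circ)+1)-\frac1n\int_0^t|\dot x(s)|^2\,\mathrm ds;$$ (v) there exists $L\in\mathbb{N}$ such that for all $t\in[0,T)$ there exist $-\infty<a_0(t)\le a_1(t)\le\dots\le a_{2L}(t)<+\infty$ with $$\{x_i(t):b_i(t)=1\}\subset\bigcup_{\ell=1}^L\big(a_{2\ell-2}(t),a_{2\ell-1}(t)\big),\qquad\{x_i(t):b_i(t)=-1\}\subset\bigcup_{\ell=1}^L\big(a_{2\ell-1}(t),a_{2\ell}(t)\big).$$
   Context: **Assumptions on the potentials** $V:\mathbb{R}\setminus\{0\}\to\mathbb{R}$, $W:\mathbb{R}\to\mathbb{R}$: (A1) $V\in C^1(\mathbb{R}\setminus\{0\})$, $W\in C^1(\mathbb{R})$, $V'$ is locally Lipschitz on $\mathbb{R}\setminus\{0\}$, $W'$ is Lipschitz on $\mathbb{R}$. (A2) $V$ and $W$ are even. (A3) $V(r)\to+\infty$ as $r\to0$. (A4) $r\mapsto rV'(r)$ and $r\mapsto rW'(r)$ are in $L^\infty(\mathbb{R})$. Convention: $V'(0):=0$. The letter $C>0$ denotes a constant whose value can possibly change from line to line. **Energy and moments.** For $x\in\mathbb{R}^n$, $b\in\{-1,0,1\}^n$, $$E_n(x;b):=\frac1{2n^2}\sum_{i=1}^n\Big(\sum_{j\neq i,\ b_ib_j=1}V(x_i-x_j)+\sum_{j:\ b_ib_j=-1}W(x_i-x_j)\Big)\in\mathbb{R}\cup\{+\infty\},\qquad M_k(x):=\frac1n\sum_{i=1}^n|x_i|^k$$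 (the energy being $+\infty$ if some term $V(0)$ occurs). **Discrete problem with annihilation.** Let $H$ be the Heaviside function on $\mathbb{R}\cup\{+\infty\}$ with $H(0)=0$, $H(+\infty)=1$. A solution on $[0,T]$ with initial datum $(x^\circ,b^\circ)$ is a map $(x,b):[0,T]\to\mathbb{R}^n\times\{-1,0,1\}^n$ such that: (a) $x\in\mathrm{Lip}([0,T];\mathbb{R}^n)$; (b) $(x(0),b(0))=(x^\circ,b^\circ)$ and, in the classical sense, for every $i$, $$\frac{\mathrm d}{\mathrm dt}x_i=-\frac1n\sum_{j:\,b_ib_j=1}V'(x_i-x_j)-\frac1n\sum_{j:\,b_ib_j=-1}W'(x_i-x_j)\quad\text{on }(0,T)\setminus T_{\mathrm{col}},$$ where $T_{\mathrm{col}}$ is the jump set of $b$; (c) there is a vector of collision times $\tau=(\tau_1,\dots,\tau_n)$ with $\tau_i\in(0,T)\cup\{+\infty\}$ such that, with $T_{\mathrm{col}}=\{\tau_i:1\le i\le n\}\setminus\{+\infty\}=\{t_1,\dots,t_K\}\subset(0,T)$, $0<t_1<\dots<t_K<T$, there holds $b_i(t)=b_i^\circ H(\tau_i-t)$ for all $i=1,\dots,n$; (d) with $t_0:=0$, for all $k=1,\dots,K$: $t_k=\inf\{t\in(0,T):\exists(i,j)\text{ such that }b_i(t_{k-1})b_j(t_{k-1})=-1\text{ and }x_i(t)=x_j(t)\}>t_{k-1}$; (e) at each time $t\in[0,T]$ there is a bijection $\alpha:\{i:b_i^\circ=1,\tau_i\le t\}\to\{j:b_j^\circ=-1,\tau_j\le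 t\}$ such that $x_i(t)=x_{\alpha(i)}(t)$. Comment accompanying this definition: $\tau_i$ is the time at which particle $x_i$ gets annihilated, and $\tau_i=+\infty$ means that particle $x_i$ does not collide in $(0,T)$; property (d) ensures that for each pair of two colliding particles at least one gets annihilated; property (e) ensures that both particles get annihilated, and that annihilation can only occur for colliding particles with non-zero charge. For $k=1,\dots,K$: $\Gamma_k:=\{i:\tau_i=t_k\}$ and $\gamma_k:=\#\Gamma_k$.
   Formalization: Property (d) is supplemented by requiring that after the last collision time t_K no two particles of opposite remaining charge meet in (0,T); with (d) only for k=1,…,K, uniqueness fails (e.g. V=-log|r|, W=0, charges (1,1,-1), all τ_i=+∞). *)

theory Defs
  imports "HOL-Analysis.Analysis"
begin

text \<open>
  A potential on the punctured line is a function \<open>V :: real \<Rightarrow> real\<close> whose value at \<open>0\<close> is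
  never used: \<open>pot_ext\<close> replaces it by \<open>\<infinity>\<close>, and \<open>pot_deriv\<close> implements the convention
  \<open>V'(0) := 0\<close>. Vectors of length \<open>n\<close> are functions of which only the values on \<open>{1..n}\<close>
  matter, and a path \<open>x :: real \<Rightarrow> nat \<Rightarrow> real\<close> takes the time first.
\<close>

definition pot_deriv :: "(real \<Rightarrow> real) \<Rightarrow> real \<Rightarrow> real" where
  "pot_deriv V r = (if r = 0 then 0 else deriv V r)"

definition pot_ext :: "(real \<Rightarrow> real) \<Rightarrow> real \<Rightarrow> ereal" where
  "pot_ext V r = (if r = 0 then \<infinity> else ereal (V r))"

definition Linfty :: "(real \<Rightarrow> real) \<Rightarrow> bool" where
  "Linfty f \<longleftrightarrow> f \<in> borel_measurable lebesgue \<and> (\<exists>B. AE r in lebesgue. \<bar>f r\<bar> \<le> B)"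

definition admissible_potentials :: "(real \<Rightarrow> real) \<Rightarrow> (real \<Rightarrow> real) \<Rightarrow> bool" where
  "admissible_potentials V W \<longleftrightarrow>
     V C1_differentiable_on (- {0}) \<and> W C1_differentiable_on UNIV \<and>
     (\<forall>r. r \<noteq> 0 \<longrightarrow> (\<exists>u>0. \<exists>L. L-lipschitz_on (cball r u \<inter> - {0}) (deriv V))) \<and>
     (\<exists>L. L-lipschitz_on UNIV (deriv W)) \<and>
     (\<forall>r. r \<noteq> 0 \<longrightarrow> V (- r) = V r) \<and> (\<forall>r. W (- r) = W r) \<and>
     filterlim V at_top (at 0) \<and>
     Linfty (\<lambda>r. r * pot_deriv V r) \<and> Linfty (\<lambda>r. r * deriv W r)"

definition energy ::
    "(real \<Rightarrow> real) \<Rightarrow> (real \<Rightarrow> real) \<Rightarrow> nat \<Rightarrow> (nat \<Rightarrow> real) \<Rightarrow> (nat \<Rightarrow> int) \<Rightarrow> ereal" where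
  "energy V W n x b =
     ereal (1 / (2 * (real n)\<^sup>2)) *
     (\<Sum>i\<in>{1..n}. (\<Sum>j\<in>{j \<in> {1..n}. j \<noteq> i \<and> b i * b j = 1}. pot_ext V (x i - x j)) +
                 (\<Sum>j\<in>{j \<in> {1..n}. b i * b j = - 1}. ereal (W (x i - x j))))"

definition moment :: "nat \<Rightarrow> nat \<Rightarrow> (nat \<Rightarrow> real) \<Rightarrow> real" where
  "moment n k x = 1 / real n * (\<Sum>i\<in>{1..n}. \<bar>x i\<bar> ^ k)"

definition heaviside :: "ereal \<Rightarrow> int" where
  "heaviside s = (if s > 0 then 1 else 0)"

definition collision_set :: "nat \<Rightarrow> (nat \<Rightarrow> ereal) \<Rightarrow> real set" where
  "collision_set n \<tau> = {t. \<exists>i\<in>{1..n}. \<tau> i = ereal t}"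

definition num_collisions :: "nat \<Rightarrow> (nat \<Rightarrow> ereal) \<Rightarrow> nat" where
  "num_collisions n \<tau> = card (collision_set n \<tau>)"

text \<open>\<open>t\<^sub>0 = 0\<close>, and \<open>t\<^sub>k\<close> for \<open>1 \<le> k \<le> K\<close> is the \<open>k\<close>-th smallest collision time.\<close>

definition collision_time :: "nat \<Rightarrow> (nat \<Rightarrow> ereal) \<Rightarrow> nat \<Rightarrow> real" where
  "collision_time n \<tau> k =
     (if k = 0 then 0 else sorted_list_of_set (collision_set n \<tau>) ! (k - 1))"

definition annihilated_at :: "nat \<Rightarrow> (nat \<Rightarrow> ereal) \<Rightarrow> nat \<Rightarrow> nat set" where
  "annihilated_at n \<tau> k = {i \<in> {1..n}. \<tau> i = ereal (collision_time n \<tau> k)}"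

definition meeting_times ::
    "nat \<Rightarrow> real \<Rightarrow> (real \<Rightarrow> nat \<Rightarrow> real) \<Rightarrow> (nat \<Rightarrow> int) \<Rightarrow> real set" where
  "meeting_times n T x c =
     {t \<in> {0<..<T}. \<exists>i\<in>{1..n}. \<exists>j\<in>{1..n}. c i * c j = - 1 \<and> x t i = x t j}"

text \<open>
  The recursion for the collision times is imposed with the infimum taken in the extended reals,
  and also for \<open>k = K + 1\<close> with \<open>t\<^bsub>K+1\<^esub> = \<infinity> = inf \<emptyset>\<close>: after the last collision time no two
  particles of opposite remaining charge meet in \<open>(0,T)\<close>. Without this closing clause
  \<open>\<tau> = (\<infinity>,\<dots>,\<infinity>)\<close> would satisfy the recursion vacuously, oppositely charged particles could
  pass through each other, and solutions would not be unique (for instance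
  \<open>V r = - ln \<bar>r\<bar>\<close>, \<open>W = 0\<close>, charges \<open>(1,1,-1)\<close>).
\<close>

definition annihilation_solution_with ::
    "(real \<Rightarrow> real) \<Rightarrow> (real \<Rightarrow> real) \<Rightarrow> nat \<Rightarrow> real \<Rightarrow> (nat \<Rightarrow> real) \<Rightarrow> (nat \<Rightarrow> int) \<Rightarrow>
     (nat \<Rightarrow> ereal) \<Rightarrow> (real \<Rightarrow> nat \<Rightarrow> real) \<Rightarrow> (real \<Rightarrow> nat \<Rightarrow> int) \<Rightarrow> bool" where
  "annihilation_solution_with V W n T x0 b0 \<tau> x b \<longleftrightarrow>
     (\<forall>t\<in>{0..T}. \<forall>i\<in>{1..n}. b t i \<in> {- 1, 0, 1}) \<and>
     (\<forall>i\<in>{1..n}. \<exists>L. L-lipschitz_on {0..T} (\<lambda>t. x t i)) \<and>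
     (\<forall>i\<in>{1..n}. x 0 i = x0 i \<and> b 0 i = b0 i) \<and>
     (\<forall>t\<in>{0<..<T} - collision_set n \<tau>. \<forall>i\<in>{1..n}.
        ((\<lambda>s. x s i) has_real_derivative
           - (1 / real n) * (\<Sum>j\<in>{j \<in> {1..n}. b t i * b t j = 1}. pot_deriv V (x t i - x t j))
           - (1 / real n) * (\<Sum>j\<in>{j \<in> {1..n}. b t i * b t j = - 1}. deriv W (x t i - x t j)))
        (at t)) \<and>
     (\<forall>i\<in>{1..n}. \<tau> i \<in> ereal ` {0<..<T} \<union> {\<infinity>}) \<and>
     (\<forall>t\<in>{0..T}. \<forall>i\<in>{1..n}. b t i = b0 i * heaviside (\<tau> i - ereal t)) \<and>
     (\<forall>k\<in>{1..num_collisions n \<tau>}.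
        ereal (collision_time n \<tau> k) =
          (INF t\<in>meeting_times n T x (b (collision_time n \<tau> (k - 1))). ereal t) \<and>
        collision_time n \<tau> k > collision_time n \<tau> (k - 1)) \<and>
     meeting_times n T x (b (collision_time n \<tau> (num_collisions n \<tau>))) = {} \<and>
     (\<forall>t\<in>{0..T}. \<exists>\<alpha>.
        bij_betw \<alpha> {i \<in> {1..n}. b0 i = 1 \<and> \<tau> i \<le> ereal t}
                   {j \<in> {1..n}. b0 j = - 1 \<and> \<tau> j \<le> ereal t} \<and>
        (\<forall>i\<in>{i \<in> {1..n}. b0 i = 1 \<and> \<tau> i \<le> ereal t}. x t i = x t (\<alpha> i)))"

definition annihilation_solution ::
    "(real \<Rightarrow> real) \<Rightarrow> (real \<Rightarrow> real) \<Rightarrow> nat \<Rightarrow> real \<Rightarrow> (nat \<Rightarrow> real) \<Rightarrow> (nat \<Rightarrow> int) \<Rightarrow>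
     (real \<Rightarrow> nat \<Rightarrow> real) \<Rightarrow> (real \<Rightarrow> nat \<Rightarrow> int) \<Rightarrow> bool" where
  "annihilation_solution V W n T x0 b0 x b \<longleftrightarrow>
     (\<exists>\<tau>. annihilation_solution_with V W n T x0 b0 \<tau> x b)"

definition energy_path ::
    "(real \<Rightarrow> real) \<Rightarrow> (real \<Rightarrow> real) \<Rightarrow> nat \<Rightarrow> (real \<Rightarrow> nat \<Rightarrow> real) \<Rightarrow> (real \<Rightarrow> nat \<Rightarrow> int) \<Rightarrow>
     real \<Rightarrow> real" where
  "energy_path V W n x b t = real_of_ereal (energy V W n (x t) (b t))"

definition jump :: "(real \<Rightarrow> real) \<Rightarrow> real \<Rightarrow> real" where
  "jump e t = e t - Lim (at_left t) e"

definition speed_sq :: "nat \<Rightarrow> (real \<Rightarrow> nat \<Rightarrow> real) \<Rightarrow> real \<Rightarrow> real" where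
  "speed_sq n x s = (\<Sum>i\<in>{1..n}. (deriv (\<lambda>r. x r i) s)\<^sup>2)"

end

theory Submission imports Defs begin

text \<open>
  Give every particle a death time and consider the system in which a pair interacts as long as both
  of its particles live. Since \<open>V'\<close> and \<open>W'\<close> are odd, the force pairs with any observable through
  differences, and \<open>r V'(r), r W'(r) \<in> L\<^sup>\<infinity>\<close> bounds the moments. The energy with the interaction of each pair
  frozen at the first death in the pair is continuous and decreases at rate \<open>\<bar>x'\<bar>\<^sup>2 / n\<close>; since \<open>V\<close> blows
  up at \<open>0\<close> this keeps equal charges apart, uniformly in the flow. The energy itself differs from it
  by the sum of the jumps at the death times, which are estimated by \<open>V, W \<ge> - K (1 + r\<^sup>2)\<close>.
  With equal charges separated the forces are Lipschitz, so a flow is determined by its death times;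
  these are in turn determined because a first difference between two sets of death times is
  contradicted by the partner with which a particle dies. Existence follows by restarting a flow with fixed
  charges at each collision.
\<close>

section \<open>Pair potentials and pair forces\<close>

text \<open>The forces carry no sign or monotonicity, so nothing local keeps equal charges apart;
  only the energy can, and it has to survive annihilations. Freezing interactions instead of
  removing them achieves this and, moreover, gives separation up to and including the first death in
  a pair. That endpoint carries the combinatorics: at one death time and one position there cannot
  be two dying particles of the same charge, so partners are unique. The separation distance is
  fixed before the flow and its horizon are chosen. Existence needs this order, because there the
  bound is applied to a curve known to be a flow only up to the time at which it might leave the
  region where truncated and true forces agree. Opposite charges meet without singularity since
  \<open>W'\<close> is globally Lipschitz: a flow with fixed charges runs through their meetings,
  and the whole effect of annihilation sits in the death times. The lower bounds on the potentials
  are quadratic because the second moment is the quantity under control.\<close>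

lemma AE_le_imp_le_on_open:
  fixes f :: "real \<Rightarrow> real"
  assumes "open S" "continuous_on S f" "AE r in lebesgue. f r \<le> B" "r \<in> S"
  shows "f r \<le> B"
proof (rule ccontr)
  assume "\<not> f r \<le> B"
  \<comment> \<open>(A4) is only an essential bound. By continuity the set where it fails is open,
    and a nonempty open set is not null, so the bound holds at every point.\<close>
  define U where "U = S \<inter> f -` {B<..}"
  have "open U"
    unfolding U_def by (rule continuous_open_preimage) (use assms in auto)
  moreover have "r \<in> U" using \<open>\<not> f r \<le> B\<close> assms by (auto simp: U_def)
  ultimately have "\<not> negligible U"
    using open_not_negligible by blast
  obtain N where N: "{x \<in> space lebesgue. \<not> f x \<le> B} \<subseteq> N" "N \<in> null_sets lebesgue"
    using assms(3) by (auto simp: eventually_ae_filter)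
  have "negligible N" using N(2) by (simp add: negligible_iff_null_sets)
  moreover have "U \<subseteq> N" using N(1) by (auto simp: U_def)
  ultimately show False using \<open>\<not> negligible U\<close> negligible_subset by blast
qed

text \<open>Three regimes: near 0 by hypothesis, on a middle interval by compactness, and beyond 1
  by the mean value theorem, since there the bound on \<open>r * f' r\<close> bounds
  \<open>f'\<close>. The last regime even gives a linear estimate; it is weakened to the quadratic
  form that second moments can absorb.\<close>

lemma potential_lower_bound:
  fixes f :: "real \<Rightarrow> real"
  assumes deriv: "\<And>r. r \<noteq> 0 \<Longrightarrow> (f has_real_derivative f' r) (at r)"
    and bound: "\<And>r. r \<noteq> 0 \<Longrightarrow> \<bar>r * f' r\<bar> \<le> B"
    and even: "\<And>r. r \<noteq> 0 \<Longrightarrow> f (- r) = f r"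
    and d: "d > 0" "\<And>r. 0 < r \<Longrightarrow> r < d \<Longrightarrow> f r \<ge> m"
  shows "\<exists>K. \<forall>r. - f r \<le> K * (1 + r\<^sup>2)"
proof -
  have contf: "continuous_on {min d 1..1} f"
    using d by (intro continuous_at_imp_continuous_on ballI DERIV_isCont[OF deriv]) auto
  have "compact (f ` {min d 1..1})"
    by (rule compact_continuous_image[OF contf]) simp
  then have "\<exists>m'. \<forall>r\<in>{min d 1..1}. \<bar>f r\<bar> \<le> m'"
    unfolding compact_eq_bounded_closed bounded_iff by auto
  then obtain m' where m': "\<And>r. r \<in> {min d 1..1} \<Longrightarrow> \<bar>f r\<bar> \<le> m'"
    by blast
  have B0: "B \<ge> 0" using bound[of 1] by auto
  \<comment> \<open>One summand per regime; \<open>\<bar>f 0\<bar>\<close> covers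
    \<open>r = 0\<close>, where \<open>V\<close> has an arbitrary value.\<close>
  define K where "K = \<bar>m\<bar> + \<bar>m'\<bar> + B + \<bar>f 0\<bar>"
  have K0: "K \<ge> 0" using B0 by (simp add: K_def)
  have pos: "- f r \<le> K * (1 + r\<^sup>2)" if "r > 0" for r
  proof -
    consider "r < min d 1" | "min d 1 \<le> r" "r \<le> 1" | "r > 1" by linarith
    then have "- f r \<le> K * (1 + r\<^sup>2)"
    proof cases
      case 1
      then have "- f r \<le> K" using d(2)[of r] that B0 by (auto simp: K_def)
      also have "\<dots> \<le> K * (1 + r\<^sup>2)" using K0 by (simp add: algebra_simps)
      finally show ?thesis .
    next
      case 2
      then have "- f r \<le> K" using m'[of r] B0 by (auto simp: K_def)
      also have "\<dots> \<le> K * (1 + r\<^sup>2)" using K0 by (simp add: algebra_simps)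
      finally show ?thesis .
    next
      case 3
      obtain z where z: "1 < z" "z < r" "f r - f 1 = (r - 1) * f' z"
        using MVT2[of 1 r f f'] deriv 3 by force
      have "1 * \<bar>f' z\<bar> \<le> \<bar>z\<bar> * \<bar>f' z\<bar>" using z(1) by (intro mult_right_mono) auto
      then have "\<bar>f' z\<bar> \<le> B" using bound[of z] z(1) by (auto simp: abs_mult)
      then have "(r - 1) * (- f' z) \<le> (r - 1) * B" using 3 by (intro mult_left_mono) auto
      also have "\<dots> \<le> r\<^sup>2 * B"
      proof (rule mult_right_mono[OF _ B0])
        have "r * 1 \<le> r * r" using 3 by (intro mult_left_mono) auto
        then show "r - 1 \<le> r\<^sup>2" by (simp add: power2_eq_square)
      qed
      also have "\<dots> \<le> r\<^sup>2 * K" by (intro mult_left_mono) (auto simp: K_def)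
      finally have a: "- f r + f 1 \<le> r\<^sup>2 * K" using z(3) by (simp add: algebra_simps)
      have "- f 1 \<le> K" using m'[of 1] B0 by (auto simp: K_def)
      then show ?thesis using a by (simp add: algebra_simps)
    qed
    then show ?thesis .
  qed
  have "- f r \<le> K * (1 + r\<^sup>2)" for r
  proof -
    consider "r > 0" | "r < 0" | "r = 0" by linarith
    then show ?thesis
    proof cases
      case 2 then show ?thesis using pos[of "-r"] even[of r] by simp
    next
      case 3 then show ?thesis using B0 by (simp add: K_def)
    qed (rule pos)
  qed
  then show ?thesis by blast
qed

lemma deriv_even_odd:
  fixes f :: "real \<Rightarrow> real"
  assumes "f differentiable (at r)" "\<And>s. s \<noteq> 0 \<Longrightarrow> f (- s) = f s"
  shows "deriv f (- r) = - deriv f r"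
proof -
  have eq: "(\<lambda>s. f (- s)) = f"
  proof
    show "f (- s) = f s" for s by (cases "s = 0") (auto simp: assms(2))
  qed
  have "(f has_real_derivative deriv f r) (at r)"
    using assms(1) by (simp add: DERIV_deriv_iff_real_differentiable)
  then have "((\<lambda>s. f (- s)) has_real_derivative - deriv f r) (at (- r))"
    using DERIV_chain2[of f "deriv f r" uminus "- r" "- 1" UNIV, OF _ DERIV_minus[OF DERIV_ident]]
    by simp
  then show ?thesis
    by (simp add: eq DERIV_imp_deriv)
qed

text \<open>\<open>B\<close> and \<open>K\<close> depend on the potentials alone; expressing the
  estimates through them is what makes the final constant independent of \<open>n\<close>. The
  bounds hold at \<open>r = 0\<close> too, which spares case distinctions for coinciding
  particles.\<close>

locale pair_potentials =
  fixes V W :: "real \<Rightarrow> real" and B K :: real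
  assumes admissible: "admissible_potentials V W"
    and K_nonneg: "0 \<le> K"
    and bound_V: "\<And>r. \<bar>r * pot_deriv V r\<bar> \<le> B"
    and bound_W: "\<And>r. \<bar>r * deriv W r\<bar> \<le> B"
    and lower_V: "\<And>r. - V r \<le> K * (1 + r\<^sup>2)"
    and lower_W: "\<And>r. - W r \<le> K * (1 + r\<^sup>2)"

lemma C1_deriv:
  fixes f :: "real \<Rightarrow> real"
  assumes "f C1_differentiable_on S"
  shows "\<And>r. r \<in> S \<Longrightarrow> (f has_real_derivative deriv f r) (at r)" "continuous_on S (deriv f)"
proof -
  obtain D where D: "\<And>r. r \<in> S \<Longrightarrow> (f has_real_derivative D r) (at r)" "continuous_on S D"
    using assms by (auto simp: C1_differentiable_on_def has_real_derivative_iff_has_vector_derivative)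
  have eq: "deriv f r = D r" if "r \<in> S" for r using D(1)[OF that] by (rule DERIV_imp_deriv)
  show "(f has_real_derivative deriv f r) (at r)" if "r \<in> S" for r
    using D(1)[OF that] eq[OF that] by simp
  show "continuous_on S (deriv f)" using D(2) eq by (simp cong: continuous_on_cong)
qed

lemma pair_potentials_exist:
  assumes "admissible_potentials V W"
  shows "\<exists>B K. pair_potentials V W B K"
proof -
  note A = assms[unfolded admissible_potentials_def]
  have dV: "\<And>r. r \<noteq> 0 \<Longrightarrow> (V has_real_derivative deriv V r) (at r)" 
    and cV: "continuous_on (- {0}) (deriv V)"
    using C1_deriv[of V "- {0}"] A by auto
  have dW: "\<And>r. (W has_real_derivative deriv W r) (at r)" and cW: "continuous_on UNIV (deriv W)"
    using C1_deriv[of W UNIV] A by auto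
  obtain B1 where B1: "AE r in lebesgue. \<bar>r * pot_deriv V r\<bar> \<le> B1"
    using A by (auto simp: Linfty_def)
  obtain B2 where B2: "AE r in lebesgue. \<bar>r * deriv W r\<bar> \<le> B2"
    using A by (auto simp: Linfty_def)
  define B where "B = max 0 (max B1 B2)"
  have bV: "\<bar>r * pot_deriv V r\<bar> \<le> B" for r
  proof (cases "r = 0")
    case False
    have "continuous_on (- {0}) (\<lambda>r. \<bar>r * pot_deriv V r\<bar>)"
      by (intro continuous_intros continuous_on_eq[OF cV]) (simp add: pot_deriv_def)
    from AE_le_imp_le_on_open[OF _ this B1, of r] False show ?thesis
      by (auto simp: B_def open_Compl)
  qed (simp add: B_def)
  have bW: "\<bar>r * deriv W r\<bar> \<le> B" for r
  proof -
    have "continuous_on UNIV (\<lambda>r. \<bar>r * deriv W r\<bar>)" using cW by (intro continuous_intros)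
    from AE_le_imp_le_on_open[OF _ this B2, of r] show ?thesis by (auto simp: B_def)
  qed
  have "eventually (\<lambda>r. V r \<ge> 0) (at 0)"
    using A by (auto simp: filterlim_at_top)
  then obtain d where d: "d > 0" "\<And>r. r \<noteq> 0 \<Longrightarrow> \<bar>r\<bar> < d \<Longrightarrow> V r \<ge> 0"
    by (auto simp: eventually_at dist_real_def)
  have "\<exists>K. \<forall>r. - V r \<le> K * (1 + r\<^sup>2)"
  proof (rule potential_lower_bound[OF dV, of B d 0])
    show "\<bar>r * deriv V r\<bar> \<le> B" if "r \<noteq> 0" for r using bV[of r] that by (simp add: pot_deriv_def)
  qed (use A d in auto)
  then obtain K1 where K1: "\<And>r. - V r \<le> K1 * (1 + r\<^sup>2)" by blast
  have "continuous_on {0..1} W"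
    by (intro continuous_at_imp_continuous_on ballI DERIV_isCont[OF dW])
  then have "compact (W ` {0..1})" by (rule compact_continuous_image) simp
  then have "\<exists>m'. \<forall>r\<in>{0..1}. \<bar>W r\<bar> \<le> m'"
    unfolding compact_eq_bounded_closed bounded_iff by auto
  then obtain m' where m': "\<And>r. r \<in> {0..1} \<Longrightarrow> \<bar>W r\<bar> \<le> m'"
    by blast
  have "\<exists>K. \<forall>r. - W r \<le> K * (1 + r\<^sup>2)"
  proof (rule potential_lower_bound[OF dW, of B 1 "- m'"])
    show "- m' \<le> W r" if "0 < r" "r < 1" for r using m'[of r] that by auto
  qed (use A bW in auto)
  then obtain K2 where K2: "\<And>r. - W r \<le> K2 * (1 + r\<^sup>2)" by blast
  have "- V r \<le> max 0 (max K1 K2) * (1 + r\<^sup>2)" "- W r \<le> max 0 (max K1 K2) * (1 + r\<^sup>2)" for r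
    using K1[of r] K2[of r] mult_right_mono[of K1 "max 0 (max K1 K2)" "1 + r\<^sup>2"]
      mult_right_mono[of K2 "max 0 (max K1 K2)" "1 + r\<^sup>2"] by (auto intro: order_trans)
  then show ?thesis
    using bV bW assms by (intro exI[of _ B] exI[of _ "max 0 (max K1 K2)"]) (unfold_locales, auto)
qed

context pair_potentials
begin

lemma V_deriv: "r \<noteq> 0 \<Longrightarrow> (V has_real_derivative deriv V r) (at r)"
  and W_deriv: "(W has_real_derivative deriv W s) (at s)"
  using C1_deriv[of V "- {0}"] C1_deriv[of W UNIV] admissible
  by (auto simp: admissible_potentials_def)

lemma V_even: "V (- r) = V r" and W_even: "W (- r) = W r"
  using admissible by (cases "r = 0"; simp add: admissible_potentials_def)+

lemma pot_deriv_odd: "pot_deriv V (- r) = - pot_deriv V r"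
  using deriv_even_odd[of V r] V_deriv[of r] V_even
  by (auto simp: pot_deriv_def real_differentiable_def)

lemma deriv_W_odd: "deriv W (- r) = - deriv W r"
  using deriv_even_odd[of W r] W_deriv[of r] W_even by (auto simp: real_differentiable_def)

text \<open>Here \<sigma> is a product of two charges. Any value other than 1 and -1 gives no
  interaction, so a particle of charge 0 drops out of every sum over all pairs.\<close>

definition pair_pot :: "int \<Rightarrow> real \<Rightarrow> real" where
  "pair_pot \<sigma> r = (if \<sigma> = 1 then V r else if \<sigma> = - 1 then W r else 0)"

definition pair_force :: "int \<Rightarrow> real \<Rightarrow> real" where
  "pair_force \<sigma> r = (if \<sigma> = 1 then pot_deriv V r else if \<sigma> = - 1 then deriv W r else 0)"

lemma pair_force_odd: "pair_force \<sigma> (- r) = - pair_force \<sigma> r"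
  by (simp add: pair_force_def pot_deriv_odd deriv_W_odd)

text \<open>At \<open>r = 0\<close> this is the convention V'(0) = 0 for equal charges and the
  oddness of \<open>W'\<close> for opposite ones. It makes the diagonal terms vanish, so force sums
  may run over all indices.\<close>

lemma pair_force_0 [simp]: "pair_force \<sigma> 0 = 0" "pair_force 0 r = 0"
  using deriv_W_odd[of 0] by (auto simp: pair_force_def pot_deriv_def)

lemma pair_pot_0 [simp]: "pair_pot 0 r = 0"
  by (simp add: pair_pot_def)

lemma B_nonneg: "B \<ge> 0"
  using bound_W[of 0] by simp

lemma pair_force_bound: "\<bar>r * pair_force \<sigma> r\<bar> \<le> B"
  using bound_V[of r] bound_W[of r] B_nonneg by (auto simp: pair_force_def)

lemma pair_pot_deriv:
  assumes "\<sigma> = 1 \<Longrightarrow> r \<noteq> 0"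
  shows "(pair_pot \<sigma> has_real_derivative pair_force \<sigma> r) (at r)"
proof -
  have "pair_pot 1 = V" "pair_pot (- 1) = W" and
    *: "\<sigma> \<noteq> 1 \<Longrightarrow> \<sigma> \<noteq> - 1 \<Longrightarrow> pair_pot \<sigma> = (\<lambda>_. 0)"
    by (auto simp: pair_pot_def)
  then show ?thesis
    using V_deriv[of r] W_deriv[of r] assms
    by (auto simp: pair_force_def pot_deriv_def *)
qed

end

section \<open>Flows with prescribed death times\<close>

lemma sum_antisymmetric:
  fixes p :: "'a \<Rightarrow> 'a \<Rightarrow> real"
  assumes "\<And>i j. i \<in> A \<Longrightarrow> j \<in> A \<Longrightarrow> p j i = - p i j"
  shows "(\<Sum>i\<in>A. \<Sum>j\<in>A. p i j * (u i - u j)) = 2 * (\<Sum>i\<in>A. u i * (\<Sum>j\<in>A. p i j))"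
proof -
  have "(\<Sum>i\<in>A. \<Sum>j\<in>A. p i j * u j) = (\<Sum>j\<in>A. \<Sum>i\<in>A. p i j * u j)"
    by (rule sum.swap)
  also have "\<dots> = (\<Sum>j\<in>A. \<Sum>i\<in>A. - (p j i * u j))"
    by (intro sum.cong refl) (subst assms, auto)
  finally have "(\<Sum>i\<in>A. \<Sum>j\<in>A. p i j * u j) = - (\<Sum>i\<in>A. \<Sum>j\<in>A. p i j * u i)"
    by (simp add: sum_negf)
  moreover have "(\<Sum>i\<in>A. \<Sum>j\<in>A. p i j * u i) = (\<Sum>i\<in>A. u i * (\<Sum>j\<in>A. p i j))"
    unfolding sum_distrib_left by (intro sum.cong refl mult.commute)
  ultimately show ?thesis
    unfolding right_diff_distrib sum_subtractf by linarith
qed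

lemma has_integral_real_derivative:
  fixes f :: "real \<Rightarrow> real"
  assumes "finite S" "a \<le> b" "continuous_on {a..b} f"
    and "\<And>t. t \<in> {a<..<b} - S \<Longrightarrow> (f has_real_derivative f' t) (at t)"
  shows "(f' has_integral f b - f a) {a..b}"
  using assms
  by (intro fundamental_theorem_of_calculus_interior_strong)
    (auto simp: has_real_derivative_iff_has_vector_derivative)

lemma increment_le:
  fixes f :: "real \<Rightarrow> real"
  assumes "finite S" "a \<le> b" "continuous_on {a..b} f"
    and deriv: "\<And>t. t \<in> {a<..<b} - S \<Longrightarrow> (f has_real_derivative f' t) (at t)"
    and bound: "\<And>t. t \<in> {a<..<b} - S \<Longrightarrow> f' t \<le> C"
  shows "f b - f a \<le> C * (b - a)"
proof -
  \<comment> \<open>The derivative is controlled only off \<open>S\<close> and inside the interval.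
    Giving the integrand the value \<open>C\<close> elsewhere keeps its integral and makes the
    comparison pointwise.\<close>
  define g where "g t = (if t \<in> {a<..<b} - S then f' t else C)" for t
  have "(g has_integral f b - f a) {a..b}"
    by (rule has_integral_real_derivative[OF assms(1-3)]) (auto simp: g_def intro!: deriv)
  moreover have "((\<lambda>_. C) has_integral C * (b - a)) {a..b}"
    using has_integral_const_real[of C a b] \<open>a \<le> b\<close> by (simp add: mult.commute)
  ultimately show ?thesis
    by (rule has_integral_le) (auto simp: g_def intro!: bound)
qed

text \<open>The inequality is strict because H(0) = 0: at its death time a particle is already
  neutral, so charges are right-continuous.\<close>

definition alive :: "(nat \<Rightarrow> int) \<Rightarrow> (nat \<Rightarrow> real) \<Rightarrow> real \<Rightarrow> nat \<Rightarrow> int" where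
  "alive c \<theta> t i = (if t < \<theta> i then c i else 0)"

lemma alive_mult: "alive c \<theta> t i * alive c \<theta> t j = (if t < min (\<theta> i) (\<theta> j) then c i * c j else 0)"
  by (auto simp: alive_def)

text \<open>The relative position, stopped at the first death in the pair. A lower bound on it still
  speaks about that very death time, when \<open>alive\<close> has already switched the pair off;
  the uniqueness of partners relies on this.\<close>

definition gap :: "(real \<Rightarrow> nat \<Rightarrow> real) \<Rightarrow> (nat \<Rightarrow> real) \<Rightarrow> nat \<Rightarrow> nat \<Rightarrow> real \<Rightarrow> real" where
  "gap x \<theta> i j t = x (min t (min (\<theta> i) (\<theta> j))) i - x (min t (min (\<theta> i) (\<theta> j))) j"

definition separated :: "nat \<Rightarrow> (nat \<Rightarrow> real) \<Rightarrow> (nat \<Rightarrow> int) \<Rightarrow> (real \<Rightarrow> nat \<Rightarrow> real) \<Rightarrow> real \<Rightarrow> bool" where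
  "separated n \<theta> c x t \<longleftrightarrow>
     (\<forall>i\<in>{1..n}. \<forall>j\<in>{1..n}. i \<noteq> j \<longrightarrow> c i * c j = 1 \<longrightarrow> gap x \<theta> i j t \<noteq> 0)"

lemma sq_le_moment:
  assumes "i \<in> {1..n}"
  shows "(y i)\<^sup>2 \<le> real n * moment n 2 y"
proof -
  have "\<bar>y i\<bar>\<^sup>2 \<le> (\<Sum>i\<in>{1..n}. \<bar>y i\<bar> ^ 2)"
    using assms by (intro member_le_sum) auto
  then show ?thesis using assms by (simp add: moment_def)
qed

lemma moment_nonneg: "moment n k y \<ge> 0"
  by (simp add: moment_def sum_nonneg)

context pair_potentials
begin

definition force :: "nat \<Rightarrow> (nat \<Rightarrow> int) \<Rightarrow> (nat \<Rightarrow> real) \<Rightarrow> nat \<Rightarrow> real" where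
  "force n c y i = - (1 / real n) * (\<Sum>j\<in>{1..n}. pair_force (c i * c j) (y i - y j))"

text \<open>Particle \<open>i\<close> interacts with charge \<open>c i\<close> on the time interval \<open>[0, \<theta> i)\<close> and is frozen
  afterwards. It never dies if \<open>\<theta> i\<close> is beyond the time horizon \<open>u\<close>.\<close>

definition flow ::
    "nat \<Rightarrow> real \<Rightarrow> (nat \<Rightarrow> real) \<Rightarrow> (nat \<Rightarrow> int) \<Rightarrow> (real \<Rightarrow> nat \<Rightarrow> real) \<Rightarrow> bool" where
  "flow n u \<theta> c x \<longleftrightarrow>
     (\<forall>i\<in>{1..n}. continuous_on {0..u} (\<lambda>t. x t i)) \<and>
     (\<forall>t\<in>{0<..<u} - \<theta> ` {1..n}. \<forall>i\<in>{1..n}.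
        ((\<lambda>s. x s i) has_real_derivative force n (alive c \<theta> t) (x t) i) (at t))"

lemma flow_cont: "flow n u \<theta> c x \<Longrightarrow> i \<in> {1..n} \<Longrightarrow> continuous_on {0..u} (\<lambda>t. x t i)"
  by (simp add: flow_def)

lemma flow_deriv:
  "flow n u \<theta> c x \<Longrightarrow> i \<in> {1..n} \<Longrightarrow> t \<in> {0<..<u} - \<theta> ` {1..n} \<Longrightarrow>
     ((\<lambda>s. x s i) has_real_derivative force n (alive c \<theta> t) (x t) i) (at t)"
  by (simp add: flow_def)

lemma flow_mono: "flow n u \<theta> c x \<Longrightarrow> u' \<le> u \<Longrightarrow> flow n u' \<theta> c x"
  unfolding flow_def by (auto intro: continuous_on_subset)

text \<open>Symmetrising moves the singular force onto differences of \<open>v\<close>. It is used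
  with \<open>v\<close> the positions and their cubes, where a factor \<open>y i - y j\<close> turns
  the force into the bounded \<open>r * pair_force \<sigma> r\<close>, and with \<open>v\<close> the
  force itself, which yields the energy dissipation.\<close>

lemma sum_force:
  assumes "n \<ge> 1"
  shows "(\<Sum>i\<in>{1..n}. v i * force n c y i) =
    - (1 / (2 * real n)) * (\<Sum>i\<in>{1..n}. \<Sum>j\<in>{1..n}. pair_force (c i * c j) (y i - y j) * (v i - v j))"
proof -
  have "pair_force (c j * c i) (y j - y i) = - pair_force (c i * c j) (y i - y j)" for i j
    using pair_force_odd[of "c i * c j" "y i - y j"] by (simp add: mult.commute)
  then have "(\<Sum>i\<in>{1..n}. \<Sum>j\<in>{1..n}. pair_force (c i * c j) (y i - y j) * (v i - v j)) =
    2 * (\<Sum>i\<in>{1..n}. v i * (\<Sum>j\<in>{1..n}. pair_force (c i * c j) (y i - y j)))"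
    by (rule sum_antisymmetric)
  also have "\<dots> = - (2 * real n) * (\<Sum>i\<in>{1..n}. v i * force n c y i)"
    using assms by (simp add: force_def sum_distrib_left mult.assoc mult.left_commute sum_negf)
  finally show ?thesis using assms by simp
qed

section \<open>Growth of the second and fourth moments\<close>

lemma flow_moment2:
  assumes fl: "flow n u \<theta> c x" and n: "n \<ge> 1" and t: "0 \<le> t" "t \<le> u"
  shows "moment n 2 (x t) \<le> B * t + moment n 2 (x 0)"
proof -
  have "moment n 2 (x t) - moment n 2 (x 0) \<le> B * (t - 0)"
  proof (rule increment_le[of "\<theta> ` {1..n}" 0 t "\<lambda>t. moment n 2 (x t)"
      "\<lambda>t. 1 / real n * (\<Sum>i\<in>{1..n}. 2 * x t i * force n (alive c \<theta> t) (x t) i)"])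
    show "continuous_on {0..t} (\<lambda>t. moment n 2 (x t))"
      unfolding moment_def
      by (intro continuous_intros flow_cont[OF flow_mono[OF fl t(2)]])
    fix s assume s: "s \<in> {0<..<t} - \<theta> ` {1..n}"
    have [simp]: "moment n 2 (x t) = 1 / real n * (\<Sum>i\<in>{1..n}. (x t i)\<^sup>2)" for t
      by (simp add: moment_def)
    show "((\<lambda>t. moment n 2 (x t)) has_real_derivative
        1 / real n * (\<Sum>i\<in>{1..n}. 2 * x s i * force n (alive c \<theta> s) (x s) i)) (at s)"
      using s t n flow_deriv[OF fl, of _ s]
      by (auto intro!: derivative_eq_intros sum.cong simp: mult_ac simp del: One_nat_def)
    let ?p = "\<lambda>i j. pair_force (alive c \<theta> s i * alive c \<theta> s j) (x s i - x s j)"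
    have "1 / real n * (\<Sum>i\<in>{1..n}. 2 * x s i * force n (alive c \<theta> s) (x s) i) =
       2 / real n * (\<Sum>i\<in>{1..n}. x s i * force n (alive c \<theta> s) (x s) i)"
      by (simp add: sum_distrib_left mult_ac)
    also have "\<dots> = (1 / (real n)\<^sup>2) * (\<Sum>i\<in>{1..n}. \<Sum>j\<in>{1..n}. - (?p i j * (x s i - x s j)))"
      unfolding sum_force[OF n] by (simp add: power2_eq_square sum_negf)
    also have "\<dots> \<le> (1 / (real n)\<^sup>2) * (\<Sum>i\<in>{1..n}. \<Sum>j\<in>{1..n}. B)"
    proof (intro mult_left_mono sum_mono)
      show "- (?p i j * (x s i - x s j)) \<le> B" for i j
        using pair_force_bound[of "x s i - x s j" "alive c \<theta> s i * alive c \<theta> s j"]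
        by (auto simp: mult.commute)
    qed auto
    also have "\<dots> = B" using n by (simp add: power2_eq_square)
    finally show "1 / real n * (\<Sum>i\<in>{1..n}. 2 * x s i * force n (alive c \<theta> s) (x s) i) \<le> B" .
  qed (use t in auto)
  then show ?thesis by simp
qed

lemma flow_moment4:
  assumes fl: "flow n u \<theta> c x" and n: "n \<ge> 1" and t: "0 \<le> t" "t \<le> u"
  shows "moment n 4 (x t) \<le> 6 * B * (B * t + moment n 2 (x 0)) * t + moment n 4 (x 0)"
proof -
  have "moment n 4 (x t) - moment n 4 (x 0) \<le> 6 * B * (B * t + moment n 2 (x 0)) * (t - 0)"
  proof (rule increment_le[of "\<theta> ` {1..n}" 0 t "\<lambda>t. moment n 4 (x t)"
      "\<lambda>t. 1 / real n * (\<Sum>i\<in>{1..n}. 4 * x t i ^ 3 * force n (alive c \<theta> t) (x t) i)"])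
    show "continuous_on {0..t} (\<lambda>t. moment n 4 (x t))"
      unfolding moment_def
      by (intro continuous_intros flow_cont[OF flow_mono[OF fl t(2)]])
    fix s assume s: "s \<in> {0<..<t} - \<theta> ` {1..n}"
    have [simp]: "moment n 4 (x t) = 1 / real n * (\<Sum>i\<in>{1..n}. (x t i) ^ 4)" for t
      by (simp add: moment_def)
    show "((\<lambda>t. moment n 4 (x t)) has_real_derivative
        1 / real n * (\<Sum>i\<in>{1..n}. 4 * x s i ^ 3 * force n (alive c \<theta> s) (x s) i)) (at s)"
      using s t n flow_deriv[OF fl, of _ s]
      by (auto intro!: derivative_eq_intros sum.cong simp: mult_ac simp del: One_nat_def)
    let ?p = "\<lambda>i j. pair_force (alive c \<theta> s i * alive c \<theta> s j) (x s i - x s j)"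
    have "1 / real n * (\<Sum>i\<in>{1..n}. 4 * x s i ^ 3 * force n (alive c \<theta> s) (x s) i) =
       4 / real n * (\<Sum>i\<in>{1..n}. x s i ^ 3 * force n (alive c \<theta> s) (x s) i)"
      by (simp add: sum_distrib_left mult_ac)
    also have "\<dots> = (2 / (real n)\<^sup>2) * (\<Sum>i\<in>{1..n}. \<Sum>j\<in>{1..n}. - (?p i j * (x s i ^ 3 - x s j ^ 3)))"
      unfolding sum_force[OF n] by (simp add: power2_eq_square sum_negf)
    also have "\<dots> \<le> (2 / (real n)\<^sup>2) *
        (\<Sum>i\<in>{1..n}. \<Sum>j\<in>{1..n}. 3 / 2 * B * ((x s i)\<^sup>2 + (x s j)\<^sup>2))"
    proof (intro mult_left_mono sum_mono)
      fix i j
      let ?a = "x s i" and ?b = "x s j"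
      \<comment> \<open>The factor \<open>?a - ?b\<close> is absorbed into the bound
        \<open>B\<close>; the other factor is non-negative and at most 3/2 times the sum of the
        squares. With the prefactor 2, and each square counted twice in the double sum, this
        produces the constant \<open>6 * B\<close>.\<close>
      have "?a ^ 3 - ?b ^ 3 = (?a - ?b) * (?a\<^sup>2 + ?a * ?b + ?b\<^sup>2)"
        by (simp add: power2_eq_square power3_eq_cube algebra_simps)
      then have "- (?p i j * (?a ^ 3 - ?b ^ 3)) =
          - ((?a - ?b) * ?p i j) * (?a\<^sup>2 + ?a * ?b + ?b\<^sup>2)" by simp
      also have "\<dots> \<le> B * (3 / 2 * (?a\<^sup>2 + ?b\<^sup>2))"
      proof (rule mult_mono)
        show "- ((?a - ?b) * ?p i j) \<le> B"
          using pair_force_bound[of "?a - ?b" "alive c \<theta> s i * alive c \<theta> s j"] by auto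
        have "0 \<le> (?a - ?b)\<^sup>2" by simp
        then show "?a\<^sup>2 + ?a * ?b + ?b\<^sup>2 \<le> 3 / 2 * (?a\<^sup>2 + ?b\<^sup>2)"
          by (simp add: power2_diff)
        have "0 \<le> (?a + ?b)\<^sup>2 + ?a\<^sup>2 + ?b\<^sup>2" by simp
        then show "0 \<le> ?a\<^sup>2 + ?a * ?b + ?b\<^sup>2" by (simp add: power2_sum)
      qed (rule B_nonneg)
      finally show "- (?p i j * (x s i ^ 3 - x s j ^ 3)) \<le> 3 / 2 * B * ((x s i)\<^sup>2 + (x s j)\<^sup>2)"
        by (simp add: algebra_simps)
    qed auto
    also have "\<dots> = 3 * B / (real n)\<^sup>2 * (2 * real n * (\<Sum>i\<in>{1..n}. (x s i)\<^sup>2))"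
      unfolding sum_distrib_left[symmetric] by (simp add: sum.distrib sum_distrib_left[symmetric])
    also have "\<dots> = 6 * B * moment n 2 (x s)"
      using n by (simp add: moment_def power2_eq_square)
    also have "\<dots> \<le> 6 * B * (B * t + moment n 2 (x 0))"
      using flow_moment2[OF fl n, of s] s t B_nonneg mult_left_mono[of s t B]
      by (intro mult_left_mono) auto
    finally show "1 / real n * (\<Sum>i\<in>{1..n}. 4 * x s i ^ 3 * force n (alive c \<theta> s) (x s) i)
      \<le> 6 * B * (B * t + moment n 2 (x 0))" .
  qed (use t in auto)
  then show ?thesis by simp
qed

section \<open>Frozen gaps, dissipation of the stopped energy, separation of equal charges\<close>

lemma flow_gap_cont:
  assumes fl: "flow n u \<theta> c x" and ij: "i \<in> {1..n}" "j \<in> {1..n}" and \<theta>: "\<And>i. i \<in> {1..n} \<Longrightarrow> 0 < \<theta> i"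
  shows "continuous_on {0..u} (gap x \<theta> i j)"
proof -
  have "continuous_on {0..u} (\<lambda>t. x (min t (min (\<theta> i) (\<theta> j))) k)" if "k \<in> {1..n}" for k
    using \<theta>[OF ij(1)] \<theta>[OF ij(2)]
    by (intro continuous_on_compose2[OF flow_cont[OF fl that]] continuous_intros) auto
  then show ?thesis using ij unfolding gap_def by (intro continuous_intros) auto
qed

text \<open>Unlike the energy itself, this quantity is continuous in time: at a death the interactions are
  frozen instead of removed.\<close>

definition stopped_energy ::
    "nat \<Rightarrow> (nat \<Rightarrow> real) \<Rightarrow> (nat \<Rightarrow> int) \<Rightarrow> (real \<Rightarrow> nat \<Rightarrow> real) \<Rightarrow> real \<Rightarrow> real" where
  "stopped_energy n \<theta> c x t = 1 / (2 * (real n)\<^sup>2) *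
     (\<Sum>i\<in>{1..n}. \<Sum>j\<in>{1..n}. if i = j then 0 else pair_pot (c i * c j) (gap x \<theta> i j t))"

text \<open>The squared speed, written through the force so that it has a definite value also at the
  death times, where the curve need not be differentiable.\<close>

definition force_sq :: "nat \<Rightarrow> (nat \<Rightarrow> real) \<Rightarrow> (nat \<Rightarrow> int) \<Rightarrow> (real \<Rightarrow> nat \<Rightarrow> real) \<Rightarrow> real \<Rightarrow> real" where
  "force_sq n \<theta> c x t = (\<Sum>i\<in>{1..n}. (force n (alive c \<theta> t) (x t) i)\<^sup>2)"

lemma stopped_energy_cont:
  assumes fl: "flow n u \<theta> c x" and \<theta>: "\<And>i. i \<in> {1..n} \<Longrightarrow> 0 < \<theta> i"
    and sep: "\<And>t. t \<in> {0..u} \<Longrightarrow> separated n \<theta> c x t"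
  shows "continuous_on {0..u} (stopped_energy n \<theta> c x)"
proof -
  have "continuous_on {0..u} (\<lambda>t. if i = j then 0 else pair_pot (c i * c j) (gap x \<theta> i j t))"
    if "i \<in> {1..n}" "j \<in> {1..n}" for i j
  proof (cases "i = j")
    case False
    show ?thesis
    proof (simp add: False, rule continuous_on_compose2[OF _ flow_gap_cont[OF fl that \<theta>]])
      show "continuous_on (gap x \<theta> i j ` {0..u}) (pair_pot (c i * c j))"
      proof (intro continuous_at_imp_continuous_on ballI, elim imageE)
        fix r t assume t: "r = gap x \<theta> i j t" "t \<in> {0..u}"
        show "isCont (pair_pot (c i * c j)) r"
          by (rule DERIV_isCont[OF pair_pot_deriv]) (use sep[OF t(2)] t(1) False that in \<open>auto simp: separated_def\<close>)
      qed
    qed auto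
  qed simp
  then show ?thesis
    unfolding stopped_energy_def by (intro continuous_intros) auto
qed

text \<open>While a pair lives its frozen gap is the current one; afterwards the gap is constant and
  the pair exerts no force. Hence the force is \<open>- n\<close> times the gradient of the stopped
  energy, and \<open>sum_force\<close> with \<open>v\<close> the force gives the rate.\<close>

lemma stopped_energy_deriv:
  assumes fl: "flow n u \<theta> c x" and n: "n \<ge> 1"
    and t: "t \<in> {0<..<u} - \<theta> ` {1..n}" and sep: "separated n \<theta> c x t"
  shows "(stopped_energy n \<theta> c x has_real_derivative - (1 / real n) * force_sq n \<theta> c x t) (at t)"
proof -
  define f where "f = force n (alive c \<theta> t) (x t)"
  let ?p = "\<lambda>i j. pair_force (alive c \<theta> t i * alive c \<theta> t j) (x t i - x t j)"
  have pair: "((\<lambda>s. if i = j then 0 else pair_pot (c i * c j) (gap x \<theta> i j s))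
      has_real_derivative ?p i j * (f i - f j)) (at t)"
    if ij: "i \<in> {1..n}" "j \<in> {1..n}" for i j
  proof -
    let ?m = "min (\<theta> i) (\<theta> j)"
    have "t \<noteq> \<theta> i" "t \<noteq> \<theta> j" using t ij by auto
    then consider "i = j" | "i \<noteq> j" "t < ?m" | "i \<noteq> j" "t > ?m" by fastforce
    then show ?thesis
    proof cases
      case 1 then show ?thesis by simp
    next
      case 2
      have "((\<lambda>s. x s i - x s j) has_real_derivative f i - f j) (at t)"
        unfolding f_def by (intro derivative_intros flow_deriv[OF fl] ij t)
      moreover have "gap x \<theta> i j t = x t i - x t j" using 2 by (simp add: gap_def)
      then have "(pair_pot (c i * c j) has_real_derivative pair_force (c i * c j) (x t i - x t j))
          (at (x t i - x t j))"
        using sep 2 ij by (intro pair_pot_deriv) (auto simp: separated_def)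
      ultimately have "((\<lambda>s. pair_pot (c i * c j) (x s i - x s j)) has_real_derivative
          pair_force (c i * c j) (x t i - x t j) * (f i - f j)) (at t)"
        by (intro DERIV_chain2)
      then have "((\<lambda>s. pair_pot (c i * c j) (gap x \<theta> i j s)) has_real_derivative
          pair_force (c i * c j) (x t i - x t j) * (f i - f j)) (at t)"
        by (rule has_field_derivative_transform_within_open[of _ _ _ "{..<?m}"])
          (use 2 in \<open>auto simp: gap_def\<close>)
      then show ?thesis using 2 by (simp add: alive_mult)
    next
      case 3
      have "((\<lambda>s. pair_pot (c i * c j) (x ?m i - x ?m j)) has_real_derivative 0) (at t)" by simp
      then have "((\<lambda>s. pair_pot (c i * c j) (gap x \<theta> i j s)) has_real_derivative 0) (at t)"
        by (rule has_field_derivative_transform_within_open[of _ _ _ "{?m<..}"])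
          (use 3 in \<open>auto simp: gap_def min_def\<close>)
      moreover have "\<not> t < ?m" using 3(2) by (simp only: not_less less_imp_le)
      ultimately show ?thesis using 3(1) by (simp only: alive_mult if_False pair_force_0 mult_zero_left)
    qed
  qed
  have "(stopped_energy n \<theta> c x has_real_derivative
      1 / (2 * (real n)\<^sup>2) * (\<Sum>i\<in>{1..n}. \<Sum>j\<in>{1..n}. ?p i j * (f i - f j))) (at t)"
    unfolding stopped_energy_def[abs_def]
    by (intro DERIV_cmult DERIV_sum pair)
  moreover have "(\<Sum>i\<in>{1..n}. f i * f i) =
     - (1 / (2 * real n)) * (\<Sum>i\<in>{1..n}. \<Sum>j\<in>{1..n}. ?p i j * (f i - f j))"
    using sum_force[OF n, of f "alive c \<theta> t" "x t"] by (simp add: f_def)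
  then have "1 / (2 * (real n)\<^sup>2) * (\<Sum>i\<in>{1..n}. \<Sum>j\<in>{1..n}. ?p i j * (f i - f j)) =
    - (1 / real n) * force_sq n \<theta> c x t"
    using n by (simp add: force_sq_def f_def power2_eq_square field_simps)
  ultimately show ?thesis by simp
qed

lemma stopped_energy_integral:
  assumes fl: "flow n u \<theta> c x" and \<theta>: "\<And>i. i \<in> {1..n} \<Longrightarrow> 0 < \<theta> i" and n: "n \<ge> 1" and "0 \<le> t" "t \<le> u"
    and sep: "\<And>s. s \<in> {0..t} \<Longrightarrow> separated n \<theta> c x s"
  shows "((\<lambda>s. - (1 / real n) * force_sq n \<theta> c x s) has_integral
    stopped_energy n \<theta> c x t - stopped_energy n \<theta> c x 0) {0..t}"
proof (rule has_integral_real_derivative[of "\<theta> ` {1..n}"])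
  have fl': "flow n t \<theta> c x" using fl \<open>t \<le> u\<close> by (rule flow_mono)
  show "continuous_on {0..t} (stopped_energy n \<theta> c x)"
    using fl' \<theta> sep by (rule stopped_energy_cont)
  show "(stopped_energy n \<theta> c x has_real_derivative - (1 / real n) * force_sq n \<theta> c x s) (at s)"
    if "s \<in> {0<..<t} - \<theta> ` {1..n}" for s
    using that by (intro stopped_energy_deriv[OF fl' n] sep) auto
qed (use assms in auto)

lemma stopped_energy_le:
  assumes "flow n u \<theta> c x" "\<And>i. i \<in> {1..n} \<Longrightarrow> 0 < \<theta> i" "n \<ge> 1" "0 \<le> t" "t \<le> u"
    and "\<And>s. s \<in> {0..t} \<Longrightarrow> separated n \<theta> c x s"
  shows "stopped_energy n \<theta> c x t \<le> stopped_energy n \<theta> c x 0"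
proof -
  have "stopped_energy n \<theta> c x t - stopped_energy n \<theta> c x 0 \<le> 0"
    by (rule has_integral_le[OF stopped_energy_integral[OF assms] has_integral_0])
      (auto simp: force_sq_def intro!: divide_nonneg_nonneg sum_nonneg)
  then show ?thesis by simp
qed

text \<open>A single particle is controlled by \<open>n\<close> times the second moment. The
  resulting bound grows with \<open>n\<close>; it enters separation distances and Lipschitz
  constants, but never the constant of the theorem.\<close>

lemma gap_sq_le:
  assumes "flow n u \<theta> c x" "\<And>i. i \<in> {1..n} \<Longrightarrow> 0 < \<theta> i" "n \<ge> 1" "0 \<le> t" "t \<le> u"
    and "i \<in> {1..n}" "j \<in> {1..n}"
  shows "(gap x \<theta> i j t)\<^sup>2 \<le> 4 * real n * (B * u + moment n 2 (x 0))"
proof -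
  define s where "s = min t (min (\<theta> i) (\<theta> j))"
  have s: "0 \<le> s" "s \<le> u" using assms(2)[OF assms(6)] assms(2)[OF assms(7)] assms(4,5) by (auto simp: s_def)
  have "(gap x \<theta> i j t)\<^sup>2 \<le> 2 * ((x s i)\<^sup>2 + (x s j)\<^sup>2)"
    using zero_le_power2[of "x s i + x s j"]
    by (simp add: gap_def s_def[symmetric] power2_diff power2_sum)
  also have "\<dots> \<le> 2 * (real n * moment n 2 (x s) + real n * moment n 2 (x s))"
    using sq_le_moment[OF assms(6), of "x s"] sq_le_moment[OF assms(7), of "x s"] by simp
  also have "\<dots> = 4 * real n * moment n 2 (x s)" by simp
  also have "\<dots> \<le> 4 * real n * (B * u + moment n 2 (x 0))"
    using flow_moment2[OF assms(1,3) s] mult_left_mono[OF s(2) B_nonneg]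
    by (intro mult_left_mono) auto
  finally show ?thesis .
qed

text \<open>Up to the first meeting time of two equal charges the energy does not increase, hence \<open>V\<close> stays
  bounded along their gap.\<close>

lemma flow_separation:
  assumes \<theta>: "\<And>i. i \<in> {1..n} \<Longrightarrow> 0 < \<theta> i" and n: "n \<ge> 1" and "0 \<le> T"
    and init: "\<And>i j. i \<in> {1..n} \<Longrightarrow> j \<in> {1..n} \<Longrightarrow> i \<noteq> j \<Longrightarrow> c i * c j = 1 \<Longrightarrow> x0 i \<noteq> x0 j"
  shows "\<exists>\<delta>>0. \<forall>u x t i j. u \<le> T \<longrightarrow> flow n u \<theta> c x \<longrightarrow> (\<forall>i\<in>{1..n}. x 0 i = x0 i) \<longrightarrow> t \<in> {0..u} \<longrightarrow>
    i \<in> {1..n} \<longrightarrow> j \<in> {1..n} \<longrightarrow> i \<noteq> j \<longrightarrow> c i * c j = 1 \<longrightarrow> \<delta> \<le> \<bar>gap x \<theta> i j t\<bar>"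
proof -
  define R2 where "R2 = 4 * real n * (B * T + moment n 2 x0)"
  define m where "m = K * (1 + R2)"
  define E0 where "E0 = stopped_energy n \<theta> c (\<lambda>_. x0) 0"
  \<comment> \<open>Raised by \<open>m\<close>, each of the n^2 pair contributions is non-negative,
    so any one of them is at most their sum, which the initial energy controls. \<open>A\<close> is
    the resulting bound for \<open>V\<close> along a gap; neither \<open>u\<close> nor the flow
    enters it.\<close>
  define A where "A = 2 * (real n)\<^sup>2 * E0 + (real n)\<^sup>2 * m"
  have "eventually (\<lambda>r. V r > A) (at 0)"
    using admissible by (auto simp: admissible_potentials_def filterlim_at_top_dense)
  then obtain \<delta> where \<delta>: "\<delta> > 0" "\<And>r. r \<noteq> 0 \<Longrightarrow> \<bar>r\<bar> < \<delta> \<Longrightarrow> V r > A"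
    by (auto simp: eventually_at dist_real_def)
  \<comment> \<open>The energy argument requires separation on the whole past, as the stopped energy
    is known to be differentiable only there. The assumption is removed below by looking at a first
    contact.\<close>
  have key: "\<delta> \<le> \<bar>gap x \<theta> i j t\<bar>"
    if fl: "flow n u \<theta> c x" and u: "u \<le> T" and x0: "\<forall>i\<in>{1..n}. x 0 i = x0 i" and t: "t \<in> {0..u}"
      and sep: "\<And>s. s \<in> {0..t} \<Longrightarrow> separated n \<theta> c x s"
      and ij: "i \<in> {1..n}" "j \<in> {1..n}" "i \<noteq> j" "c i * c j = 1" for u x t i j
  proof (rule ccontr)
    assume "\<not> \<delta> \<le> \<bar>gap x \<theta> i j t\<bar>"
    moreover have "gap x \<theta> i j t \<noteq> 0" using sep[of t] t ij by (auto simp: separated_def)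
    ultimately have large: "V (gap x \<theta> i j t) > A" using \<delta>(2) by auto
    have "moment n 2 (x 0) = moment n 2 x0" using x0 by (auto simp: moment_def intro!: sum.cong arg_cong2[of _ _ _ _ "(*)"])
    then have R2: "4 * real n * (B * u + moment n 2 (x 0)) \<le> R2"
      unfolding R2_def using mult_left_mono[OF u B_nonneg] by (intro mult_left_mono) auto
    have low: "- pair_pot (c k * c l) (gap x \<theta> k l t) \<le> m" if "k \<in> {1..n}" "l \<in> {1..n}" for k l
    proof -
      have g: "(gap x \<theta> k l t)\<^sup>2 \<le> R2"
        using gap_sq_le[OF fl \<theta> n _ _ that, of t] R2 t by auto
      then have "K * (1 + (gap x \<theta> k l t)\<^sup>2) \<le> m" "0 \<le> m"
        unfolding m_def using K_nonneg order_trans[OF zero_le_power2 g]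
        by (auto intro: mult_left_mono)
      then show ?thesis
        using lower_V[of "gap x \<theta> k l t"] lower_W[of "gap x \<theta> k l t"] by (auto simp: pair_pot_def)
    qed
    let ?w = "\<lambda>k l. if k = l then 0 else pair_pot (c k * c l) (gap x \<theta> k l t)"
    have m0: "0 \<le> m"
      using K_nonneg order_trans[OF zero_le_power2 order_trans[OF gap_sq_le[OF fl \<theta> n _ _ ij(1,2), of t] R2]] t
      by (auto simp: m_def)
    have w0: "0 \<le> ?w k l + m" if "k \<in> {1..n}" "l \<in> {1..n}" for k l
      using low[OF that] m0 by auto
    have "V (gap x \<theta> i j t) \<le> ?w i j + m" using ij m0 by (simp add: pair_pot_def)
    also have "\<dots> \<le> (\<Sum>l\<in>{1..n}. ?w i l + m)"
      using ij w0 by (intro member_le_sum[of j "{1..n}" "\<lambda>l. ?w i l + m"]) auto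
    also have "\<dots> \<le> (\<Sum>k\<in>{1..n}. \<Sum>l\<in>{1..n}. ?w k l + m)"
      using ij w0 by (intro member_le_sum[of i "{1..n}" "\<lambda>k. \<Sum>l\<in>{1..n}. ?w k l + m"] sum_nonneg) auto
    also have "\<dots> = 2 * (real n)\<^sup>2 * stopped_energy n \<theta> c x t + (real n)\<^sup>2 * m"
      using n by (simp add: stopped_energy_def sum.distrib power2_eq_square)
    also have "stopped_energy n \<theta> c x t \<le> stopped_energy n \<theta> c x 0"
      using t by (intro stopped_energy_le[OF fl \<theta> n] sep) auto
    also have "stopped_energy n \<theta> c x 0 = E0"
    proof -
      have "gap x \<theta> i j 0 = gap (\<lambda>_. x0) \<theta> i j 0" if "i \<in> {1..n}" "j \<in> {1..n}" for i j
        using x0 that \<theta>[of i] \<theta>[of j] by (simp add: gap_def)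
      then show ?thesis unfolding E0_def stopped_energy_def
        by (intro arg_cong2[of _ _ _ _ "(*)"] sum.cong refl) auto
    qed
    finally have "V (gap x \<theta> i j t) \<le> A" unfolding A_def using m0 by (simp add: mult_left_mono)
    then show False using large by simp
  qed
  have sep: "separated n \<theta> c x t"
    if fl: "flow n u \<theta> c x" and u: "u \<le> T" and x0: "\<forall>i\<in>{1..n}. x 0 i = x0 i" and t: "t \<in> {0..u}"
    for u x t
  proof (rule ccontr)
    assume nsep: "\<not> separated n \<theta> c x t"
    define P where "P = {(i, j). i \<in> {1..n} \<and> j \<in> {1..n} \<and> i \<noteq> j \<and> c i * c j = 1}"
    define Z where "Z = (\<Union>(i, j)\<in>P. {0..u} \<inter> gap x \<theta> i j -` {0})"
    have Z: "s \<in> Z \<longleftrightarrow> s \<in> {0..u} \<and> \<not> separated n \<theta> c x s" for s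
      by (auto simp: Z_def P_def separated_def simp del: One_nat_def atLeastAtMost_iff)
    have "finite P" by (rule finite_subset[of _ "{1..n} \<times> {1..n}"]) (auto simp: P_def)
    have "closed Z" unfolding Z_def
      using \<open>finite P\<close>
      by (intro closed_UN ballI) (auto simp: P_def intro!: continuous_closed_preimage flow_gap_cont[OF fl] \<theta>)
    moreover have "Z \<subseteq> {0..u}" by (auto simp: Z)
    ultimately have "compact Z" using compact_Int_closed[OF compact_Icc, of Z 0 u] by (simp add: Int_absorb1)
    moreover have "Z \<noteq> {}" using nsep t Z by blast
    ultimately obtain s where s: "s \<in> Z" "\<And>r. r \<in> Z \<Longrightarrow> s \<le> r"
      using compact_attains_inf[of Z] by blast
    then obtain i j where ij: "i \<in> {1..n}" "j \<in> {1..n}" "i \<noteq> j" "c i * c j = 1" "gap x \<theta> i j s = 0"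
      by (auto simp: Z separated_def)
    have "s \<noteq> 0"
      using ij init[of i j] x0 \<theta>[of i] \<theta>[of j] by (auto simp: gap_def)
    then have "0 < s" "s \<le> u" using s(1) by (auto simp: Z)
    \<comment> \<open>Strictly before the first contact the bound holds with the fixed
      \<open>\<delta>\<close>, and by continuity it persists at the contact, where the gap should be
      0.\<close>
    have big: "\<delta> \<le> \<bar>gap x \<theta> i j r\<bar>" if "0 < r" "r < s" for r
    proof (rule key[OF fl u x0 _ _ ij(1-4)])
      show "separated n \<theta> c x q" if "q \<in> {0..r}" for q
        using s(2)[of q] that \<open>r < s\<close> \<open>s \<le> u\<close> by (force simp: Z)
    qed (use that \<open>s \<le> u\<close> in auto)
    have "continuous_on {0..s} (gap x \<theta> i j)"
      by (rule continuous_on_subset[OF flow_gap_cont[OF fl ij(1,2) \<theta>]]) (use \<open>s \<le> u\<close> in auto)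
    then have "(gap x \<theta> i j \<longlongrightarrow> gap x \<theta> i j s) (at s within {0..s})"
      using \<open>0 < s\<close> by (auto simp: continuous_on)
    then have "(gap x \<theta> i j \<longlongrightarrow> gap x \<theta> i j s) (at_left s)"
      using \<open>0 < s\<close> by (simp add: at_within_Icc_at_left)
    then have "((\<lambda>r. \<bar>gap x \<theta> i j r\<bar>) \<longlongrightarrow> \<bar>gap x \<theta> i j s\<bar>) (at_left s)"
      by (rule tendsto_rabs)
    moreover have "eventually (\<lambda>r. \<delta> \<le> \<bar>gap x \<theta> i j r\<bar>) (at_left s)"
      using eventually_at_left_real[OF \<open>0 < s\<close>] by eventually_elim (use big in auto)
    ultimately have "\<delta> \<le> \<bar>gap x \<theta> i j s\<bar>"
      by (intro tendsto_lowerbound) auto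
    then show False using ij(5) \<delta>(1) by simp
  qed
  show ?thesis
    using \<delta>(1) by (intro exI[of _ \<delta>] conjI allI impI key) (auto intro!: sep)
qed

end

section \<open>Energy along flows\<close>

text \<open>The jumps accumulated up to \<open>r\<close> depend on \<open>r\<close> only through
  this intersection. That it is constant right after \<open>t\<close>, and that right before
  \<open>t\<close> it lacks at most \<open>t\<close> itself, gives right-continuity and left limits
  of the energy.\<close>

lemma eventually_at_right_Int_atMost:
  fixes F :: "real set"
  assumes "finite F"
  shows "eventually (\<lambda>r. F \<inter> {..r} = F \<inter> {..t}) (at_right t)"
proof -
  have "eventually (\<lambda>r. \<forall>s\<in>F. s \<le> r \<longleftrightarrow> s \<le> t) (at_right t)"
  proof (rule eventually_ball_finite[OF assms], rule ballI)
    fix s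
    show "eventually (\<lambda>r. s \<le> r \<longleftrightarrow> s \<le> t) (at_right t)"
    proof (cases "s \<le> t")
      case True
      show ?thesis using eventually_at_right_less[of t] by eventually_elim (use True in auto)
    next
      case False
      then show ?thesis using eventually_at_right_real[of t s] by (auto elim: eventually_mono)
    qed
  qed
  then show ?thesis by eventually_elim auto
qed

lemma eventually_at_left_Int_atMost:
  fixes F :: "real set"
  assumes "finite F"
  shows "eventually (\<lambda>r. F \<inter> {..r} = F \<inter> {..<t}) (at_left t)"
proof -
  have "eventually (\<lambda>r. \<forall>s\<in>F. s \<le> r \<longleftrightarrow> s < t) (at_left t)"
  proof (rule eventually_ball_finite[OF assms], rule ballI)
    fix s
    show "eventually (\<lambda>r. s \<le> r \<longleftrightarrow> s < t) (at_left t)"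
    proof (cases "s < t")
      case True
      then show ?thesis using eventually_at_left_real[of s t] by (auto elim: eventually_mono)
    next
      case False
      then show ?thesis using eventually_at_left_real[of "t - 1" t] by (auto elim: eventually_mono)
    qed
  qed
  then show ?thesis by eventually_elim auto
qed

context pair_potentials
begin

lemma flow_frozen:
  assumes fl: "flow n u \<theta> c x" and i: "i \<in> {1..n}" and "0 \<le> s" "\<theta> i \<le> s" "s \<le> t" "t \<le> u"
  shows "x t i = x s i"
proof -
  have "((\<lambda>_. 0) has_integral x t i - x s i) {s..t}"
  proof (rule has_integral_real_derivative[of "\<theta> ` {1..n}"])
    show "continuous_on {s..t} (\<lambda>t. x t i)"
      by (rule continuous_on_subset[OF flow_cont[OF fl i]]) (use assms in auto)
    fix r assume r: "r \<in> {s<..<t} - \<theta> ` {1..n}"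
    then have "((\<lambda>s. x s i) has_real_derivative force n (alive c \<theta> r) (x r) i) (at r)"
      using assms by (intro flow_deriv[OF fl i]) auto
    moreover have "alive c \<theta> r i = 0" using r assms by (auto simp: alive_def)
    then have "force n (alive c \<theta> r) (x r) i = 0" by (simp add: force_def)
    ultimately show "((\<lambda>s. x s i) has_real_derivative 0) (at r)" by simp
  qed (use assms in auto)
  then have "x t i - x s i = 0" using has_integral_0 has_integral_unique by blast
  then show ?thesis by simp
qed

section \<open>The energy as stopped energy plus accumulated jumps\<close>

definition live_energy :: "nat \<Rightarrow> (nat \<Rightarrow> real) \<Rightarrow> (nat \<Rightarrow> int) \<Rightarrow> real" where
  "live_energy n y a = 1 / (2 * (real n)\<^sup>2) *
     (\<Sum>i\<in>{1..n}. \<Sum>j\<in>{1..n}. if i = j then 0 else pair_pot (a i * a j) (y i - y j))"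

text \<open>The value \<infinity> could come only from equal charges at one position. Excluding the
  diagonal from the \<open>W\<close> sum as well changes nothing, because a square is never
  -1.\<close>

lemma energy_eq_live_energy:
  assumes "\<And>i j. i \<in> {1..n} \<Longrightarrow> j \<in> {1..n} \<Longrightarrow> i \<noteq> j \<Longrightarrow> a i * a j = 1 \<Longrightarrow> y i \<noteq> y j"
    and b: "\<And>i. i \<in> {1..n} \<Longrightarrow> b i = a i"
  shows "energy V W n y b = ereal (live_energy n y a)"
proof -
  have sq: "a i * a i \<noteq> - 1" for i using zero_le_square[of "a i"] by linarith
  have inner: "(\<Sum>j\<in>{j \<in> {1..n}. j \<noteq> i \<and> b i * b j = 1}. pot_ext V (y i - y j)) +
      (\<Sum>j\<in>{j \<in> {1..n}. b i * b j = - 1}. ereal (W (y i - y j))) =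
    ereal (\<Sum>j\<in>{1..n}. if i = j then 0 else pair_pot (a i * a j) (y i - y j))" (is "?l = _")
    if i: "i \<in> {1..n}" for i
  proof -
    have "?l = (\<Sum>j\<in>{1..n}. (if j \<noteq> i \<and> b i * b j = 1 then pot_ext V (y i - y j) else 0) +
        (if b i * b j = - 1 then ereal (W (y i - y j)) else 0))"
      by (simp only: sum.distrib sum.inter_filter[OF finite_atLeastAtMost])
    also have "\<dots> = (\<Sum>j\<in>{1..n}. ereal (if i = j then 0 else pair_pot (a i * a j) (y i - y j)))"
    proof (rule sum.cong[OF refl])
      fix j assume j: "j \<in> {1..n}"
      show "(if j \<noteq> i \<and> b i * b j = 1 then pot_ext V (y i - y j) else 0) +
          (if b i * b j = - 1 then ereal (W (y i - y j)) else 0) =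
        ereal (if i = j then 0 else pair_pot (a i * a j) (y i - y j))"
        using assms(1)[OF i j] sq[of i] unfolding b[OF i] b[OF j]
        by (auto simp: pot_ext_def pair_pot_def)
    qed
    finally show ?thesis by (simp only: sum_ereal)
  qed
  have "(\<Sum>i\<in>{1..n}. (\<Sum>j\<in>{j \<in> {1..n}. j \<noteq> i \<and> b i * b j = 1}. pot_ext V (y i - y j)) +
      (\<Sum>j\<in>{j \<in> {1..n}. b i * b j = - 1}. ereal (W (y i - y j)))) =
    (\<Sum>i\<in>{1..n}. ereal (\<Sum>j\<in>{1..n}. if i = j then 0 else pair_pot (a i * a j) (y i - y j)))"
    by (rule sum.cong[OF refl inner])
  also have "\<dots> = ereal (\<Sum>i\<in>{1..n}. \<Sum>j\<in>{1..n}. if i = j then 0 else pair_pot (a i * a j) (y i - y j))"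
    by (rule sum_ereal)
  finally show ?thesis
    unfolding energy_def live_energy_def by simp
qed

text \<open>The jump of the energy at a death time \<open>s\<close>: the interactions of the particles dying at \<open>s\<close>
  are removed.\<close>

definition death_jump :: "nat \<Rightarrow> (nat \<Rightarrow> real) \<Rightarrow> (nat \<Rightarrow> int) \<Rightarrow> (real \<Rightarrow> nat \<Rightarrow> real) \<Rightarrow> real \<Rightarrow> real" where
  "death_jump n \<theta> c x s = - (1 / (2 * (real n)\<^sup>2)) * (\<Sum>i\<in>{1..n}. \<Sum>j\<in>{1..n}.
     if i \<noteq> j \<and> min (\<theta> i) (\<theta> j) = s then pair_pot (c i * c j) (x s i - x s j) else 0)"

text \<open>Pair by pair: a living pair contributes equally to both energies and has not jumped yet;
  a pair with a dead member contributes nothing to the live energy, and its frozen contribution is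
  cancelled by its single jump at the first death.\<close>

lemma live_energy_decomposition:
  "live_energy n (x t) (alive c \<theta> t) =
     stopped_energy n \<theta> c x t + (\<Sum>s\<in>\<theta> ` {1..n} \<inter> {..t}. death_jump n \<theta> c x s)"
proof -
  let ?F = "\<theta> ` {1..n} \<inter> {..t}"
  let ?q = "\<lambda>i j s. if i \<noteq> j \<and> min (\<theta> i) (\<theta> j) = s then pair_pot (c i * c j) (x s i - x s j) else 0"
  have pair: "(if i = j then 0 else pair_pot (alive c \<theta> t i * alive c \<theta> t j) (x t i - x t j)) =
      (if i = j then 0 else pair_pot (c i * c j) (gap x \<theta> i j t)) - (\<Sum>s\<in>?F. ?q i j s)"
    if ij: "i \<in> {1..n}" "j \<in> {1..n}" for i j
  proof -
    let ?m = "min (\<theta> i) (\<theta> j)"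
    consider "i = j" | "i \<noteq> j" "t < ?m" | "i \<noteq> j" "?m \<le> t" by fastforce
    then show ?thesis
    proof cases
      case 1 then show ?thesis by simp
    next
      case 2
      have "(\<Sum>s\<in>?F. ?q i j s) = 0" using 2 by (intro sum.neutral) auto
      moreover have "gap x \<theta> i j t = x t i - x t j" using 2 by (simp add: gap_def)
      ultimately show ?thesis using 2 by (simp only: alive_mult if_True if_False refl if_cancel)
    next
      case 3
      have "?m \<in> ?F" using ij 3(2) by (auto simp: min_def)
      then have "(\<Sum>s\<in>?F. ?q i j s) = pair_pot (c i * c j) (x ?m i - x ?m j)"
        using 3(1) by simp
      moreover have "gap x \<theta> i j t = x ?m i - x ?m j" using 3 by (simp add: gap_def min_absorb2)
      moreover have "\<not> t < ?m" using 3(2) by (simp only: not_less)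
      ultimately show ?thesis using 3(1) by (simp only: alive_mult if_False pair_pot_0)
    qed
  qed
  have "(\<Sum>s\<in>?F. death_jump n \<theta> c x s) =
      - (1 / (2 * (real n)\<^sup>2)) * (\<Sum>s\<in>?F. \<Sum>i\<in>{1..n}. \<Sum>j\<in>{1..n}. ?q i j s)"
    unfolding death_jump_def sum_distrib_left[symmetric] by (rule refl)
  also have "(\<Sum>s\<in>?F. \<Sum>i\<in>{1..n}. \<Sum>j\<in>{1..n}. ?q i j s) = (\<Sum>i\<in>{1..n}. \<Sum>s\<in>?F. \<Sum>j\<in>{1..n}. ?q i j s)"
    by (rule sum.swap)
  also have "\<dots> = (\<Sum>i\<in>{1..n}. \<Sum>j\<in>{1..n}. \<Sum>s\<in>?F. ?q i j s)"
    by (intro sum.cong refl sum.swap)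
  finally have "(\<Sum>s\<in>?F. death_jump n \<theta> c x s) =
    - (1 / (2 * (real n)\<^sup>2)) * (\<Sum>i\<in>{1..n}. \<Sum>j\<in>{1..n}. \<Sum>s\<in>?F. ?q i j s)" .
  moreover have "live_energy n (x t) (alive c \<theta> t) = 1 / (2 * (real n)\<^sup>2) *
     (\<Sum>i\<in>{1..n}. \<Sum>j\<in>{1..n}. (if i = j then 0 else pair_pot (c i * c j) (gap x \<theta> i j t)) - (\<Sum>s\<in>?F. ?q i j s))"
    unfolding live_energy_def by (intro arg_cong2[of _ _ _ _ "(*)"] sum.cong refl pair)
  ultimately show ?thesis
    unfolding stopped_energy_def sum_subtractf right_diff_distrib by linarith
qed

text \<open>Removing an interaction costs at most the quadratic lower bound of its potential. Every
  removed pair has a dying member; summing over the other member turns squares into \<open>n\<close>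
  times the second moment, so the prefactor of order 1/n^2 becomes one of order 1/n.\<close>

lemma death_jump_le:
  fixes \<theta> :: "nat \<Rightarrow> real"
  assumes n: "n \<ge> 1"
  defines "\<Gamma> \<equiv> \<lambda>s. {i \<in> {1..n}. \<theta> i = s}"
  shows "death_jump n \<theta> c x s \<le>
    2 * K / real n * (real (card (\<Gamma> s)) * moment n 2 (x s) + real (card (\<Gamma> s)) + (\<Sum>i\<in>\<Gamma> s. (x s i)\<^sup>2))"
proof -
  let ?G = "\<Gamma> s"
  define h where "h i j = K * (1 + 2 * (x s i)\<^sup>2 + 2 * (x s j)\<^sup>2)" for i j
  have h0: "h i j \<ge> 0" for i j using K_nonneg by (simp add: h_def)
  have fin: "finite ?G" by (simp add: \<Gamma>_def)
  have low: "- pair_pot (c i * c j) (x s i - x s j) \<le> h i j" for i j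
  proof -
    have "- pair_pot (c i * c j) (x s i - x s j) \<le> K * (1 + (x s i - x s j)\<^sup>2)"
      using lower_V[of "x s i - x s j"] lower_W[of "x s i - x s j"] K_nonneg
      by (auto simp: pair_pot_def)
    also have "\<dots> \<le> h i j" unfolding h_def
    proof (intro mult_left_mono K_nonneg)
      show "1 + (x s i - x s j)\<^sup>2 \<le> 1 + 2 * (x s i)\<^sup>2 + 2 * (x s j)\<^sup>2"
        using zero_le_power2[of "x s i + x s j"] by (simp add: power2_diff power2_sum)
    qed
    finally show ?thesis .
  qed
  have "death_jump n \<theta> c x s = 1 / (2 * (real n)\<^sup>2) * (\<Sum>i\<in>{1..n}. \<Sum>j\<in>{1..n}.
     if i \<noteq> j \<and> min (\<theta> i) (\<theta> j) = s then - pair_pot (c i * c j) (x s i - x s j) else 0)"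
  proof -
    have "(\<Sum>i\<in>{1..n}. \<Sum>j\<in>{1..n}.
        if i \<noteq> j \<and> min (\<theta> i) (\<theta> j) = s then - pair_pot (c i * c j) (x s i - x s j) else 0) =
      - (\<Sum>i\<in>{1..n}. \<Sum>j\<in>{1..n}.
        if i \<noteq> j \<and> min (\<theta> i) (\<theta> j) = s then pair_pot (c i * c j) (x s i - x s j) else 0)"
      unfolding sum_negf[symmetric] by (intro sum.cong refl) auto
    then show ?thesis unfolding death_jump_def by simp
  qed
  \<comment> \<open>A pair is charged to each of its dying members. As \<open>h\<close> is
    symmetric, the two halves agree after exchanging the indices.\<close>
  also have "\<dots> \<le> 1 / (2 * (real n)\<^sup>2) * (\<Sum>i\<in>{1..n}. \<Sum>j\<in>{1..n}.
     (if i \<in> ?G then h i j else 0) + (if j \<in> ?G then h i j else 0))"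
  proof (intro mult_left_mono sum_mono)
    fix i j assume "i \<in> {1..n}" "j \<in> {1..n}"
    then show "(if i \<noteq> j \<and> min (\<theta> i) (\<theta> j) = s then - pair_pot (c i * c j) (x s i - x s j) else 0) \<le>
        (if i \<in> ?G then h i j else 0) + (if j \<in> ?G then h i j else 0)"
      using low[of i j] h0[of i j] by (auto simp: \<Gamma>_def min_def)
  qed simp
  also have "(\<Sum>i\<in>{1..n}. \<Sum>j\<in>{1..n}. (if i \<in> ?G then h i j else 0) + (if j \<in> ?G then h i j else 0)) =
     (\<Sum>i\<in>{1..n}. \<Sum>j\<in>{1..n}. if i \<in> ?G then h i j else 0) +
     (\<Sum>j\<in>{1..n}. \<Sum>i\<in>{1..n}. if j \<in> ?G then h i j else 0)"
    unfolding sum.distrib by (intro arg_cong2[of _ _ _ _ "(+)"] refl sum.swap)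
  also have "(\<Sum>j\<in>{1..n}. \<Sum>i\<in>{1..n}. if j \<in> ?G then h i j else 0) =
     (\<Sum>i\<in>{1..n}. \<Sum>j\<in>{1..n}. if i \<in> ?G then h i j else 0)"
    by (intro sum.cong refl) (simp add: h_def algebra_simps)
  also have "(\<Sum>i\<in>{1..n}. \<Sum>j\<in>{1..n}. if i \<in> ?G then h i j else 0) =
     (\<Sum>i\<in>{1..n}. if i \<in> ?G then \<Sum>j\<in>{1..n}. h i j else 0)"
    by (intro sum.cong refl) auto
  also have "\<dots> = (\<Sum>i\<in>?G. \<Sum>j\<in>{1..n}. h i j)"
    unfolding sum.inter_filter[OF finite_atLeastAtMost, symmetric] by (rule sum.cong) (auto simp: \<Gamma>_def)
  also have "\<dots> = (\<Sum>i\<in>?G. K * real n * (1 + 2 * (x s i)\<^sup>2 + 2 * moment n 2 (x s)))"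
    using n by (intro sum.cong refl)
      (simp add: h_def moment_def sum.distrib sum_distrib_left[symmetric] algebra_simps)
  also have "\<dots> = K * real n * (real (card ?G) + 2 * (\<Sum>i\<in>?G. (x s i)\<^sup>2) + 2 * (real (card ?G) * moment n 2 (x s)))"
    unfolding sum_distrib_left[symmetric] by (simp add: sum.distrib sum_distrib_left[symmetric])
  also have "1 / (2 * (real n)\<^sup>2) * (\<dots> + \<dots>) =
     K / real n * (real (card ?G) + 2 * (\<Sum>i\<in>?G. (x s i)\<^sup>2) + 2 * (real (card ?G) * moment n 2 (x s)))"
    using n by (simp add: power2_eq_square)
  also have "\<dots> \<le> K / real n * (2 * (real (card ?G) * moment n 2 (x s) + real (card ?G) + (\<Sum>i\<in>?G. (x s i)\<^sup>2)))"
    using K_nonneg by (intro mult_left_mono) auto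
  finally show ?thesis by (simp add: mult_ac)
qed

text \<open>Each particle dies at most once and stays where it died. So the squares taken at the
  various death times add up to a part of the second moment at the single time \<open>t\<close>, and
  the total is bounded however many collisions occur.\<close>

lemma sum_death_jump_le:
  assumes fl: "flow n u \<theta> c x" and \<theta>: "\<And>i. i \<in> {1..n} \<Longrightarrow> 0 < \<theta> i" and n: "n \<ge> 1"
    and t: "0 \<le> t" "t \<le> u"
  shows "(\<Sum>s\<in>\<theta> ` {1..n} \<inter> {..t}. death_jump n \<theta> c x s) \<le>
    4 * K * (B + 1) * (t + moment n 2 (x 0) + 1)"
proof -
  define S where "S = {i \<in> {1..n}. \<theta> i \<le> t}"
  define g where "g i = moment n 2 (x (\<theta> i)) + 1 + (x (\<theta> i) i)\<^sup>2" for i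
  have S: "\<theta> ` {1..n} \<inter> {..t} = \<theta> ` S" "finite S" "S \<subseteq> {1..n}"
    by (auto simp: S_def)
  then have cardS: "card S \<le> n"
    using card_mono[OF finite_atLeastAtMost S(3)] by simp
  have "(\<Sum>s\<in>\<theta> ` S. death_jump n \<theta> c x s) \<le>
      (\<Sum>s\<in>\<theta> ` S. 2 * K / real n * (\<Sum>i\<in>{i \<in> S. \<theta> i = s}. g i))"
  proof (rule sum_mono)
    fix s assume "s \<in> \<theta> ` S"
    then have eq: "{i \<in> {1..n}. \<theta> i = s} = {i \<in> S. \<theta> i = s}" by (auto simp: S_def)
    have "(\<Sum>i\<in>{i \<in> S. \<theta> i = s}. g i) = (\<Sum>i\<in>{i \<in> S. \<theta> i = s}. moment n 2 (x s) + 1 + (x s i)\<^sup>2)"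
      by (rule sum.cong) (auto simp: g_def)
    then show "death_jump n \<theta> c x s \<le> 2 * K / real n * (\<Sum>i\<in>{i \<in> S. \<theta> i = s}. g i)"
      using death_jump_le[OF n, of \<theta> c x s] unfolding eq by (simp add: sum.distrib distrib_left)
  qed
  also have "\<dots> = 2 * K / real n * (\<Sum>i\<in>S. g i)"
    unfolding sum_distrib_left[symmetric] sum.image_gen[OF S(2), of g \<theta>] ..
  also have "(\<Sum>i\<in>S. g i) \<le> (\<Sum>i\<in>S. B * t + moment n 2 (x 0) + 1 + (x t i)\<^sup>2)"
  proof (rule sum_mono)
    fix i assume i: "i \<in> S"
    then have i': "i \<in> {1..n}" "0 < \<theta> i" "\<theta> i \<le> t" using \<theta> by (auto simp: S_def)
    have "moment n 2 (x (\<theta> i)) \<le> B * \<theta> i + moment n 2 (x 0)"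
      using i' t by (intro flow_moment2[OF fl n]) auto
    also have "B * \<theta> i \<le> B * t" using i' B_nonneg by (intro mult_left_mono) auto
    finally show "g i \<le> B * t + moment n 2 (x 0) + 1 + (x t i)\<^sup>2"
      using flow_frozen[OF fl i'(1) _ order_refl i'(3) t(2)] i'(2) by (simp add: g_def)
  qed
  also have "\<dots> = real (card S) * (B * t + moment n 2 (x 0) + 1) + (\<Sum>i\<in>S. (x t i)\<^sup>2)"
    by (simp add: sum.distrib algebra_simps)
  also have "\<dots> \<le> real n * (B * t + moment n 2 (x 0) + 1) + real n * (B * t + moment n 2 (x 0))"
  proof (rule add_mono)
    show "real (card S) * (B * t + moment n 2 (x 0) + 1) \<le> real n * (B * t + moment n 2 (x 0) + 1)"
      using cardS B_nonneg t moment_nonneg[of n 2 "x 0"] by (intro mult_right_mono) auto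
    have "(\<Sum>i\<in>S. (x t i)\<^sup>2) \<le> (\<Sum>i\<in>{1..n}. (x t i)\<^sup>2)"
      by (rule sum_mono2) (auto simp: S_def)
    also have "\<dots> = real n * moment n 2 (x t)" using n by (simp add: moment_def)
    also have "\<dots> \<le> real n * (B * t + moment n 2 (x 0))"
      using flow_moment2[OF fl n t] by (intro mult_left_mono) auto
    finally show "(\<Sum>i\<in>S. (x t i)\<^sup>2) \<le> real n * (B * t + moment n 2 (x 0))" .
  qed
  also have "\<dots> = real n * (2 * (B * t) + 2 * moment n 2 (x 0) + 1)" by (simp add: algebra_simps)
  finally have "(\<Sum>s\<in>\<theta> ` S. death_jump n \<theta> c x s) \<le>
     2 * K / real n * (real n * (2 * (B * t) + 2 * moment n 2 (x 0) + 1))"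
    using K_nonneg by (simp add: mult_left_mono divide_right_mono)
  also have "\<dots> = 2 * K * (2 * (B * t) + 2 * moment n 2 (x 0) + 1)" using n by simp
  also have "\<dots> \<le> 2 * K * (2 * ((B + 1) * (t + moment n 2 (x 0) + 1)))"
    using K_nonneg B_nonneg t moment_nonneg[of n 2 "x 0"]
    by (intro mult_left_mono) (simp_all add: algebra_simps)
  finally show ?thesis unfolding S(1) by (simp add: algebra_simps)
qed

context
  fixes n T \<theta> c x e
  assumes fl: "flow n T \<theta> c x" and \<theta>: "\<And>i. i \<in> {1..n} \<Longrightarrow> 0 < \<theta> i" and n: "n \<ge> 1"
    and sep: "\<And>t. t \<in> {0..T} \<Longrightarrow> separated n \<theta> c x t"
    and e: "\<And>t. t \<in> {0..T} \<Longrightarrow> e t = live_energy n (x t) (alive c \<theta> t)"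
begin

lemma energy_split:
  "t \<in> {0..T} \<Longrightarrow> e t = stopped_energy n \<theta> c x t + (\<Sum>s\<in>\<theta> ` {1..n} \<inter> {..t}. death_jump n \<theta> c x s)"
  by (simp add: e live_energy_decomposition)

lemma flow_energy_right:
  assumes t: "t \<in> {0..<T}"
  shows "continuous (at_right t) e"
proof -
  have tT: "t < T" using t by simp
  have "continuous_on {t..T} (stopped_energy n \<theta> c x)"
    by (rule continuous_on_subset[OF stopped_energy_cont[OF fl \<theta> sep]]) (use t in simp_all)
  then have "(stopped_energy n \<theta> c x \<longlongrightarrow> stopped_energy n \<theta> c x t) (at t within {t..T})"
    using t by (simp add: continuous_on_def)
  then have "(stopped_energy n \<theta> c x \<longlongrightarrow> stopped_energy n \<theta> c x t) (at_right t)"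
    using t by (simp add: at_within_Icc_at_right)
  then have "((\<lambda>r. stopped_energy n \<theta> c x r + (\<Sum>s\<in>\<theta> ` {1..n} \<inter> {..t}. death_jump n \<theta> c x s)) \<longlongrightarrow> e t) (at_right t)"
    using t by (auto simp: energy_split intro!: tendsto_intros)
  moreover have "eventually (\<lambda>r. stopped_energy n \<theta> c x r +
      (\<Sum>s\<in>\<theta> ` {1..n} \<inter> {..t}. death_jump n \<theta> c x s) = e r) (at_right t)"
    using eventually_at_right_Int_atMost[OF finite_imageI[OF finite_atLeastAtMost], of \<theta> 1 n t]
      eventually_at_right_real[of t T, OF tT]
  proof eventually_elim
    case (elim r)
    then have "r \<in> {0..T}" using t by auto
    then show ?case using energy_split[of r] elim(1) by (simp only: True_implies_equals)
  qed
  ultimately show ?thesis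
    unfolding continuous_within by (rule Lim_transform_eventually)
qed

lemma flow_energy_left:
  assumes t: "t \<in> {0<..T}"
  shows "(e \<longlongrightarrow> stopped_energy n \<theta> c x t + (\<Sum>s\<in>\<theta> ` {1..n} \<inter> {..<t}. death_jump n \<theta> c x s)) (at_left t)"
proof -
  have t0: "0 < t" using t by simp
  have "continuous_on {0..t} (stopped_energy n \<theta> c x)"
    by (rule continuous_on_subset[OF stopped_energy_cont[OF fl \<theta> sep]]) (use t in simp_all)
  then have "(stopped_energy n \<theta> c x \<longlongrightarrow> stopped_energy n \<theta> c x t) (at t within {0..t})"
    using t by (simp add: continuous_on_def)
  then have "(stopped_energy n \<theta> c x \<longlongrightarrow> stopped_energy n \<theta> c x t) (at_left t)"
    using t by (simp add: at_within_Icc_at_left)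
  then have "((\<lambda>r. stopped_energy n \<theta> c x r + (\<Sum>s\<in>\<theta> ` {1..n} \<inter> {..<t}. death_jump n \<theta> c x s)) \<longlongrightarrow>
     stopped_energy n \<theta> c x t + (\<Sum>s\<in>\<theta> ` {1..n} \<inter> {..<t}. death_jump n \<theta> c x s)) (at_left t)"
    by (intro tendsto_intros)
  moreover have "eventually (\<lambda>r. stopped_energy n \<theta> c x r +
      (\<Sum>s\<in>\<theta> ` {1..n} \<inter> {..<t}. death_jump n \<theta> c x s) = e r) (at_left t)"
    using eventually_at_left_Int_atMost[OF finite_imageI[OF finite_atLeastAtMost], of \<theta> 1 n t]
      eventually_at_left_real[of 0 t, OF t0]
  proof eventually_elim
    case (elim r)
    then have "r \<in> {0..T}" using t by auto
    then show ?case using energy_split[of r] elim(1) by (simp only: True_implies_equals)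
  qed
  ultimately show ?thesis by (rule Lim_transform_eventually)
qed

lemma flow_energy_jump:
  assumes t: "t \<in> {0<..T}" "t \<in> \<theta> ` {1..n}"
  shows "jump e t = death_jump n \<theta> c x t"
proof -
  let ?F = "\<theta> ` {1..n}"
  have "Lim (at_left t) e = stopped_energy n \<theta> c x t + (\<Sum>s\<in>?F \<inter> {..<t}. death_jump n \<theta> c x s)"
    by (rule tendsto_Lim[OF _ flow_energy_left[OF t(1)]]) simp
  moreover have "?F \<inter> {..t} = insert t (?F \<inter> {..<t})" using t(2) by auto
  then have "(\<Sum>s\<in>?F \<inter> {..t}. death_jump n \<theta> c x s) =
      death_jump n \<theta> c x t + (\<Sum>s\<in>?F \<inter> {..<t}. death_jump n \<theta> c x s)" by simp
  ultimately show ?thesis using t by (simp add: jump_def energy_split)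
qed

lemma flow_energy_deriv:
  assumes t: "t \<in> {0<..<T} - \<theta> ` {1..n}"
  shows "(e has_real_derivative - (1 / real n) * force_sq n \<theta> c x t) (at t)"
proof -
  let ?F = "\<theta> ` {1..n}"
  let ?D = "\<Sum>s\<in>?F \<inter> {..t}. death_jump n \<theta> c x s"
  have "separated n \<theta> c x t" using t by (intro sep) auto
  then have d: "((\<lambda>r. stopped_energy n \<theta> c x r + ?D) has_real_derivative - (1 / real n) * force_sq n \<theta> c x t) (at t)"
    using stopped_energy_deriv[OF fl n t] by (auto intro!: derivative_eq_intros)
  have "eventually (\<lambda>r. r \<in> {0<..<T} \<and> ?F \<inter> {..r} = ?F \<inter> {..t}) (at_left t)"
  proof -
    have "?F \<inter> {..<t} = ?F \<inter> {..t}" using t less_eq_real_def by auto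
    moreover have "0 < t" "t < T" using t by auto
    ultimately show ?thesis
      using eventually_at_left_Int_atMost[of ?F t] eventually_at_left_real[of 0 t]
      by (auto elim: eventually_elim2)
  qed
  moreover have "eventually (\<lambda>r. r \<in> {0<..<T} \<and> ?F \<inter> {..r} = ?F \<inter> {..t}) (at_right t)"
  proof -
    have "0 < t" "t < T" using t by auto
    then show ?thesis
      using eventually_at_right_Int_atMost[of ?F t] eventually_at_right_real[of t T]
      by (auto elim: eventually_elim2)
  qed
  ultimately have "eventually (\<lambda>r. r \<in> {0<..<T} \<and> ?F \<inter> {..r} = ?F \<inter> {..t}) (at t)"
    by (simp only: eventually_at_split)
  then have "eventually (\<lambda>r. r \<in> {0<..<T} \<and> ?F \<inter> {..r} = ?F \<inter> {..t}) (nhds t)"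
    using t by (auto simp: eventually_nhds_conv_at)
  then have ev: "eventually (\<lambda>r. stopped_energy n \<theta> c x r + ?D = e r) (nhds t)"
  proof eventually_elim
    case (elim r)
    then have "r \<in> {0..T}" by auto
    then show ?case unfolding energy_split[OF \<open>r \<in> {0..T}\<close>] using elim by simp
  qed
  from iffD1[OF DERIV_cong_ev[OF refl ev refl] d] show ?thesis .
qed

lemma flow_speed_sq:
  assumes t: "t \<in> {0..T}"
  shows "speed_sq n x integrable_on {0..t}"
    and "e t - e 0 = - (1 / real n) * integral {0..t} (speed_sq n x) + (\<Sum>s\<in>\<theta> ` {1..n} \<inter> {..t}. death_jump n \<theta> c x s)"
proof -
  let ?\<Delta> = "stopped_energy n \<theta> c x t - stopped_energy n \<theta> c x 0"
  have "((\<lambda>s. - (1 / real n) * force_sq n \<theta> c x s) has_integral ?\<Delta>) {0..t}"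
    using t by (intro stopped_energy_integral[OF fl \<theta> n] sep) auto
  from has_integral_mult_right[OF this, of "- real n"]
  have "(force_sq n \<theta> c x has_integral - real n * ?\<Delta>) {0..t}" using n by simp
  \<comment> \<open>\<open>speed_sq\<close> is built from \<open>deriv\<close>, whose value at death
    times and end points is not under control; these are finitely many points.\<close>
  then have "(speed_sq n x has_integral - real n * ?\<Delta>) {0..t}"
  proof (rule has_integral_spike_finite[of "insert 0 (insert t (\<theta> ` {1..n}))", rotated 2])
    fix s assume "s \<in> {0..t} - insert 0 (insert t (\<theta> ` {1..n}))"
    then have "s \<in> {0<..<T} - \<theta> ` {1..n}" using t by auto
    then have "deriv (\<lambda>r. x r i) s = force n (alive c \<theta> s) (x s) i" if "i \<in> {1..n}" for i
      using that by (intro DERIV_imp_deriv flow_deriv[OF fl])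
    then show "speed_sq n x s = force_sq n \<theta> c x s"
      unfolding speed_sq_def force_sq_def by (intro sum.cong refl) simp
  qed auto
  then show "speed_sq n x integrable_on {0..t}" 
    "e t - e 0 = - (1 / real n) * integral {0..t} (speed_sq n x) + (\<Sum>s\<in>\<theta> ` {1..n} \<inter> {..t}. death_jump n \<theta> c x s)"
  proof -
    assume I: "(speed_sq n x has_integral - real n * ?\<Delta>) {0..t}"
    have "\<theta> ` {1..n} \<inter> {..0} = {}" using \<theta> by force
    then have "e 0 = stopped_energy n \<theta> c x 0" using energy_split[of 0] t by simp
    then show "e t - e 0 = - (1 / real n) * integral {0..t} (speed_sq n x) +
        (\<Sum>s\<in>\<theta> ` {1..n} \<inter> {..t}. death_jump n \<theta> c x s)"
      using energy_split[OF t] n integral_unique[OF I] by simp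
  qed (auto simp: has_integral_integrable)
qed

end

end

section \<open>Uniqueness\<close>

context pair_potentials
begin

text \<open>A locally Lipschitz function is Lipschitz on compact sets, here on both components of
  \<open>\<delta> \<le> \<bar>r\<bar> \<le> R\<close> together. The signs of \<open>r\<close> and
  \<open>s\<close> may differ, since nothing says beforehand that two flows order a pair
  alike.\<close>

lemma pair_force_lipschitz:
  assumes "0 < \<delta>"
  shows "\<exists>L\<ge>0. \<forall>\<sigma> r s. (\<sigma> = 1 \<longrightarrow> {\<bar>r\<bar>, \<bar>s\<bar>} \<subseteq> {\<delta>..R}) \<longrightarrow>
    \<bar>pair_force \<sigma> r - pair_force \<sigma> s\<bar> \<le> L * \<bar>r - s\<bar>"
proof -
  obtain L1 where L1: "L1-lipschitz_on UNIV (deriv W)"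
    using admissible by (auto simp: admissible_potentials_def)
  define X where "X = {- R..- \<delta>} \<union> {\<delta>..R}"
  \<comment> \<open>\<open>local_lipschitz\<close> speaks about time-dependent fields; a one-point
    set of times makes the time irrelevant.\<close>
  have "local_lipschitz {0::real} (- {0}) (\<lambda>_. deriv V)"
  proof (rule local_lipschitzI)
    fix t r :: real assume "t \<in> {0}" "r \<in> - {0}"
    then obtain u L where "u > 0" "L-lipschitz_on (cball r u \<inter> - {0}) (deriv V)"
      using admissible by (auto simp: admissible_potentials_def)
    then show "\<exists>u>0. \<exists>L. \<forall>t\<in>cball t u \<inter> {0}. L-lipschitz_on (cball r u \<inter> - {0}) (deriv V)"
      by blast
  qed
  then have "local_lipschitz {0::real} X (\<lambda>_. deriv V)"
    by (rule local_lipschitz_subset) (use assms in \<open>auto simp: X_def\<close>)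
  then obtain L2 where "\<And>t::real. t \<in> {0} \<Longrightarrow> L2-lipschitz_on X (deriv V)"
    by (rule local_lipschitz_compact_implies_lipschitz) (auto simp: X_def)
  then have L2: "L2-lipschitz_on X (deriv V)" by blast
  have nn: "L1 \<ge> 0" "L2 \<ge> 0" using L1 L2 by (auto intro: lipschitz_on_nonneg)
  have "\<bar>pair_force \<sigma> r - pair_force \<sigma> s\<bar> \<le> (L1 + L2) * \<bar>r - s\<bar>"
    if "\<sigma> = 1 \<longrightarrow> {\<bar>r\<bar>, \<bar>s\<bar>} \<subseteq> {\<delta>..R}" for \<sigma> r s
  proof -
    consider "\<sigma> = 1" | "\<sigma> = - 1" | "\<sigma> \<noteq> 1" "\<sigma> \<noteq> - 1" by blast
    then show ?thesis
    proof cases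
      case 1
      then have "r \<in> X" "s \<in> X" "r \<noteq> 0" "s \<noteq> 0" using that assms by (auto simp: X_def abs_if split: if_splits)
      then have "\<bar>pair_force \<sigma> r - pair_force \<sigma> s\<bar> \<le> L2 * \<bar>r - s\<bar>"
        using lipschitz_onD[OF L2, of r s] 1 by (simp add: pair_force_def pot_deriv_def dist_real_def)
      also have "\<dots> \<le> (L1 + L2) * \<bar>r - s\<bar>" using nn by (intro mult_right_mono) auto
      finally show ?thesis .
    next
      case 2
      then have "\<bar>pair_force \<sigma> r - pair_force \<sigma> s\<bar> \<le> L1 * \<bar>r - s\<bar>"
        using lipschitz_onD[OF L1, of r s] by (simp add: pair_force_def dist_real_def)
      also have "\<dots> \<le> (L1 + L2) * \<bar>r - s\<bar>" using nn by (intro mult_right_mono) auto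
      finally show ?thesis .
    next
      case 3
      then show ?thesis using nn by (simp add: pair_force_def)
    qed
  qed
  then show ?thesis using nn by (intro exI[of _ "L1 + L2"]) auto
qed

lemma force_cong:
  "(\<And>j. j \<in> {1..n} \<Longrightarrow> a j = b j) \<Longrightarrow> i \<in> {1..n} \<Longrightarrow> force n a y i = force n b y i"
  unfolding force_def by (intro arg_cong2[of _ _ _ _ "(*)"] refl sum.cong) auto

text \<open>Gronwall for the sum of squared differences. Along both flows the gaps of living equal
  charges stay between the same \<open>\<delta>\<close> and \<open>R\<close>, where the forces are
  Lipschitz, and pairs with a dead member exert none.\<close>

lemma flow_unique:
  assumes x: "flow n u \<theta> c x" and y: "flow n u \<theta> c y" and \<theta>: "\<And>i. i \<in> {1..n} \<Longrightarrow> 0 < \<theta> i" and n: "n \<ge> 1"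
    and init: "\<And>i j. i \<in> {1..n} \<Longrightarrow> j \<in> {1..n} \<Longrightarrow> i \<noteq> j \<Longrightarrow> c i * c j = 1 \<Longrightarrow> x 0 i \<noteq> x 0 j"
    and eq0: "\<And>i. i \<in> {1..n} \<Longrightarrow> y 0 i = x 0 i" and t: "t \<in> {0..u}" and k: "k \<in> {1..n}"
  shows "x t k = y t k"
proof -
  have u: "0 \<le> u" using t by auto
  obtain \<delta> where \<delta>: "\<delta> > 0" and sep: "\<And>z t i j. \<lbrakk>flow n u \<theta> c z; \<forall>i\<in>{1..n}. z 0 i = x 0 i; t \<in> {0..u};
      i \<in> {1..n}; j \<in> {1..n}; i \<noteq> j; c i * c j = 1\<rbrakk> \<Longrightarrow> \<delta> \<le> \<bar>gap z \<theta> i j t\<bar>"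
    using flow_separation[of n \<theta> u c "x 0", OF \<theta> n u init] by blast
  define R where "R = sqrt (4 * real n * (B * u + moment n 2 (x 0)))"
  have M0: "moment n 2 (y 0) = moment n 2 (x 0)"
    using eq0 by (auto simp: moment_def intro!: sum.cong arg_cong2[of _ _ _ _ "(*)"])
  have R: "\<bar>gap z \<theta> i j t\<bar> \<le> R" if "z = x \<or> z = y" "t \<in> {0..u}" "i \<in> {1..n}" "j \<in> {1..n}" for z t i j
    unfolding R_def
    using that gap_sq_le[OF x \<theta> n, of t i j] gap_sq_le[OF y \<theta> n, of t i j] M0
    by (auto intro!: real_le_rsqrt)
  obtain L where L: "L \<ge> 0" "\<And>\<sigma> r s. (\<sigma> = 1 \<longrightarrow> {\<bar>r\<bar>, \<bar>s\<bar>} \<subseteq> {\<delta>..R}) \<Longrightarrow>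
    \<bar>pair_force \<sigma> r - pair_force \<sigma> s\<bar> \<le> L * \<bar>r - s\<bar>"
    using pair_force_lipschitz[OF \<delta>, of R] by blast
  define d where "d s i = x s i - y s i" for s i
  define f where "f s i = force n (alive c \<theta> s) (x s) i - force n (alive c \<theta> s) (y s) i" for s i
  define \<phi> where "\<phi> s = (\<Sum>i\<in>{1..n}. (d s i)\<^sup>2)" for s
  have f_le: "\<bar>f s i\<bar> \<le> 1 / real n * (\<Sum>j\<in>{1..n}. L * (\<bar>d s i\<bar> + \<bar>d s j\<bar>))"
    if i: "i \<in> {1..n}" and s: "s \<in> {0<..<u}" for s i
  proof -
    let ?p = "\<lambda>z j. pair_force (alive c \<theta> s i * alive c \<theta> s j) (z s i - z s j)"
    have "f s i = - (1 / real n) * (\<Sum>j\<in>{1..n}. ?p x j - ?p y j)"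
      by (simp add: f_def force_def sum_subtractf algebra_simps)
    then have "\<bar>f s i\<bar> = 1 / real n * \<bar>\<Sum>j\<in>{1..n}. ?p x j - ?p y j\<bar>"
      by (simp add: abs_mult)
    moreover have "\<bar>\<Sum>j\<in>{1..n}. ?p x j - ?p y j\<bar> \<le> (\<Sum>j\<in>{1..n}. \<bar>?p x j - ?p y j\<bar>)" by (rule sum_abs)
    moreover have "(\<Sum>j\<in>{1..n}. \<bar>?p x j - ?p y j\<bar>) \<le> (\<Sum>j\<in>{1..n}. L * (\<bar>d s i\<bar> + \<bar>d s j\<bar>))"
    proof (rule sum_mono)
      fix j assume j: "j \<in> {1..n}"
      have "\<bar>?p x j - ?p y j\<bar> \<le> L * \<bar>(x s i - x s j) - (y s i - y s j)\<bar>"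
      proof (cases "i \<noteq> j \<and> s < min (\<theta> i) (\<theta> j)")
        case True
        then have g: "gap z \<theta> i j s = z s i - z s j" for z by (simp add: gap_def)
        show ?thesis
        proof (rule L(2), intro impI)
          assume "alive c \<theta> s i * alive c \<theta> s j = 1"
          then have "c i * c j = 1" using True by (simp add: alive_def)
          then show "{\<bar>x s i - x s j\<bar>, \<bar>y s i - y s j\<bar>} \<subseteq> {\<delta>..R}"
            using True sep[OF x _ _ i j, of s] sep[OF y _ _ i j, of s] R[of x s i j] R[of y s i j] i j s eq0
            by (auto simp: g)
        qed
      next
        case False
        then have "?p z j = 0" for z by (cases "i = j") (auto simp: alive_def)
        then show ?thesis using L(1) by simp
      qed
      also have "\<dots> \<le> L * (\<bar>d s i\<bar> + \<bar>d s j\<bar>)"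
        using L(1) by (intro mult_left_mono) (auto simp: d_def)
      finally show "\<bar>?p x j - ?p y j\<bar> \<le> L * (\<bar>d s i\<bar> + \<bar>d s j\<bar>)" .
    qed
    ultimately have "\<bar>f s i\<bar> = 1 / real n * \<bar>\<Sum>j\<in>{1..n}. ?p x j - ?p y j\<bar>"
      "\<bar>\<Sum>j\<in>{1..n}. ?p x j - ?p y j\<bar> \<le> (\<Sum>j\<in>{1..n}. L * (\<bar>d s i\<bar> + \<bar>d s j\<bar>))"
      by linarith+
    then show ?thesis by (simp add: divide_right_mono)
  qed
  have \<phi>_le: "(\<Sum>i\<in>{1..n}. 2 * d s i * f s i) \<le> 4 * L * \<phi> s" if s: "s \<in> {0<..<u}" for s
  proof -
    have "(\<Sum>i\<in>{1..n}. 2 * d s i * f s i) \<le>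
        (\<Sum>i\<in>{1..n}. 2 * \<bar>d s i\<bar> * (1 / real n * (\<Sum>j\<in>{1..n}. L * (\<bar>d s i\<bar> + \<bar>d s j\<bar>))))"
    proof (rule sum_mono)
      fix i assume "i \<in> {1..n}"
      then have "2 * \<bar>d s i\<bar> * \<bar>f s i\<bar> \<le> 2 * \<bar>d s i\<bar> * (1 / real n * (\<Sum>j\<in>{1..n}. L * (\<bar>d s i\<bar> + \<bar>d s j\<bar>)))"
        using f_le s by (intro mult_left_mono) auto
      moreover have "2 * d s i * f s i \<le> 2 * \<bar>d s i\<bar> * \<bar>f s i\<bar>"
        using abs_ge_self[of "2 * d s i * f s i"] by (simp add: abs_mult)
      ultimately show "2 * d s i * f s i \<le> 2 * \<bar>d s i\<bar> * (1 / real n * (\<Sum>j\<in>{1..n}. L * (\<bar>d s i\<bar> + \<bar>d s j\<bar>)))"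
        by linarith
    qed
    also have "\<dots> = (2 * L / real n) * (\<Sum>i\<in>{1..n}. \<Sum>j\<in>{1..n}. \<bar>d s i\<bar> * (\<bar>d s i\<bar> + \<bar>d s j\<bar>))"
      unfolding sum_distrib_left by (intro sum.cong refl) (simp add: mult_ac)
    \<comment> \<open>Young's inequality. The coefficients 3/2 and 1/2 add up to 2, whence the rate
      \<open>4 * L\<close> that the weight in \<open>\<psi>\<close> compensates.\<close>
    also have "\<dots> \<le> (2 * L / real n) * (\<Sum>i\<in>{1..n}. \<Sum>j\<in>{1..n}. 3 / 2 * (d s i)\<^sup>2 + 1 / 2 * (d s j)\<^sup>2)"
    proof (intro mult_left_mono sum_mono)
      fix i j
      have "0 \<le> (\<bar>d s i\<bar> - \<bar>d s j\<bar>)\<^sup>2" by simp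
      then show "\<bar>d s i\<bar> * (\<bar>d s i\<bar> + \<bar>d s j\<bar>) \<le> 3 / 2 * (d s i)\<^sup>2 + 1 / 2 * (d s j)\<^sup>2"
        by (simp add: power2_diff algebra_simps flip: power2_eq_square)
    qed (use L in auto)
    also have "(\<Sum>i\<in>{1..n}. \<Sum>j\<in>{1..n}. 3 / 2 * (d s i)\<^sup>2 + 1 / 2 * (d s j)\<^sup>2) = 2 * real n * \<phi> s"
      unfolding sum.distrib sum_distrib_left[symmetric] \<phi>_def[symmetric]
      by (simp add: \<phi>_def sum_distrib_left[symmetric] sum_divide_distrib[symmetric])
    also have "(2 * L / real n) * (2 * real n * \<phi> s) = 4 * L * \<phi> s" using n by simp
    finally show ?thesis .
  qed
  define \<psi> where "\<psi> s = exp (- 4 * L * s) * \<phi> s" for s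
  have "\<psi> t - \<psi> 0 \<le> 0 * (t - 0)"
  proof (rule increment_le[of "\<theta> ` {1..n}" 0 t \<psi>
      "\<lambda>s. exp (- 4 * L * s) * ((\<Sum>i\<in>{1..n}. 2 * d s i * f s i) - 4 * L * \<phi> s)"])
    have "continuous_on {0..t} (\<lambda>s. x s i)" "continuous_on {0..t} (\<lambda>s. y s i)" if "i \<in> {1..n}" for i
      using that flow_cont[OF flow_mono[OF x]] flow_cont[OF flow_mono[OF y]] t by auto
    then show "continuous_on {0..t} \<psi>"
      unfolding \<psi>_def \<phi>_def d_def by (intro continuous_intros) auto
    fix s assume s: "s \<in> {0<..<t} - \<theta> ` {1..n}"
    then have s': "s \<in> {0<..<u} - \<theta> ` {1..n}" using t by auto
    have "(\<phi> has_real_derivative (\<Sum>i\<in>{1..n}. 2 * d s i * f s i)) (at s)"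
      unfolding \<phi>_def
    proof (rule DERIV_sum)
      fix i assume "i \<in> {1..n}"
      then have "((\<lambda>s. d s i) has_real_derivative f s i) (at s)"
        unfolding d_def f_def by (intro derivative_intros flow_deriv[OF x _ s'] flow_deriv[OF y _ s'])
      then show "((\<lambda>s. (d s i)\<^sup>2) has_real_derivative 2 * d s i * f s i) (at s)"
        by (auto intro!: derivative_eq_intros)
    qed
    then show "(\<psi> has_real_derivative exp (- 4 * L * s) * ((\<Sum>i\<in>{1..n}. 2 * d s i * f s i) - 4 * L * \<phi> s)) (at s)"
      unfolding \<psi>_def by (auto intro!: derivative_eq_intros simp: algebra_simps)
    show "exp (- 4 * L * s) * ((\<Sum>i\<in>{1..n}. 2 * d s i * f s i) - 4 * L * \<phi> s) \<le> 0"
      using \<phi>_le[of s] s' by (simp add: mult_nonneg_nonpos)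
  qed (use t in auto)
  moreover have "\<psi> 0 = 0" using eq0 by (simp add: \<psi>_def \<phi>_def d_def)
  ultimately have "\<phi> t \<le> 0" by (simp add: \<psi>_def mult_le_0_iff)
  moreover have "(d t k)\<^sup>2 \<le> \<phi> t" unfolding \<phi>_def using k by (intro member_le_sum) auto
  ultimately have "(d t k)\<^sup>2 \<le> 0" by linarith
  then show ?thesis by (simp add: d_def)
qed

text \<open>A reformulation of the annihilation problem without the recursion for the collision times:
  living particles of opposite charge never meet, and whoever dies does so together with a partner of
  opposite charge at the same position. Death times \<open>T + 1\<close> encode survival.\<close>

definition annihilating ::
    "nat \<Rightarrow> real \<Rightarrow> (nat \<Rightarrow> real) \<Rightarrow> (nat \<Rightarrow> int) \<Rightarrow> (nat \<Rightarrow> real) \<Rightarrow> (real \<Rightarrow> nat \<Rightarrow> real) \<Rightarrow> bool" where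
  "annihilating n T x0 c \<theta> x \<longleftrightarrow> flow n T \<theta> c x \<and> (\<forall>i\<in>{1..n}. x 0 i = x0 i) \<and>
     (\<forall>i\<in>{1..n}. 0 < \<theta> i \<and> (\<theta> i < T \<or> \<theta> i = T + 1)) \<and>
     (\<forall>t\<in>{0<..<T}. \<forall>i\<in>{1..n}. \<forall>j\<in>{1..n}. c i * c j = - 1 \<longrightarrow> t < \<theta> i \<longrightarrow> t < \<theta> j \<longrightarrow> x t i \<noteq> x t j) \<and>
     (\<forall>i\<in>{1..n}. \<theta> i < T \<longrightarrow> (\<exists>j\<in>{1..n}. c i * c j = - 1 \<and> \<theta> j = \<theta> i \<and> x (\<theta> i) j = x (\<theta> i) i))"

lemma annihilatingD:
  assumes "annihilating n T x0 c \<theta> x"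
  shows "flow n T \<theta> c x" "\<And>i. i \<in> {1..n} \<Longrightarrow> x 0 i = x0 i" "\<And>i. i \<in> {1..n} \<Longrightarrow> 0 < \<theta> i"
    "\<And>i. i \<in> {1..n} \<Longrightarrow> \<theta> i < T \<or> \<theta> i = T + 1"
    "\<And>t i j. t \<in> {0<..<T} \<Longrightarrow> i \<in> {1..n} \<Longrightarrow> j \<in> {1..n} \<Longrightarrow> c i * c j = - 1 \<Longrightarrow> t < \<theta> i \<Longrightarrow> t < \<theta> j \<Longrightarrow>
       x t i \<noteq> x t j"
    "\<And>i. i \<in> {1..n} \<Longrightarrow> \<theta> i < T \<Longrightarrow> \<exists>j\<in>{1..n}. c i * c j = - 1 \<and> \<theta> j = \<theta> i \<and> x (\<theta> i) j = x (\<theta> i) i"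
  using assms unfolding annihilating_def by blast+

lemma mult_eq_minus_1_trans:
  fixes a b d :: int
  assumes "a * b = - 1" "b * d = - 1"
  shows "a * d = 1"
proof -
  have "\<bar>b\<bar> = 1" using assms(1) by (metis abs_minus_cancel abs_one abs_zmult_eq_1 mult.commute)
  then have "b = 1 \<or> b = - 1" by linarith
  then show ?thesis using assms by auto
qed

text \<open>At the first difference \<open>u\<close>, particle \<open>i\<close> dies in
  \<open>x\<close> and lives on in \<open>y\<close>. Before \<open>u\<close> the living charges
  agree, so by \<open>flow_unique\<close> the positions agree at \<open>u\<close>, and in
  \<open>y\<close> too \<open>i\<close> meets its partner \<open>j\<close>. Living opposite charges
  never meet, hence \<open>j\<close> dies at \<open>u\<close> in \<open>y\<close>, together with
  some \<open>k\<close>. This \<open>k\<close> differs from \<open>i\<close> but has its charge and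
  its position, against the separation of equal charges.\<close>

lemma annihilating_no_first_difference:
  assumes x: "annihilating n T x0 c \<theta> x" and y: "annihilating n T x0 c \<phi> y" and n: "n \<ge> 1"
    and init: "\<And>i j. i \<in> {1..n} \<Longrightarrow> j \<in> {1..n} \<Longrightarrow> i \<noteq> j \<Longrightarrow> c i * c j = 1 \<Longrightarrow> x0 i \<noteq> x0 j"
    and i: "i \<in> {1..n}" "\<theta> i < \<phi> i"
    and first: "\<And>k. k \<in> {1..n} \<Longrightarrow> \<theta> k \<noteq> \<phi> k \<Longrightarrow> \<theta> i \<le> min (\<theta> k) (\<phi> k)"
  shows False
proof -
  note X = annihilatingD[OF x] and Y = annihilatingD[OF y]
  define u where "u = \<theta> i"
  have u: "0 < u" "u < T" using X(3,4)[OF i(1)] Y(4)[OF i(1)] i(2) by (auto simp: u_def)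
  have alive: "alive c \<phi> t k = alive c \<theta> t k" if "t < u" "k \<in> {1..n}" for t k
    using first[OF that(2)] that by (cases "\<theta> k = \<phi> k") (auto simp: alive_def u_def)
  have "flow n u \<theta> c y"
    unfolding flow_def
  proof (intro conjI ballI)
    show "continuous_on {0..u} (\<lambda>t. y t k)" if "k \<in> {1..n}" for k
      using flow_cont[OF flow_mono[OF Y(1)] that] u by auto
    fix t k assume t: "t \<in> {0<..<u} - \<theta> ` {1..n}" and k: "k \<in> {1..n}"
    have "t \<notin> \<phi> ` {1..n}"
    proof
      assume "t \<in> \<phi> ` {1..n}"
      then obtain l where l: "l \<in> {1..n}" "t = \<phi> l" by blast
      show False
      proof (cases "\<theta> l = \<phi> l")
        case True
        then have "t \<in> \<theta> ` {1..n}" using l by (metis imageI)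
        then show False using t by blast
      next
        case False
        then show False using first[OF l(1)] t l(2) by (simp add: u_def)
      qed
    qed
    then have "((\<lambda>s. y s k) has_real_derivative force n (alive c \<phi> t) (y t) k) (at t)"
      using t u by (intro flow_deriv[OF Y(1) k]) auto
    also have "force n (alive c \<phi> t) (y t) k = force n (alive c \<theta> t) (y t) k"
      using t by (intro force_cong alive k) auto
    finally show "((\<lambda>s. y s k) has_real_derivative force n (alive c \<theta> t) (y t) k) (at t)" .
  qed
  moreover have "flow n u \<theta> c x" using X(1) u by (auto intro: flow_mono)
  note flows = this calculation
  have eq: "x u k = y u k" if "k \<in> {1..n}" for k
  proof (rule flow_unique[OF flows X(3) n])
    show "x 0 i \<noteq> x 0 j" if "i \<in> {1..n}" "j \<in> {1..n}" "i \<noteq> j" "c i * c j = 1" for i j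
      using init that X(2) by simp
  qed (use X(2) Y(2) u that in \<open>simp_all del: One_nat_def\<close>)
  obtain j where j: "j \<in> {1..n}" "c i * c j = - 1" "\<theta> j = u" "x u j = x u i"
    using X(6)[OF i(1)] u by (auto simp: u_def)
  have yij: "y u i = y u j" using eq i(1) j by simp
  have "\<phi> j = u"
  proof (cases "\<theta> j = \<phi> j")
    case False
    then have "u \<le> \<phi> j" using first[OF j(1)] by (simp add: u_def)
    moreover have "\<not> u < \<phi> j" using Y(5)[OF _ i(1) j(1,2)] u i(2) yij by (auto simp: u_def)
    ultimately show ?thesis by simp
  qed (use j in simp)
  then obtain k where k: "k \<in> {1..n}" "c j * c k = - 1" "\<phi> k = u" "y u k = y u j"
    using Y(6)[OF j(1)] u by auto
  have ik: "c i * c k = 1" using j(2) k(2) by (rule mult_eq_minus_1_trans)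
  have "i \<noteq> k" using k(3) i(2) by (auto simp: u_def)
  have "0 \<le> T" using u by simp
  obtain \<delta> where \<delta>: "\<delta> > 0" and sep: "\<And>z t i j. \<lbrakk>flow n T \<phi> c z; \<forall>i\<in>{1..n}. z 0 i = x0 i; t \<in> {0..T};
      i \<in> {1..n}; j \<in> {1..n}; i \<noteq> j; c i * c j = 1\<rbrakk> \<Longrightarrow> \<delta> \<le> \<bar>gap z \<phi> i j t\<bar>"
    using flow_separation[of n \<phi> T c x0, OF Y(3) n \<open>0 \<le> T\<close> init] by blast
  \<comment> \<open>As \<open>u\<close> is the death time of \<open>k\<close>, the separation is
    used here at the very moment of a death.\<close>
  have "\<delta> \<le> \<bar>gap y \<phi> i k u\<bar>"
    using u Y(2) by (intro sep Y(1) i(1) k(1) \<open>i \<noteq> k\<close> ik) auto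
  moreover have "gap y \<phi> i k u = 0"
    using k(3,4) i(2) yij by (simp add: gap_def u_def)
  ultimately show False using \<delta> by simp
qed

lemma annihilating_unique:
  assumes x: "annihilating n T x0 c \<theta> x" and y: "annihilating n T x0 c \<phi> y" and n: "n \<ge> 1"
    and init: "\<And>i j. i \<in> {1..n} \<Longrightarrow> j \<in> {1..n} \<Longrightarrow> i \<noteq> j \<Longrightarrow> c i * c j = 1 \<Longrightarrow> x0 i \<noteq> x0 j"
    and i: "i \<in> {1..n}"
  shows "\<theta> i = \<phi> i" "t \<in> {0..T} \<Longrightarrow> x t i = y t i"
proof -
  note X = annihilatingD[OF x] and Y = annihilatingD[OF y]
  have eq: "\<theta> k = \<phi> k" if "k \<in> {1..n}" for k
  proof (rule ccontr)
    assume "\<theta> k \<noteq> \<phi> k"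
    \<comment> \<open>Among the particles with differing death times, one whose earlier death time
      is least realises the first difference; the two solutions play symmetric roles.\<close>
    define D where "D = {k \<in> {1..n}. \<theta> k \<noteq> \<phi> k}"
    have "finite D" "D \<noteq> {}" using \<open>\<theta> k \<noteq> \<phi> k\<close> that by (auto simp: D_def)
    then obtain l where l: "l \<in> D" "\<And>k. k \<in> D \<Longrightarrow> min (\<theta> l) (\<phi> l) \<le> min (\<theta> k) (\<phi> k)"
      using arg_min_if_finite[of D "\<lambda>k. min (\<theta> k) (\<phi> k)"] by (metis not_le)
    consider "\<theta> l < \<phi> l" | "\<phi> l < \<theta> l" using l(1) unfolding D_def by fastforce
    then show False
    proof cases
      case 1
      show False
      proof (rule annihilating_no_first_difference[OF x y n init _ 1])
        show "\<theta> l \<le> min (\<theta> k) (\<phi> k)" if "k \<in> {1..n}" "\<theta> k \<noteq> \<phi> k" for k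
          using l(2)[of k] 1 that by (simp add: D_def)
      qed (use l in \<open>auto simp: D_def\<close>)
    next
      case 2
      show False
      proof (rule annihilating_no_first_difference[OF y x n init _ 2])
        show "\<phi> l \<le> min (\<phi> k) (\<theta> k)" if "k \<in> {1..n}" "\<phi> k \<noteq> \<theta> k" for k
          using l(2)[of k] 2 that by (simp add: D_def min.commute)
      qed (use l in \<open>auto simp: D_def\<close>)
    qed
  qed
  then show "\<theta> i = \<phi> i" using i .
  have "flow n T \<theta> c y"
  proof -
    have "\<theta> ` {1..n} = \<phi> ` {1..n}" using eq by (rule image_cong[OF refl])
    moreover have "force n (alive c \<theta> t) z k = force n (alive c \<phi> t) z k" if "k \<in> {1..n}" for t z k
      using eq by (intro force_cong that) (simp add: alive_def)
    ultimately show ?thesis using Y(1) by (simp add: flow_def)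
  qed
  note flow_y = this
  show "x t i = y t i" if "t \<in> {0..T}"
  proof (rule flow_unique[OF X(1) flow_y X(3) n])
    show "x 0 i \<noteq> x 0 j" if "i \<in> {1..n}" "j \<in> {1..n}" "i \<noteq> j" "c i * c j = 1" for i j
      using init that X(2) by simp
  qed (use X(2) Y(2) that i in \<open>simp_all del: One_nat_def\<close>)
qed

end

section \<open>Collision times\<close>

lemma finite_collision_set: "finite (collision_set n \<tau>)"
proof (rule finite_subset)
  show "collision_set n \<tau> \<subseteq> (real_of_ereal \<circ> \<tau>) ` {1..n}"
    by (force simp: collision_set_def)
qed simp

lemma collision_time_0 [simp]: "collision_time n \<tau> 0 = 0"
  by (simp add: collision_time_def)

lemma
  shows collision_time_mono: "1 \<le> k \<Longrightarrow> k < l \<Longrightarrow> l \<le> num_collisions n \<tau> \<Longrightarrow>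
      collision_time n \<tau> k < collision_time n \<tau> l"
    and collision_time_image: "collision_time n \<tau> ` {1..num_collisions n \<tau>} = collision_set n \<tau>"
proof -
  define xs where "xs = sorted_list_of_set (collision_set n \<tau>)"
  have xs: "sorted_wrt (<) xs" "set xs = collision_set n \<tau>" "length xs = num_collisions n \<tau>"
    using finite_collision_set by (auto simp: xs_def num_collisions_def)
  have ct: "collision_time n \<tau> k = xs ! (k - 1)" if "1 \<le> k" for k
    using that by (simp add: collision_time_def xs_def)
  show "collision_time n \<tau> k < collision_time n \<tau> l" if "1 \<le> k" "k < l" "l \<le> num_collisions n \<tau>"
    using that sorted_wrt_nth_less[OF xs(1), of "k - 1" "l - 1"] by (simp add: ct xs(3))
  have "collision_time n \<tau> ` {1..num_collisions n \<tau>} = (\<lambda>k. xs ! (k - 1)) ` {1..length xs}"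
    unfolding xs(3) by (intro image_cong refl ct) auto
  also have "\<dots> = (\<lambda>k. xs ! k) ` {0..<length xs}"
  proof -
    have "(\<lambda>k. k - 1) ` {1..length xs} = {0..<length xs}"
      by (force simp: image_iff intro: bexI[of _ "Suc _"])
    from arg_cong[OF this, of "image ((!) xs)"] show ?thesis unfolding image_image .
  qed
  also have "\<dots> = set xs" by (simp add: set_conv_nth image_def) auto
  finally show "collision_time n \<tau> ` {1..num_collisions n \<tau>} = collision_set n \<tau>" by (simp add: xs(2))
qed

lemma collision_time_inj: "inj_on (collision_time n \<tau>) {1..num_collisions n \<tau>}"
proof (rule linorder_inj_onI')
  fix k l assume "k \<in> {1..num_collisions n \<tau>}" "l \<in> {1..num_collisions n \<tau>}" "k < l"
  then show "collision_time n \<tau> k \<noteq> collision_time n \<tau> l"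
    using collision_time_mono[of k l n \<tau>] by auto
qed

text \<open>The guard on \<open>k\<close> lets \<open>k = 0\<close> in: the starting time 0 precedes
  the first collision without being an entry of the sorted list.\<close>

lemma collision_time_next:
  assumes "s \<in> collision_set n \<tau>" "k < num_collisions n \<tau>" "1 \<le> k \<Longrightarrow> collision_time n \<tau> k < s"
  shows "collision_time n \<tau> (Suc k) \<le> s"
proof -
  obtain l where l: "l \<in> {1..num_collisions n \<tau>}" "s = collision_time n \<tau> l"
    using assms(1) unfolding collision_time_image[symmetric] by blast
  have "k < l"
  proof (rule ccontr)
    assume "\<not> k < l"
    then have "1 \<le> k" "l \<le> k" using l by auto
    then show False using assms l collision_time_mono[of l k n \<tau>] by (cases "l = k") auto
  qed
  then show ?thesis
    using l collision_time_mono[of "Suc k" l n \<tau>] by (cases "Suc k = l") auto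
qed

lemma collision_time_last:
  assumes "s \<in> collision_set n \<tau>"
  shows "s \<le> collision_time n \<tau> (num_collisions n \<tau>)"
proof -
  obtain l where l: "l \<in> {1..num_collisions n \<tau>}" "s = collision_time n \<tau> l"
    using assms unfolding collision_time_image[symmetric] by blast
  then show ?thesis
    using collision_time_mono[of l "num_collisions n \<tau>" n \<tau>] by (cases "l = num_collisions n \<tau>") auto
qed

section \<open>Equivalence of the annihilation problem with its reformulation by death times\<close>

definition death_time :: "real \<Rightarrow> (nat \<Rightarrow> ereal) \<Rightarrow> nat \<Rightarrow> real" where
  "death_time T \<tau> i = (if \<tau> i = \<infinity> then T + 1 else real_of_ereal (\<tau> i))"

lemma death_time_cases:
  assumes "\<tau> i \<in> ereal ` {0<..<T} \<union> {\<infinity>}"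
  obtains "\<tau> i = \<infinity>" "death_time T \<tau> i = T + 1"
    | s where "\<tau> i = ereal s" "death_time T \<tau> i = s" "0 < s" "s < T"
  using assms by (auto simp: death_time_def)

lemma collision_set_iff:
  assumes "\<forall>i\<in>{1..n}. \<tau> i \<in> ereal ` {0<..<T} \<union> {\<infinity>}"
  shows "s \<in> collision_set n \<tau> \<longleftrightarrow> s \<in> death_time T \<tau> ` {1..n} \<and> s < T"
proof -
  have "\<tau> i = ereal s \<longleftrightarrow> death_time T \<tau> i = s \<and> s < T" if "i \<in> {1..n}" for i
    using assms[rule_format, OF that] by (rule death_time_cases) auto
  then show ?thesis unfolding collision_set_def by blast
qed

context pair_potentials
begin

lemma force_eq:
  assumes "\<And>j. j \<in> {1..n} \<Longrightarrow> b j = a j" and i: "i \<in> {1..n}"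
  shows "- (1 / real n) * (\<Sum>j\<in>{j \<in> {1..n}. b i * b j = 1}. pot_deriv V (y i - y j))
    - (1 / real n) * (\<Sum>j\<in>{j \<in> {1..n}. b i * b j = - 1}. deriv W (y i - y j)) = force n a y i"
proof -
  have "(\<Sum>j\<in>{1..n}. pair_force (a i * a j) (y i - y j)) =
      (\<Sum>j\<in>{1..n}. (if b i * b j = 1 then pot_deriv V (y i - y j) else 0) +
         (if b i * b j = - 1 then deriv W (y i - y j) else 0))"
    by (rule sum.cong[OF refl]) (use assms in \<open>auto simp: pair_force_def\<close>)
  also have "\<dots> = (\<Sum>j\<in>{j \<in> {1..n}. b i * b j = 1}. pot_deriv V (y i - y j)) +
      (\<Sum>j\<in>{j \<in> {1..n}. b i * b j = - 1}. deriv W (y i - y j))"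
    by (simp only: sum.distrib sum.inter_filter[OF finite_atLeastAtMost])
  finally show ?thesis
    by (simp add: force_def algebra_simps del: One_nat_def)
qed

lemma solution_alive:
  assumes sol: "annihilation_solution_with V W n T x0 b0 \<tau> x b" and t: "t \<in> {0..T}" and i: "i \<in> {1..n}"
  shows "b t i = alive b0 (death_time T \<tau>) t i"
proof -
  have "\<tau> i \<in> ereal ` {0<..<T} \<union> {\<infinity>}" "b t i = b0 i * heaviside (\<tau> i - ereal t)"
    using sol t i unfolding annihilation_solution_with_def by blast+
  then show ?thesis
    using t by (elim death_time_cases) (auto simp: heaviside_def alive_def)
qed

text \<open>The recursion together with its closing clause excludes meetings of living opposite
  charges. Property (e) compares only the totals of the dead so far, so a partner for an individual
  death has to be found by counting: the change between two successive death times isolates those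
  who die at one of them.\<close>

lemma solution_annihilating:
  assumes sol: "annihilation_solution_with V W n T x0 b0 \<tau> x b" and "T > 0"
    and b0: "\<forall>i\<in>{1..n}. b0 i \<in> {- 1, 1}"
  shows "annihilating n T x0 b0 (death_time T \<tau>) x"
proof -
  let ?\<theta> = "death_time T \<tau>"
  note S = sol[unfolded annihilation_solution_with_def]
  have \<tau>: "\<forall>i\<in>{1..n}. \<tau> i \<in> ereal ` {0<..<T} \<union> {\<infinity>}" using S by blast
  have \<theta>: "0 < ?\<theta> i \<and> (?\<theta> i < T \<or> ?\<theta> i = T + 1)" if "i \<in> {1..n}" for i
    using \<tau>[rule_format, OF that] \<open>T > 0\<close> by (elim death_time_cases) auto
  note alive = solution_alive[OF sol]
  have fl: "flow n T ?\<theta> b0 x"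
    unfolding flow_def
  proof (intro conjI ballI)
    fix i assume "i \<in> {1..n}"
    then show "continuous_on {0..T} (\<lambda>t. x t i)"
      using S lipschitz_on_continuous_on by blast
  next
    fix t i assume t: "t \<in> {0<..<T} - ?\<theta> ` {1..n}" and i: "i \<in> {1..n}"
    have "t \<notin> collision_set n \<tau>" using t collision_set_iff[OF \<tau>] by blast
    then have "((\<lambda>s. x s i) has_real_derivative
           - (1 / real n) * (\<Sum>j\<in>{j \<in> {1..n}. b t i * b t j = 1}. pot_deriv V (x t i - x t j))
           - (1 / real n) * (\<Sum>j\<in>{j \<in> {1..n}. b t i * b t j = - 1}. deriv W (x t i - x t j))) (at t)"
      using S t i by blast
    also have "- (1 / real n) * (\<Sum>j\<in>{j \<in> {1..n}. b t i * b t j = 1}. pot_deriv V (x t i - x t j))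
           - (1 / real n) * (\<Sum>j\<in>{j \<in> {1..n}. b t i * b t j = - 1}. deriv W (x t i - x t j)) =
         force n (alive b0 ?\<theta> t) (x t) i"
      using t by (intro force_eq alive i) auto
    finally show "((\<lambda>s. x s i) has_real_derivative force n (alive b0 ?\<theta> t) (x t) i) (at t)" .
  qed
  have no_meet: "x t i \<noteq> x t j"
    if t: "t \<in> {0<..<T}" and ij: "i \<in> {1..n}" "j \<in> {1..n}" "b0 i * b0 j = - 1" "t < ?\<theta> i" "t < ?\<theta> j" for t i j
  proof
    assume meet: "x t i = x t j"
    \<comment> \<open>The last collision not after \<open>t\<close>. Both particles still carry
      their initial charges then, so the next collision time, an infimum over meetings that include
      \<open>t\<close>, would also be at most \<open>t\<close>; if no collision is left, the closing
      clause applies.\<close>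
    define k where "k = Max {k \<in> {0..num_collisions n \<tau>}. collision_time n \<tau> k \<le> t}"
    have fin: "finite {k \<in> {0..num_collisions n \<tau>}. collision_time n \<tau> k \<le> t}" by simp
    have "k \<in> {k \<in> {0..num_collisions n \<tau>}. collision_time n \<tau> k \<le> t}"
      unfolding k_def using t by (intro Max_in fin) (auto intro!: exI[of _ 0])
    then have k: "k \<le> num_collisions n \<tau>" "collision_time n \<tau> k \<le> t" by auto
    have k0: "0 \<le> collision_time n \<tau> k"
    proof (cases "k = 0")
      case False
      then have "collision_time n \<tau> k \<in> collision_set n \<tau>"
        using k(1) by (auto simp: collision_time_image[symmetric])
      then show ?thesis using collision_set_iff[OF \<tau>] \<theta> by force
    qed simp
    have "b (collision_time n \<tau> k) i = b0 i" "b (collision_time n \<tau> k) j = b0 j"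
      using alive[of "collision_time n \<tau> k"] k k0 t ij by (auto simp: alive_def)
    then have "b (collision_time n \<tau> k) i * b (collision_time n \<tau> k) j = - 1" using ij by simp
    then have mt: "t \<in> meeting_times n T x (b (collision_time n \<tau> k))"
      using t ij(1,2) meet unfolding meeting_times_def by blast
    show False
    proof (cases "k = num_collisions n \<tau>")
      case True
      then show False using S mt by blast
    next
      case False
      then have "Suc k \<in> {1..num_collisions n \<tau>}" using k by auto
      then have "ereal (collision_time n \<tau> (Suc k)) = (INF t\<in>meeting_times n T x (b (collision_time n \<tau> (Suc k - 1))). ereal t)"
        using S by blast
      also have "\<dots> \<le> ereal t" using mt by (intro INF_lower) simp
      finally have "collision_time n \<tau> (Suc k) \<le> t" by simp
      then have "Suc k \<le> k"
        unfolding k_def using \<open>Suc k \<in> _\<close> k_def by (intro Max_ge fin) auto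
      then show False by simp
    qed
  qed
  have partner: "\<exists>j\<in>{1..n}. b0 i * b0 j = - 1 \<and> ?\<theta> j = ?\<theta> i \<and> x (?\<theta> i) j = x (?\<theta> i) i"
    if i: "i \<in> {1..n}" "?\<theta> i < T" for i
  proof -
    define u where "u = ?\<theta> i"
    define p where "p = x u i"
    \<comment> \<open>\<open>A\<close> collects the particles of charge \<open>s\<close> dead by
      time \<open>t\<close> at position \<open>p\<close>, \<open>G\<close> those dying exactly at
      \<open>u\<close>. The bijection in (e) preserves positions, hence restricts to those at
      \<open>p\<close> and balances the two charges in \<open>A\<close>.\<close>
    define A where "A s t = {k \<in> {1..n}. b0 k = s \<and> ?\<theta> k \<le> t \<and> x t k = p}" for s t
    define G where "G s = {k \<in> {1..n}. b0 k = s \<and> ?\<theta> k = u \<and> x u k = p}" for s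
    have cardA: "card (A 1 t) = card (A (- 1) t)" if t: "t \<in> {0..T}" for t
    proof -
      obtain \<alpha> where \<alpha>: "bij_betw \<alpha> {i \<in> {1..n}. b0 i = 1 \<and> \<tau> i \<le> ereal t} {j \<in> {1..n}. b0 j = - 1 \<and> \<tau> j \<le> ereal t}"
        "\<forall>i\<in>{i \<in> {1..n}. b0 i = 1 \<and> \<tau> i \<le> ereal t}. x t i = x t (\<alpha> i)"
        using S t by blast
      have le: "\<tau> k \<le> ereal t \<longleftrightarrow> ?\<theta> k \<le> t" if "k \<in> {1..n}" for k
        using \<tau>[rule_format, OF that] t by (elim death_time_cases) auto
      have "bij_betw \<alpha> (A 1 t) (A (- 1) t)"
      proof (rule bij_betw_subset[OF \<alpha>(1)])
        show "A 1 t \<subseteq> {i \<in> {1..n}. b0 i = 1 \<and> \<tau> i \<le> ereal t}"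
          using le by (auto simp: A_def)
        show "\<alpha> ` A 1 t = A (- 1) t"
        proof (intro equalityI subsetI)
          fix j assume "j \<in> \<alpha> ` A 1 t"
          then obtain k where k: "j = \<alpha> k" "k \<in> {1..n}" "b0 k = 1" "\<tau> k \<le> ereal t" "x t k = p"
            using le by (auto simp: A_def)
          then have "x t (\<alpha> k) = p" "\<alpha> k \<in> {j \<in> {1..n}. b0 j = - 1 \<and> \<tau> j \<le> ereal t}"
            using \<alpha> bij_betwE[OF \<alpha>(1)] by auto
          then show "j \<in> A (- 1) t" using k(1) le by (auto simp: A_def)
        next
          fix j assume j: "j \<in> A (- 1) t"
          then have "j \<in> {j \<in> {1..n}. b0 j = - 1 \<and> \<tau> j \<le> ereal t}" using le by (auto simp: A_def)
          then obtain k where k: "k \<in> {i \<in> {1..n}. b0 i = 1 \<and> \<tau> i \<le> ereal t}" "j = \<alpha> k"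
            using bij_betw_imp_surj_on[OF \<alpha>(1)] by blast
          then have "k \<in> A 1 t" using \<alpha>(2) j le by (auto simp: A_def)
          then show "j \<in> \<alpha> ` A 1 t" using k(2) by blast
        qed
      qed
      then show ?thesis by (rule bij_betw_same_card)
    qed
    \<comment> \<open>The last death time before \<open>u\<close>, or 0 if there is none. Those dead
      by \<open>u'\<close> do not move until \<open>u\<close>, so subtracting the balance at
      \<open>u'\<close> from that at \<open>u\<close> leaves the balance of
      \<open>G\<close>.\<close>
    define u' where "u' = Max (insert 0 {r \<in> ?\<theta> ` {1..n}. r < u})"
    have u: "0 < u" "u < T" using \<theta>[OF i(1)] i(2) by (auto simp: u_def)
    have fin: "finite (insert 0 {r \<in> ?\<theta> ` {1..n}. r < u})" by simp
    have u': "0 \<le> u'" "u' < u" "\<And>k. k \<in> {1..n} \<Longrightarrow> ?\<theta> k < u \<Longrightarrow> ?\<theta> k \<le> u'"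
      using Max_in[OF fin] Max_ge[OF fin] u unfolding u'_def by auto
    have "card (A s u) = card (A s u') + card (G s)" for s
    proof -
      have "A s u = A s u' \<union> G s"
      proof -
        have "k \<in> A s u \<longleftrightarrow> k \<in> A s u' \<union> G s" for k
        proof (cases "k \<in> {1..n} \<and> ?\<theta> k < u")
          case True
          then have "?\<theta> k \<le> u'" using u'(3) by auto
          then have "x u k = x u' k" using True u u' by (intro flow_frozen[OF fl]) auto
          then show ?thesis using True \<open>?\<theta> k \<le> u'\<close> by (auto simp: A_def G_def)
        next
          case False
          then show ?thesis using u' by (auto simp: A_def G_def)
        qed
        then show ?thesis by blast
      qed
      moreover have "A s u' \<inter> G s = {}" using u' by (auto simp: A_def G_def)
      ultimately show ?thesis by (simp add: card_Un_disjoint A_def G_def)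
    qed
    then have cardG: "card (G 1) = card (G (- 1))"
      using cardA[of u] cardA[of u'] u u' by simp
    have "i \<in> G (b0 i)" using i(1) by (simp add: G_def u_def p_def)
    then have "card (G (b0 i)) > 0" by (auto simp: card_gt_0_iff G_def)
    moreover have sgn: "b0 i = - 1 \<or> b0 i = 1" using b0 i(1) by blast
    then have "card (G (b0 i)) = card (G (- b0 i))" using cardG by auto
    ultimately obtain j where "j \<in> G (- b0 i)" by (metis card_gt_0_iff ex_in_conv)
    then show ?thesis using sgn by (intro bexI[of _ j]) (auto simp: G_def u_def p_def)
  qed
  show ?thesis
    unfolding annihilating_def using fl S \<theta> no_meet partner by blast
qed

lemma flow_lipschitz:
  assumes x: "flow n u \<theta> c x" and \<theta>: "\<And>i. i \<in> {1..n} \<Longrightarrow> 0 < \<theta> i" and n: "n \<ge> 1" and u: "0 \<le> u"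
    and init: "\<And>i j. i \<in> {1..n} \<Longrightarrow> j \<in> {1..n} \<Longrightarrow> i \<noteq> j \<Longrightarrow> c i * c j = 1 \<Longrightarrow> x 0 i \<noteq> x 0 j"
    and k: "k \<in> {1..n}"
  shows "\<exists>L. L-lipschitz_on {0..u} (\<lambda>t. x t k)"
proof -
  obtain \<delta> where \<delta>: "\<delta> > 0" and sep: "\<And>z t i j. \<lbrakk>flow n u \<theta> c z; \<forall>i\<in>{1..n}. z 0 i = x 0 i; t \<in> {0..u};
      i \<in> {1..n}; j \<in> {1..n}; i \<noteq> j; c i * c j = 1\<rbrakk> \<Longrightarrow> \<delta> \<le> \<bar>gap z \<theta> i j t\<bar>"
    using flow_separation[of n \<theta> u c "x 0", OF \<theta> n u init] by blast
  define R where "R = sqrt (4 * real n * (B * u + moment n 2 (x 0)))"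
  \<comment> \<open>This constant serves only products \<sigma> different from 1, for which the
    interval imposes no restriction; any interval would do.\<close>
  obtain L where L: "L \<ge> 0" "\<And>\<sigma> r s. (\<sigma> = 1 \<longrightarrow> {\<bar>r\<bar>, \<bar>s\<bar>} \<subseteq> {1..1}) \<Longrightarrow>
    \<bar>pair_force \<sigma> r - pair_force \<sigma> s\<bar> \<le> L * \<bar>r - s\<bar>"
    using pair_force_lipschitz[of 1 1] by auto
  \<comment> \<open>The first summand bounds the force between equal charges, by \<open>B\<close>
    and the separation; the second bounds the other forces, which vanish at 0 and are Lipschitz, on
    gaps of size at most \<open>R\<close>.\<close>
  define M where "M = B / \<delta> + L * R"
  have R0: "R \<ge> 0" using B_nonneg u moment_nonneg[of n 2 "x 0"] by (simp add: R_def)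
  have M0: "M \<ge> 0" using R0 L B_nonneg \<delta> by (simp add: M_def)
  have le: "\<bar>force n (alive c \<theta> t) (x t) k\<bar> \<le> M" if t: "t \<in> {0<..<u}" for t
  proof -
    let ?p = "\<lambda>j. pair_force (alive c \<theta> t k * alive c \<theta> t j) (x t k - x t j)"
    have "\<bar>?p j\<bar> \<le> M" if j: "j \<in> {1..n}" for j
    proof (cases "k \<noteq> j \<and> t < min (\<theta> k) (\<theta> j)")
      case True
      then have g: "gap x \<theta> k j t = x t k - x t j" by (simp add: gap_def)
      have \<sigma>: "alive c \<theta> t k * alive c \<theta> t j = c k * c j" using True by (simp add: alive_def)
      show ?thesis
      proof (cases "c k * c j = 1")
        case True
        then have "\<delta> \<le> \<bar>x t k - x t j\<bar>"
          using sep[OF x _ _ k j, of t] t \<open>k \<noteq> j \<and> _\<close> by (simp add: g)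
        then have "\<delta> * \<bar>?p j\<bar> \<le> \<bar>x t k - x t j\<bar> * \<bar>?p j\<bar>" by (intro mult_right_mono) auto
        also have "\<dots> \<le> B" using pair_force_bound by (simp add: abs_mult[symmetric])
        finally have "\<bar>?p j\<bar> \<le> B / \<delta>" using \<delta> by (simp add: field_simps)
        then show ?thesis using L R0 unfolding M_def by (smt (verit) mult_nonneg_nonneg)
      next
        case False
        then have "\<bar>?p j\<bar> \<le> L * \<bar>x t k - x t j\<bar>"
          using L(2)[of "c k * c j" "x t k - x t j" 0] by (simp add: \<sigma>)
        also have "\<dots> \<le> L * R"
          using gap_sq_le[OF x \<theta> n _ _ k j, of t] t L(1) unfolding R_def g
          by (intro mult_left_mono) (auto intro!: real_le_rsqrt)
        also have "\<dots> \<le> M" using B_nonneg \<delta> by (simp add: M_def)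
        finally show ?thesis .
      qed
    next
      case False
      then have "?p j = 0" by (cases "k = j") (auto simp: alive_def)
      then show ?thesis using M0 by simp
    qed
    then have "(\<Sum>j\<in>{1..n}. \<bar>?p j\<bar>) \<le> real n * M"
      using sum_bounded_above[of "{1..n}" "\<lambda>j. \<bar>?p j\<bar>" M] by simp
    moreover have "\<bar>\<Sum>j\<in>{1..n}. ?p j\<bar> \<le> (\<Sum>j\<in>{1..n}. \<bar>?p j\<bar>)" by (rule sum_abs)
    ultimately have "\<bar>\<Sum>j\<in>{1..n}. ?p j\<bar> \<le> real n * M" by linarith
    then show ?thesis using n by (simp add: force_def abs_mult field_simps)
  qed
  have inc: "\<bar>x t k - x s k\<bar> \<le> M * (t - s)" if st: "s \<in> {0..u}" "t \<in> {0..u}" "s \<le> t" for s t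
  proof -
    have cont: "continuous_on {s..t} (\<lambda>t. x t k)"
      by (rule continuous_on_subset[OF flow_cont[OF x k]]) (use st in auto)
    have d: "((\<lambda>t. x t k) has_real_derivative force n (alive c \<theta> r) (x r) k) (at r)"
      "\<bar>force n (alive c \<theta> r) (x r) k\<bar> \<le> M" if "r \<in> {s<..<t} - \<theta> ` {1..n}" for r
      using that st by (auto intro!: flow_deriv[OF x k] le)
    have "x t k - x s k \<le> M * (t - s)"
      by (rule increment_le[OF _ st(3) cont d(1), of "\<theta> ` {1..n}"]) (use d(2) in force)+
    moreover have "- x t k - - x s k \<le> M * (t - s)"
      by (rule increment_le[OF _ st(3) continuous_on_minus[OF cont] DERIV_minus[OF d(1)], of "\<theta> ` {1..n}"])
        (use d(2) in force)+
    ultimately show ?thesis by linarith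
  qed
  have "M-lipschitz_on {0..u} (\<lambda>t. x t k)"
    by (rule lipschitz_on_leI) (use inc M0 in \<open>auto simp: dist_real_def abs_minus_commute\<close>)
  then show ?thesis by blast
qed

text \<open>The matching in (e) comes from the uniqueness of partners: two partners of one particle
  would be equal charges at one position at their common death. So passing to the partner is an
  involution; as partners share their death time it restricts to a bijection at every time, and as
  the dead stay put the positions remain equal.\<close>

lemma annihilating_solution:
  assumes ann: "annihilating n T x0 c \<theta> x" and n: "n \<ge> 1" and T: "T > 0"
    and c: "\<forall>i\<in>{1..n}. c i \<in> {- 1, 1}"
    and init: "\<And>i j. i \<in> {1..n} \<Longrightarrow> j \<in> {1..n} \<Longrightarrow> i \<noteq> j \<Longrightarrow> c i * c j = 1 \<Longrightarrow> x0 i \<noteq> x0 j"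
  shows "annihilation_solution V W n T x0 c x (alive c \<theta>)"
proof -
  note X = annihilatingD[OF ann]
  define \<tau> where "\<tau> i = (if \<theta> i < T then ereal (\<theta> i) else \<infinity>)" for i
  have \<tau>: "\<forall>i\<in>{1..n}. \<tau> i \<in> ereal ` {0<..<T} \<union> {\<infinity>}"
    using X(3) by (auto simp: \<tau>_def)
  have \<theta>: "death_time T \<tau> i = \<theta> i" if "i \<in> {1..n}" for i
    using X(4)[OF that] by (auto simp: \<tau>_def death_time_def)
  have coll: "s \<in> collision_set n \<tau> \<longleftrightarrow> s \<in> \<theta> ` {1..n} \<and> s < T" for s
    using collision_set_iff[OF \<tau>] \<theta> by (simp cong: image_cong_simp)
  have coll_time: "collision_time n \<tau> k \<in> \<theta> ` {1..n} \<and> collision_time n \<tau> k < T" if "k \<in> {1..num_collisions n \<tau>}" for k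
    using that coll collision_time_image[of n \<tau>] by blast
  have coll_pos: "0 < collision_time n \<tau> k" if "k \<in> {1..num_collisions n \<tau>}" for k
    using coll_time[OF that] X(3) by auto
  have init': "x 0 i \<noteq> x 0 j" if "i \<in> {1..n}" "j \<in> {1..n}" "i \<noteq> j" "c i * c j = 1" for i j
    using init[OF that] X(2) that by simp
  have "0 \<le> T" using T by simp
  obtain \<delta> where \<delta>: "\<delta> > 0" and sep: "\<And>z t i j. \<lbrakk>flow n T \<theta> c z; \<forall>i\<in>{1..n}. z 0 i = x 0 i; t \<in> {0..T};
      i \<in> {1..n}; j \<in> {1..n}; i \<noteq> j; c i * c j = 1\<rbrakk> \<Longrightarrow> \<delta> \<le> \<bar>gap z \<theta> i j t\<bar>"
    using flow_separation[of n \<theta> T c "x 0", OF X(3) n \<open>0 \<le> T\<close> init'] by blast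
  have opp: "c i * c j = - 1 \<longleftrightarrow> (c i = 1 \<and> c j = - 1 \<or> c i = - 1 \<and> c j = 1)" if "i \<in> {1..n}" "j \<in> {1..n}" for i j
    using c that by force
  define P where "P i j \<longleftrightarrow> j \<in> {1..n} \<and> c i * c j = - 1 \<and> \<theta> j = \<theta> i \<and> x (\<theta> i) j = x (\<theta> i) i" for i j
  have P_sym: "P j i" if "P i j" "i \<in> {1..n}" for i j
    using that by (auto simp: P_def mult.commute)
  have P_unique: "j = k" if "P i j" "P i k" "i \<in> {1..n}" "\<theta> i < T" for i j k
  proof (rule ccontr)
    assume "j \<noteq> k"
    have "c j * c k = 1" using that(1,2) by (auto simp: P_def mult.commute intro: mult_eq_minus_1_trans[of _ "c i"])
    then have "\<delta> \<le> \<bar>gap x \<theta> j k (\<theta> i)\<bar>"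
      using that X(3)[OF that(3)] \<open>j \<noteq> k\<close> by (intro sep X(1)) (auto simp: P_def)
    then show False using that \<delta> by (simp add: gap_def P_def)
  qed
  define \<alpha> where "\<alpha> i = (SOME j. P i j)" for i
  have \<alpha>: "P i (\<alpha> i)" if "i \<in> {1..n}" "\<theta> i < T" for i
    unfolding \<alpha>_def using X(6)[OF that] by (intro someI_ex[of "P i"]) (auto simp: P_def)
  have \<alpha>\<alpha>: "\<alpha> (\<alpha> i) = i" if "i \<in> {1..n}" "\<theta> i < T" for i
  proof (rule P_unique)
    show "P (\<alpha> i) (\<alpha> (\<alpha> i))" "P (\<alpha> i) i" "\<alpha> i \<in> {1..n}" "\<theta> (\<alpha> i) < T"
      using \<alpha>[OF that] \<alpha>[of "\<alpha> i"] P_sym that by (auto simp: P_def)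
  qed
  have le: "\<tau> i \<le> ereal t \<longleftrightarrow> \<theta> i \<le> t \<and> \<theta> i < T" if "i \<in> {1..n}" for i t
    by (auto simp: \<tau>_def)
  have matching: "\<exists>\<alpha>. bij_betw \<alpha> {i \<in> {1..n}. c i = 1 \<and> \<tau> i \<le> ereal t}
                   {j \<in> {1..n}. c j = - 1 \<and> \<tau> j \<le> ereal t} \<and>
        (\<forall>i\<in>{i \<in> {1..n}. c i = 1 \<and> \<tau> i \<le> ereal t}. x t i = x t (\<alpha> i))" if t: "t \<in> {0..T}" for t
  proof (intro exI[of _ \<alpha>] conjI ballI)
    have img: "\<alpha> i \<in> {1..n}" "c (\<alpha> i) = - c i" "\<theta> (\<alpha> i) = \<theta> i" "x (\<theta> i) (\<alpha> i) = x (\<theta> i) i"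
      if "i \<in> {1..n}" "\<theta> i < T" for i
      using \<alpha>[OF that] opp[OF that(1), of "\<alpha> i"] by (auto simp: P_def)
    show "bij_betw \<alpha> {i \<in> {1..n}. c i = 1 \<and> \<tau> i \<le> ereal t} {j \<in> {1..n}. c j = - 1 \<and> \<tau> j \<le> ereal t}"
      by (rule bij_betw_byWitness[of _ \<alpha>]) (use img \<alpha>\<alpha> le in auto)
    fix i assume "i \<in> {i \<in> {1..n}. c i = 1 \<and> \<tau> i \<le> ereal t}"
    then have i: "i \<in> {1..n}" "\<theta> i \<le> t" "\<theta> i < T" using le by auto
    have "x t i = x (\<theta> i) i"
      using i t X(3)[OF i(1)] by (intro flow_frozen[OF X(1)]) auto
    moreover have "x t (\<alpha> i) = x (\<theta> i) (\<alpha> i)"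
      using i t X(3)[OF i(1)] img[OF i(1,3)] by (intro flow_frozen[OF X(1)]) auto
    ultimately show "x t i = x t (\<alpha> i)" using img[OF i(1,3)] by simp
  qed
  have not_met: "t < \<theta> i \<Longrightarrow> t < \<theta> j \<Longrightarrow> False"
    if "t \<in> meeting_times n T x (alive c \<theta> s)" "i \<in> {1..n}" "j \<in> {1..n}" "c i * c j = - 1" "x t i = x t j" for s t i j
    using that X(5)[of t i j] by (auto simp: meeting_times_def)
  have alive_opp: "c i * c j = - 1 \<and> s < \<theta> i \<and> s < \<theta> j" if "alive c \<theta> s i * alive c \<theta> s j = - 1" for s i j
    using that by (auto simp: alive_def split: if_splits)
  \<comment> \<open>Whoever lives after a collision time lives at least until the next one, so
    living opposite charges cannot meet in between; a pair dying at the next one shows that the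
    infimum is attained there.\<close>
  have rec: "ereal (collision_time n \<tau> k) =
          (INF t\<in>meeting_times n T x (alive c \<theta> (collision_time n \<tau> (k - 1))). ereal t) \<and>
        collision_time n \<tau> k > collision_time n \<tau> (k - 1)" if k: "k \<in> {1..num_collisions n \<tau>}" for k
  proof
    let ?s = "collision_time n \<tau> (k - 1)" and ?t = "collision_time n \<tau> k"
    show lt: "?s < ?t"
      using k coll_pos[OF k] collision_time_mono[of "k - 1" k n \<tau>] by (cases "k = 1") auto
    show "ereal ?t = (INF t\<in>meeting_times n T x (alive c \<theta> ?s). ereal t)"
    proof (rule antisym)
      show "ereal ?t \<le> (INF t\<in>meeting_times n T x (alive c \<theta> ?s). ereal t)"
      proof (rule INF_greatest)
        fix t assume t: "t \<in> meeting_times n T x (alive c \<theta> ?s)"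
        then obtain i j where ij: "i \<in> {1..n}" "j \<in> {1..n}" "c i * c j = - 1" "?s < \<theta> i" "?s < \<theta> j" "x t i = x t j"
          unfolding meeting_times_def using alive_opp by blast
        have next_death: "?t \<le> \<theta> l" if "l \<in> {1..n}" "?s < \<theta> l" for l
        proof (cases "\<theta> l < T")
          case True
          then have "\<theta> l \<in> collision_set n \<tau>" using coll that by blast
          then have "collision_time n \<tau> (Suc (k - 1)) \<le> \<theta> l"
            using k that by (intro collision_time_next) auto
          then show ?thesis using k by simp
        next
          case False
          then show ?thesis using coll_time[OF k] by simp
        qed
        have "\<not> t < ?t"
        proof
          assume "t < ?t"
          then show False using not_met[OF t ij(1-3,6)] next_death ij by fastforce
        qed
        then show "ereal ?t \<le> ereal t" by simp
      qed
      obtain i where i: "i \<in> {1..n}" "?t = \<theta> i" "\<theta> i < T" using coll_time[OF k] by auto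
      obtain j where j: "j \<in> {1..n}" "c i * c j = - 1" "\<theta> j = \<theta> i" "x (\<theta> i) j = x (\<theta> i) i"
        using X(6)[OF i(1,3)] by blast
      have "alive c \<theta> ?s i * alive c \<theta> ?s j = - 1" using lt i j by (simp add: alive_def)
      moreover have "x ?t i = x ?t j" using i j by simp
      moreover have "?t \<in> {0<..<T}" using coll_pos[OF k] coll_time[OF k] by simp
      ultimately have "?t \<in> meeting_times n T x (alive c \<theta> ?s)"
        using i(1) j(1) \<open>?t \<in> {0<..<T}\<close> unfolding meeting_times_def by blast
      then show "(INF t\<in>meeting_times n T x (alive c \<theta> ?s). ereal t) \<le> ereal ?t"
        by (rule INF_lower)
    qed
  qed
  have closing: "meeting_times n T x (alive c \<theta> (collision_time n \<tau> (num_collisions n \<tau>))) = {}"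
  proof (rule equals0I)
    let ?s = "collision_time n \<tau> (num_collisions n \<tau>)"
    fix t assume t: "t \<in> meeting_times n T x (alive c \<theta> ?s)"
    then obtain i j where ij: "i \<in> {1..n}" "j \<in> {1..n}" "c i * c j = - 1" "?s < \<theta> i" "?s < \<theta> j" "x t i = x t j"
      unfolding meeting_times_def using alive_opp by blast
    have "t < T" using t by (simp add: meeting_times_def)
    have "t < \<theta> l" if "l \<in> {1..n}" "?s < \<theta> l" for l
    proof -
      have "\<not> \<theta> l < T" using collision_time_last[of "\<theta> l" n \<tau>] coll that by force
      then show ?thesis using \<open>t < T\<close> by simp
    qed
    then show False using not_met[OF t ij(1-3,6)] ij by blast
  qed
  have "annihilation_solution_with V W n T x0 c \<tau> x (alive c \<theta>)"
    unfolding annihilation_solution_with_def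
  proof (intro conjI)
    show "\<forall>t\<in>{0..T}. \<forall>i\<in>{1..n}. alive c \<theta> t i \<in> {- 1, 0, 1}" using c by (auto simp: alive_def)
    show "\<forall>i\<in>{1..n}. \<exists>L. L-lipschitz_on {0..T} (\<lambda>t. x t i)"
      using flow_lipschitz[of n T \<theta> c x, OF X(1,3) n \<open>0 \<le> T\<close> init'] by blast
    show "\<forall>i\<in>{1..n}. x 0 i = x0 i \<and> alive c \<theta> 0 i = c i" using X(2,3) by (auto simp: alive_def)
    show "\<forall>t\<in>{0<..<T} - collision_set n \<tau>. \<forall>i\<in>{1..n}.
        ((\<lambda>s. x s i) has_real_derivative
           - (1 / real n) * (\<Sum>j\<in>{j \<in> {1..n}. alive c \<theta> t i * alive c \<theta> t j = 1}. pot_deriv V (x t i - x t j))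
           - (1 / real n) * (\<Sum>j\<in>{j \<in> {1..n}. alive c \<theta> t i * alive c \<theta> t j = - 1}. deriv W (x t i - x t j)))
        (at t)"
    proof (intro ballI)
      fix t i assume t: "t \<in> {0<..<T} - collision_set n \<tau>" and i: "i \<in> {1..n}"
      have "t \<in> {0<..<T} - \<theta> ` {1..n}" using t coll by auto
      from flow_deriv[OF X(1) i this]
      show "((\<lambda>s. x s i) has_real_derivative
           - (1 / real n) * (\<Sum>j\<in>{j \<in> {1..n}. alive c \<theta> t i * alive c \<theta> t j = 1}. pot_deriv V (x t i - x t j))
           - (1 / real n) * (\<Sum>j\<in>{j \<in> {1..n}. alive c \<theta> t i * alive c \<theta> t j = - 1}. deriv W (x t i - x t j)))
        (at t)"
        unfolding force_eq[OF refl i] .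
    qed
    show "\<forall>t\<in>{0..T}. \<forall>i\<in>{1..n}. alive c \<theta> t i = c i * heaviside (\<tau> i - ereal t)"
      using X(4) by (force simp: alive_def heaviside_def \<tau>_def)
    show "\<forall>k\<in>{1..num_collisions n \<tau>}. ereal (collision_time n \<tau> k) =
          (INF t\<in>meeting_times n T x (alive c \<theta> (collision_time n \<tau> (k - 1))). ereal t) \<and>
        collision_time n \<tau> k > collision_time n \<tau> (k - 1)"
      using rec by blast
    show "\<forall>t\<in>{0..T}. \<exists>\<alpha>. bij_betw \<alpha> {i \<in> {1..n}. c i = 1 \<and> \<tau> i \<le> ereal t}
                   {j \<in> {1..n}. c j = - 1 \<and> \<tau> j \<le> ereal t} \<and>
        (\<forall>i\<in>{i \<in> {1..n}. c i = 1 \<and> \<tau> i \<le> ereal t}. x t i = x t (\<alpha> i))"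
      using matching by blast
  qed (fact \<tau> closing)+
  then show ?thesis unfolding annihilation_solution_def by blast
qed

end

section \<open>Existence\<close>

lemma continuous_on_lipschitz_comp:
  fixes F :: "('i \<Rightarrow> real) \<Rightarrow> real"
  assumes "finite I" and lip: "\<And>y z. \<bar>F y - F z\<bar> \<le> \<Lambda> * (\<Sum>j\<in>I. \<bar>y j - z j\<bar>)"
    and cont: "\<And>j. j \<in> I \<Longrightarrow> continuous_on S (\<lambda>s. x s j)"
  shows "continuous_on S (\<lambda>s. F (x s))"
  unfolding continuous_on_def
proof
  fix t assume t: "t \<in> S"
  have "((\<lambda>s. \<Lambda> * (\<Sum>j\<in>I. \<bar>x s j - x t j\<bar>)) \<longlongrightarrow> \<Lambda> * (\<Sum>j\<in>I. \<bar>x t j - x t j\<bar>)) (at t within S)"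
    using cont t by (intro tendsto_intros) (auto simp: continuous_on_def)
  then have "((\<lambda>s. \<Lambda> * (\<Sum>j\<in>I. \<bar>x s j - x t j\<bar>)) \<longlongrightarrow> 0) (at t within S)" by simp
  then have "((\<lambda>s. F (x s) - F (x t)) \<longlongrightarrow> 0) (at t within S)"
    by (rule Lim_null_comparison[rotated]) (auto intro!: always_eventually lip)
  then show "((\<lambda>s. F (x s)) \<longlongrightarrow> F (x t)) (at t within S)" by (rule Lim_null[THEN iffD2])
qed

text \<open>Picard iteration on the whole interval at once: in a norm weighted by
  \<open>exp (- \<beta> * t)\<close> each step is a contraction with factor 1/2. Only coordinates in
  \<open>I\<close> are controlled, so the norm is a sum over \<open>I\<close>.\<close>

lemma picard_lindelof:
  fixes F :: "('i \<Rightarrow> real) \<Rightarrow> 'i \<Rightarrow> real"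
  assumes I: "finite I" and "0 \<le> \<Lambda>" "0 \<le> T"
    and lip: "\<And>y z i. i \<in> I \<Longrightarrow> \<bar>F y i - F z i\<bar> \<le> \<Lambda> * (\<Sum>j\<in>I. \<bar>y j - z j\<bar>)"
  shows "\<exists>x. (\<forall>i\<in>I. continuous_on {0..T} (\<lambda>t. x t i) \<and> x 0 i = x0 i \<and>
    (\<forall>t\<in>{0<..<T}. ((\<lambda>s. x s i) has_real_derivative F (x t) i) (at t)))"
proof -
  define X where "X = rec_nat (\<lambda>(t::real). x0) (\<lambda>_ x t i. x0 i + integral {0..t} (\<lambda>s. F (x s) i))"
  have X0: "X 0 t = x0" and XS: "X (Suc k) t i = x0 i + integral {0..t} (\<lambda>s. F (X k s) i)" for k t i
    by (simp_all add: X_def)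
  have F_cont: "continuous_on S (\<lambda>s. F (x s) i)"
    if "i \<in> I" "\<And>j. j \<in> I \<Longrightarrow> continuous_on S (\<lambda>s. x s j)" for S i and x :: "real \<Rightarrow> 'i \<Rightarrow> real"
    using I lip[OF that(1)] that(2) by (rule continuous_on_lipschitz_comp)
  have X_cont: "continuous_on {0..T} (\<lambda>t. X k t i)" if "i \<in> I" for k i
    using that
  proof (induction k arbitrary: i)
    case (Suc k)
    have "continuous_on {0..T} (\<lambda>t. integral {0..t} (\<lambda>s. F (X k s) i))"
      by (intro indefinite_integral_continuous_1 integrable_continuous_real F_cont Suc)
    then show ?case unfolding XS by (intro continuous_intros)
  qed (simp add: X0)
  have FX_int: "(\<lambda>s. F (X k s) i) integrable_on {0..t}" if "i \<in> I" "t \<le> T" for k i t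
    using that by (intro integrable_continuous_real continuous_on_subset[OF F_cont[OF _ X_cont]]) auto
  \<comment> \<open>Integrating \<open>exp (\<beta> * s)\<close> gains \<open>1 / \<beta>\<close>,
    which has to beat the factor \<open>card I * \<Lambda>\<close> from summing the Lipschitz bound,
    with a margin of 1/2. The added 1 keeps \<open>\<beta>\<close> positive when
    \<open>\<Lambda> = 0\<close>.\<close>
  define \<beta> where "\<beta> = 2 * real (card I) * \<Lambda> + 1"
  define M where "M = (\<Sum>i\<in>I. T * \<bar>F x0 i\<bar>)"
  have \<beta>: "\<beta> > 0" "real (card I) * \<Lambda> / \<beta> \<le> 1 / 2"
    using \<open>0 \<le> \<Lambda>\<close> by (auto simp: \<beta>_def field_simps add_pos_nonneg)
  have M: "M \<ge> 0" using \<open>0 \<le> T\<close> by (auto simp: M_def intro!: sum_nonneg)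
  have contraction: "(\<Sum>i\<in>I. \<bar>X (Suc k) t i - X k t i\<bar>) \<le> M * (1 / 2) ^ k * exp (\<beta> * t)"
    if "t \<in> {0..T}" for k t
    using that
  proof (induction k arbitrary: t)
    case 0
    have "(\<Sum>i\<in>I. \<bar>X (Suc 0) t i - X 0 t i\<bar>) = (\<Sum>i\<in>I. t * \<bar>F x0 i\<bar>)"
      using 0 by (simp add: XS X0 abs_mult)
    also have "\<dots> \<le> M" unfolding M_def using 0 by (intro sum_mono mult_right_mono) auto
    also have "\<dots> \<le> M * exp (\<beta> * t)" using M \<beta> 0 by (simp add: mult_le_cancel_left1)
    finally show ?case by simp
  next
    case (Suc k)
    let ?e = "\<lambda>s. \<Lambda> * (M * (1 / 2) ^ k * exp (\<beta> * s))"
    have e_int: "(?e has_integral \<Lambda> * (M * (1 / 2) ^ k * ((exp (\<beta> * t) - 1) / \<beta>))) {0..t}"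
    proof -
      have "((\<lambda>s. exp (\<beta> * s)) has_integral exp (\<beta> * t) / \<beta> - exp (\<beta> * 0) / \<beta>) {0..t}"
        by (rule fundamental_theorem_of_calculus)
          (use Suc.prems \<beta> in \<open>auto intro!: derivative_eq_intros simp: has_real_derivative_iff_has_vector_derivative[symmetric]\<close>)
      then have "((\<lambda>s. exp (\<beta> * s)) has_integral (exp (\<beta> * t) - 1) / \<beta>) {0..t}"
        by (simp add: diff_divide_distrib)
      then show ?thesis by (intro has_integral_mult_right)
    qed
    have "\<bar>X (Suc (Suc k)) t i - X (Suc k) t i\<bar> \<le> \<Lambda> * (M * (1 / 2) ^ k * (exp (\<beta> * t) / \<beta>))"
      if i: "i \<in> I" for i
    proof -
      have "X (Suc (Suc k)) t i - X (Suc k) t i = integral {0..t} (\<lambda>s. F (X (Suc k) s) i - F (X k s) i)"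
        unfolding XS[of "Suc k"] XS[of k t] using FX_int[OF i, of t] Suc.prems
        by (simp add: Henstock_Kurzweil_Integration.integral_diff)
      also have "\<bar>\<dots>\<bar> \<le> integral {0..t} ?e"
        unfolding real_norm_def[symmetric]
      proof (rule Henstock_Kurzweil_Integration.integral_norm_bound_integral)
        show "(\<lambda>s. F (X (Suc k) s) i - F (X k s) i) integrable_on {0..t}"
          using FX_int[OF i, of t] Suc.prems by (intro integrable_diff) auto
        show "?e integrable_on {0..t}" using e_int by blast
        fix s assume "s \<in> {0..t}"
        then have "s \<in> {0..T}" using Suc.prems by auto
        have "\<bar>F (X (Suc k) s) i - F (X k s) i\<bar> \<le> \<Lambda> * (\<Sum>j\<in>I. \<bar>X (Suc k) s j - X k s j\<bar>)"
          by (rule lip[OF i])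
        also have "\<dots> \<le> ?e s"
          using Suc.IH[OF \<open>s \<in> {0..T}\<close>] \<open>0 \<le> \<Lambda>\<close> by (intro mult_left_mono) auto
        finally show "norm (F (X (Suc k) s) i - F (X k s) i) \<le> ?e s" by simp
      qed
      also have "\<dots> = \<Lambda> * (M * (1 / 2) ^ k * ((exp (\<beta> * t) - 1) / \<beta>))"
        using e_int by (rule integral_unique)
      also have "\<dots> \<le> \<Lambda> * (M * (1 / 2) ^ k * (exp (\<beta> * t) / \<beta>))"
        using \<open>0 \<le> \<Lambda>\<close> M \<beta> by (intro mult_left_mono divide_right_mono) auto
      finally show ?thesis .
    qed
    then have "(\<Sum>i\<in>I. \<bar>X (Suc (Suc k)) t i - X (Suc k) t i\<bar>) \<le>
        (\<Sum>i\<in>I. \<Lambda> * (M * (1 / 2) ^ k * (exp (\<beta> * t) / \<beta>)))"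
      by (rule sum_mono)
    also have "\<dots> = (real (card I) * \<Lambda> / \<beta>) * (M * (1 / 2) ^ k * exp (\<beta> * t))" by simp
    also have "\<dots> \<le> 1 / 2 * (M * (1 / 2) ^ k * exp (\<beta> * t))"
      using \<beta>(2) M by (intro mult_right_mono) auto
    finally show ?case by simp
  qed
  \<comment> \<open>The limit is written as a telescoping series so that the geometric bound yields
    uniform convergence by the M-test.\<close>
  define Y where "Y t i = x0 i + (\<Sum>k. X (Suc k) t i - X k t i)" for t i
  have lim: "uniform_limit {0..T} (\<lambda>k t. X k t i) (\<lambda>t. Y t i) sequentially" if i: "i \<in> I" for i
  proof -
    have "uniform_limit {0..T} (\<lambda>k t. \<Sum>l<k. X (Suc l) t i - X l t i) (\<lambda>t. \<Sum>k. X (Suc k) t i - X k t i) sequentially"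
    proof (rule Weierstrass_m_test)
      fix k t assume t: "t \<in> {0..T}"
      have "\<bar>X (Suc k) t i - X k t i\<bar> \<le> (\<Sum>i\<in>I. \<bar>X (Suc k) t i - X k t i\<bar>)"
        using I i by (intro member_le_sum[of i I "\<lambda>i. \<bar>X (Suc k) t i - X k t i\<bar>"]) auto
      also have "\<dots> \<le> M * (1 / 2) ^ k * exp (\<beta> * t)" using t by (rule contraction)
      also have "\<dots> \<le> M * (1 / 2) ^ k * exp (\<beta> * T)" using t M \<beta> by (intro mult_left_mono) auto
      finally show "norm (X (Suc k) t i - X k t i) \<le> M * exp (\<beta> * T) * (1 / 2) ^ k" by (simp add: mult_ac)
    next
      show "summable (\<lambda>k. M * exp (\<beta> * T) * (1 / 2) ^ k :: real)"
        by (intro summable_mult summable_geometric) simp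
    qed
    moreover have "(\<Sum>l<k. X (Suc l) t i - X l t i) = X k t i - x0 i" for k t
      using sum_lessThan_telescope[of "\<lambda>k. X k t i" k] by (simp add: X0)
    ultimately have "uniform_limit {0..T} (\<lambda>k t. x0 i + (X k t i - x0 i)) (\<lambda>t. Y t i) sequentially"
      unfolding Y_def by (intro uniform_limit_add uniform_limit_const) simp
    then show ?thesis by simp
  qed
  have Y_cont: "continuous_on {0..T} (\<lambda>t. Y t i)" if "i \<in> I" for i
    by (rule uniform_limit_theorem[OF _ lim[OF that]]) (auto intro!: always_eventually X_cont that)
  have F_lim: "uniform_limit {0..T} (\<lambda>k s. F (X k s) i) (\<lambda>s. F (Y s) i) sequentially" if i: "i \<in> I" for i
  proof (rule uniform_limitI)
    fix e :: real assume "e > 0"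
    define e' where "e' = e / (\<Lambda> * real (card I) + 1)"
    have pos: "\<Lambda> * real (card I) + 1 > 0" using \<open>0 \<le> \<Lambda>\<close> by (intro add_nonneg_pos) auto
    then have "e' > 0" using \<open>e > 0\<close> by (simp add: e'_def)
    have "eventually (\<lambda>k. \<forall>j\<in>I. \<forall>s\<in>{0..T}. dist (X k s j) (Y s j) < e') sequentially"
      by (intro eventually_ball_finite[OF I] ballI uniform_limitD[OF lim] \<open>e' > 0\<close>)
    then show "eventually (\<lambda>k. \<forall>s\<in>{0..T}. dist (F (X k s) i) (F (Y s) i) < e) sequentially"
    proof eventually_elim
      case (elim k)
      show ?case
      proof
        fix s assume s: "s \<in> {0..T}"
        have "dist (F (X k s) i) (F (Y s) i) \<le> \<Lambda> * (\<Sum>j\<in>I. \<bar>X k s j - Y s j\<bar>)"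
          using lip[OF i] by (simp add: dist_real_def)
        also have "\<dots> \<le> \<Lambda> * (\<Sum>j\<in>I. e')"
          using elim s \<open>0 \<le> \<Lambda>\<close> by (intro mult_left_mono sum_mono) (auto simp: dist_real_def less_imp_le)
        also have "\<dots> < (\<Lambda> * real (card I) + 1) * e'" using \<open>e' > 0\<close> by (simp add: algebra_simps)
        also have "\<dots> = e" using pos by (simp add: e'_def)
        finally show "dist (F (X k s) i) (F (Y s) i) < e" .
      qed
    qed
  qed
  have eq: "Y t i = x0 i + integral {0..t} (\<lambda>s. F (Y s) i)" if i: "i \<in> I" and t: "t \<in> {0..T}" for i t
  proof -
    have "uniform_limit {0..t} (\<lambda>k s. F (X k s) i) (\<lambda>s. F (Y s) i) sequentially"
      using F_lim[OF i] by (rule uniform_limit_on_subset) (use t in auto)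
    moreover have "continuous_on {0..t} (\<lambda>s. F (X k s) i)" for k
      by (rule continuous_on_subset[OF F_cont[OF i X_cont]]) (use t in auto)
    ultimately obtain J J' where J: "\<And>k. ((\<lambda>s. F (X k s) i) has_integral J k) {0..t}"
      "((\<lambda>s. F (Y s) i) has_integral J') {0..t}" "J \<longlonglongrightarrow> J'"
      by (rule uniform_limit_integral) auto
    have "(\<lambda>k. x0 i + J k) \<longlonglongrightarrow> x0 i + J'" by (intro tendsto_intros J)
    moreover have "x0 i + J k = X (Suc k) t i" for k using integral_unique[OF J(1)] by (simp add: XS)
    ultimately have "(\<lambda>k. X (Suc k) t i) \<longlonglongrightarrow> x0 i + J'" by simp
    moreover have "(\<lambda>k. X (Suc k) t i) \<longlonglongrightarrow> Y t i"
      by (rule LIMSEQ_Suc[OF tendsto_uniform_limitI[OF lim[OF i] t]])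
    ultimately show ?thesis using LIMSEQ_unique integral_unique[OF J(2)] by blast
  qed
  show ?thesis
  proof (intro exI[of _ Y] ballI conjI)
    fix i assume i: "i \<in> I"
    show "continuous_on {0..T} (\<lambda>t. Y t i)" by (rule Y_cont[OF i])
    show "Y 0 i = x0 i" using eq[OF i, of 0] \<open>0 \<le> T\<close> by simp
    fix t assume t: "t \<in> {0<..<T}"
    have "((\<lambda>r. integral {0..r} (\<lambda>s. F (Y s) i)) has_real_derivative F (Y t) i) (at t within {0..T})"
      using t by (intro integral_has_real_derivative F_cont[OF i Y_cont]) auto
    then have "((\<lambda>r. integral {0..r} (\<lambda>s. F (Y s) i)) has_real_derivative F (Y t) i) (at t)"
      using t by (simp add: at_within_Icc_at)
    then have "((\<lambda>r. x0 i + integral {0..r} (\<lambda>s. F (Y s) i)) has_real_derivative F (Y t) i) (at t)"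
      by (auto intro!: derivative_eq_intros)
    then show "((\<lambda>s. Y s i) has_real_derivative F (Y t) i) (at t)"
      by (rule has_field_derivative_transform_within_open[of _ _ _ "{0<..<T}"]) (use t eq[OF i] in auto)
  qed
qed

context pair_potentials
begin

text \<open>\<open>V'\<close> is unbounded near 0, and Picard iteration needs a global Lipschitz
  bound. Clamping \<open>\<bar>r\<bar>\<close> to \<open>{\<delta>..R}\<close> provides it, and the
  factor \<open>\<eta>\<close>, a Lipschitz approximation of the sign, restores oddness without a
  jump at 0.\<close>

lemma truncated_force:
  assumes "0 < \<delta>" "\<delta> \<le> R"
  shows "\<exists>G L. L \<ge> 0 \<and> (\<forall>r s. \<bar>G r - G s\<bar> \<le> L * \<bar>r - s\<bar>) \<and> G 0 = 0 \<and>
    (\<forall>r. \<bar>r\<bar> \<in> {\<delta>..R} \<longrightarrow> G r = pair_force 1 r)"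
proof -
  obtain L where L: "L \<ge> 0" "\<And>r s. {\<bar>r\<bar>, \<bar>s\<bar>} \<subseteq> {\<delta>..R} \<Longrightarrow>
    \<bar>pair_force 1 r - pair_force 1 s\<bar> \<le> L * \<bar>r - s\<bar>"
    using pair_force_lipschitz[OF assms(1), of R] by blast
  define p where "p r = max \<delta> (min R \<bar>r\<bar>)" for r
  define \<eta> where "\<eta> r = max (- 1) (min 1 (r / \<delta>))" for r
  define G where "G r = \<eta> r * pair_force 1 (p r)" for r
  have p: "p r \<in> {\<delta>..R}" "\<bar>p r - p s\<bar> \<le> \<bar>r - s\<bar>" for r s
    using assms by (auto simp: p_def max_def min_def)
  have \<eta>: "\<bar>\<eta> r\<bar> \<le> 1" "\<bar>\<eta> r - \<eta> s\<bar> \<le> \<bar>r - s\<bar> / \<delta>" for r s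
  proof -
    have "\<bar>\<eta> r - \<eta> s\<bar> \<le> \<bar>r / \<delta> - s / \<delta>\<bar>" by (auto simp: \<eta>_def max_def min_def)
    also have "\<dots> = \<bar>r - s\<bar> / \<delta>" using assms by (simp add: diff_divide_distrib[symmetric])
    finally show "\<bar>\<eta> r - \<eta> s\<bar> \<le> \<bar>r - s\<bar> / \<delta>" .
    show "\<bar>\<eta> r\<bar> \<le> 1" by (auto simp: \<eta>_def max_def min_def)
  qed
  have v: "\<bar>pair_force 1 (p r)\<bar> \<le> B / \<delta>" for r
  proof -
    have "\<delta> * \<bar>pair_force 1 (p r)\<bar> \<le> \<bar>p r\<bar> * \<bar>pair_force 1 (p r)\<bar>"
      using p(1)[of r] assms by (intro mult_right_mono) auto
    also have "\<dots> \<le> B" using pair_force_bound by (simp add: abs_mult[symmetric])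
    finally show ?thesis using assms by (simp add: field_simps)
  qed
  have G_lip: "\<bar>G r - G s\<bar> \<le> (L + B / \<delta> / \<delta>) * \<bar>r - s\<bar>" for r s
  proof -
    have "G r - G s = \<eta> r * (pair_force 1 (p r) - pair_force 1 (p s)) + (\<eta> r - \<eta> s) * pair_force 1 (p s)"
      by (simp add: G_def algebra_simps)
    also have "\<bar>\<dots>\<bar> \<le> \<bar>\<eta> r\<bar> * \<bar>pair_force 1 (p r) - pair_force 1 (p s)\<bar> + \<bar>\<eta> r - \<eta> s\<bar> * \<bar>pair_force 1 (p s)\<bar>"
      by (metis abs_mult abs_triangle_ineq)
    also have "\<dots> \<le> 1 * (L * \<bar>r - s\<bar>) + (\<bar>r - s\<bar> / \<delta>) * (B / \<delta>)"
    proof (intro add_mono mult_mono \<eta> v)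
      have "\<bar>pair_force 1 (p r) - pair_force 1 (p s)\<bar> \<le> L * \<bar>p r - p s\<bar>"
        using p(1)[of r] p(1)[of s] assms by (intro L(2)) auto
      also have "\<dots> \<le> L * \<bar>r - s\<bar>" using p(2) L(1) by (intro mult_left_mono)
      finally show "\<bar>pair_force 1 (p r) - pair_force 1 (p s)\<bar> \<le> L * \<bar>r - s\<bar>" .
    qed (use assms in auto)
    also have "\<dots> = (L + B / \<delta> / \<delta>) * \<bar>r - s\<bar>" by (simp add: algebra_simps)
    finally show ?thesis .
  qed
  have G_eq: "G r = pair_force 1 r" if "\<bar>r\<bar> \<in> {\<delta>..R}" for r
  proof (cases "r > 0")
    case True
    then have "\<eta> r = 1" "p r = r" using that assms by (auto simp: \<eta>_def p_def)
    then show ?thesis by (simp add: G_def)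
  next
    case False
    then have "r \<le> - \<delta>" using that assms by auto
    then have "r / \<delta> \<le> - 1" using assms by (simp add: divide_le_eq)
    then have "\<eta> r = - 1" "p r = - r" using that assms False by (auto simp: \<eta>_def p_def)
    then show ?thesis by (simp add: G_def pair_force_odd)
  qed
  have "G 0 = 0" by (simp add: G_def \<eta>_def)
  moreover have "L + B / \<delta> / \<delta> \<ge> 0" using L(1) B_nonneg assms by simp
  ultimately show ?thesis using G_lip G_eq by blast
qed

text \<open>Death times \<open>T + 1\<close> mean that all charges stay fixed on the interval. The
  truncation thresholds \<open>\<delta> / 2\<close> and \<open>R\<close> lie strictly beyond what a
  flow can reach, so a solution of the truncated system cannot get to them as long as it is a
  flow.\<close>

lemma flow_exists:
  assumes n: "n \<ge> 1" and T: "0 \<le> T"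
    and init: "\<And>i j. i \<in> {1..n} \<Longrightarrow> j \<in> {1..n} \<Longrightarrow> i \<noteq> j \<Longrightarrow> c i * c j = 1 \<Longrightarrow> x0 i \<noteq> x0 j"
  shows "\<exists>x. flow n T (\<lambda>_. T + 1) c x \<and> (\<forall>i\<in>{1..n}. x 0 i = x0 i)"
proof -
  let ?\<theta> = "\<lambda>_::nat. T + 1"
  have \<theta>: "0 < ?\<theta> i" for i using T by simp
  obtain \<delta> where \<delta>: "\<delta> > 0" and sep: "\<And>u z t i j. \<lbrakk>u \<le> T; flow n u ?\<theta> c z; \<forall>i\<in>{1..n}. z 0 i = x0 i; t \<in> {0..u};
      i \<in> {1..n}; j \<in> {1..n}; i \<noteq> j; c i * c j = 1\<rbrakk> \<Longrightarrow> \<delta> \<le> \<bar>gap z ?\<theta> i j t\<bar>"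
    using flow_separation[of n ?\<theta> T c x0, OF \<theta> n T init] by blast
  \<comment> \<open>The square root bounds every gap through the second moment; the 1 makes this
    bound strict, and \<open>\<delta>\<close> ensures \<open>\<delta> / 2 \<le> R\<close>.\<close>
  define R where "R = sqrt (4 * real n * (B * T + moment n 2 x0)) + \<delta> + 1"
  have R: "\<delta> / 2 \<le> R" using \<delta> B_nonneg T moment_nonneg[of n 2 x0] by (simp add: R_def add_increasing)
  obtain G L where G: "L \<ge> 0" "\<And>r s. \<bar>G r - G s\<bar> \<le> L * \<bar>r - s\<bar>" "G 0 = 0"
    "\<And>r. \<bar>r\<bar> \<in> {\<delta> / 2..R} \<Longrightarrow> G r = pair_force 1 r"
    using truncated_force[OF _ R] \<delta> by fastforce
  obtain L' where L': "L' \<ge> 0" "\<And>\<sigma> r s. \<sigma> \<noteq> 1 \<Longrightarrow> \<bar>pair_force \<sigma> r - pair_force \<sigma> s\<bar> \<le> L' * \<bar>r - s\<bar>"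
    using pair_force_lipschitz[OF \<delta>, of \<delta>] by blast
  define g where "g \<sigma> r = (if \<sigma> = 1 then G r else pair_force \<sigma> r)" for \<sigma> r
  have g: "\<bar>g \<sigma> r - g \<sigma> s\<bar> \<le> (L + L') * \<bar>r - s\<bar>" for \<sigma> r s
  proof -
    have "L * \<bar>r - s\<bar> \<le> (L + L') * \<bar>r - s\<bar>" "L' * \<bar>r - s\<bar> \<le> (L + L') * \<bar>r - s\<bar>"
      using G(1) L'(1) by (auto intro: mult_right_mono)
    then show ?thesis using G(2)[of r s] L'(2)[of \<sigma> r s] by (auto simp: g_def)
  qed
  define F where "F y i = - (1 / real n) * (\<Sum>j\<in>{1..n}. g (c i * c j) (y i - y j))" for y i
  have F_lip: "\<bar>F y i - F z i\<bar> \<le> 2 * (L + L') * (\<Sum>j\<in>{1..n}. \<bar>y j - z j\<bar>)" if i: "i \<in> {1..n}" for y z i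
  proof -
    let ?S = "\<Sum>j\<in>{1..n}. \<bar>y j - z j\<bar>"
    have *: "\<bar>y j - z j\<bar> \<le> ?S" if "j \<in> {1..n}" for j
      using that by (intro member_le_sum[of j "{1..n}" "\<lambda>j. \<bar>y j - z j\<bar>"]) auto
    have "F y i - F z i = - (1 / real n) * (\<Sum>j\<in>{1..n}. g (c i * c j) (y i - y j) - g (c i * c j) (z i - z j))"
      by (simp add: F_def sum_subtractf algebra_simps)
    then have "\<bar>F y i - F z i\<bar> = 1 / real n * \<bar>\<Sum>j\<in>{1..n}. g (c i * c j) (y i - y j) - g (c i * c j) (z i - z j)\<bar>"
      by (simp add: abs_mult)
    moreover have "\<bar>\<Sum>j\<in>{1..n}. g (c i * c j) (y i - y j) - g (c i * c j) (z i - z j)\<bar> \<le>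
        (\<Sum>j\<in>{1..n}. (L + L') * (2 * ?S))"
    proof (rule order_trans[OF sum_abs], rule sum_mono)
      fix j assume j: "j \<in> {1..n}"
      have "\<bar>g (c i * c j) (y i - y j) - g (c i * c j) (z i - z j)\<bar> \<le> (L + L') * \<bar>(y i - y j) - (z i - z j)\<bar>"
        by (rule g)
      also have "\<dots> \<le> (L + L') * (2 * ?S)"
        using *[OF i] *[OF j] G(1) L'(1) by (intro mult_left_mono) auto
      finally show "\<bar>g (c i * c j) (y i - y j) - g (c i * c j) (z i - z j)\<bar> \<le> (L + L') * (2 * ?S)" .
    qed
    ultimately have "\<bar>F y i - F z i\<bar> \<le> 1 / real n * (\<Sum>j\<in>{1..n}. (L + L') * (2 * ?S))"
      by (simp only:) (intro mult_left_mono, auto)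
    also have "\<dots> = 2 * (L + L') * ?S" using n by simp
    finally show ?thesis .
  qed
  have "\<exists>x. (\<forall>i\<in>{1..n}. continuous_on {0..T} (\<lambda>t. x t i) \<and> x 0 i = x0 i \<and>
    (\<forall>t\<in>{0<..<T}. ((\<lambda>s. x s i) has_real_derivative F (x t) i) (at t)))"
    by (rule picard_lindelof[OF finite_atLeastAtMost _ T F_lip]) (use G(1) L'(1) in auto)
  then obtain x where x: "\<And>i. i \<in> {1..n} \<Longrightarrow> continuous_on {0..T} (\<lambda>t. x t i)"
    "\<And>i. i \<in> {1..n} \<Longrightarrow> x 0 i = x0 i"
    "\<And>i t. i \<in> {1..n} \<Longrightarrow> t \<in> {0<..<T} \<Longrightarrow> ((\<lambda>s. x s i) has_real_derivative F (x t) i) (at t)"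
    by blast
  define P where "P = {(i, j). i \<in> {1..n} \<and> j \<in> {1..n} \<and> i \<noteq> j \<and> c i * c j = 1}"
  have "finite P" by (rule finite_subset[of _ "{1..n} \<times> {1..n}"]) (auto simp: P_def)
  have flow: "flow n u ?\<theta> c x" if u: "u \<le> T"
    and range: "\<And>t i j. t \<in> {0<..<u} \<Longrightarrow> (i, j) \<in> P \<Longrightarrow> \<bar>x t i - x t j\<bar> \<in> {\<delta> / 2..R}" for u
    unfolding flow_def
  proof (intro conjI ballI)
    show "continuous_on {0..u} (\<lambda>t. x t i)" if "i \<in> {1..n}" for i
      by (rule continuous_on_subset[OF x(1)[OF that]]) (use u in auto)
    fix t i assume t: "t \<in> {0<..<u} - ?\<theta> ` {1..n}" and i: "i \<in> {1..n}"
    have "((\<lambda>s. x s i) has_real_derivative F (x t) i) (at t)" using t u i by (intro x(3)) auto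
    also have "F (x t) i = force n (alive c ?\<theta> t) (x t) i"
      unfolding F_def force_def
    proof (intro arg_cong2[of _ _ _ _ "(*)"] refl sum.cong)
      fix j assume j: "j \<in> {1..n}"
      have "alive c ?\<theta> t i * alive c ?\<theta> t j = c i * c j" using t u by (simp add: alive_def)
      moreover have "g (c i * c j) (x t i - x t j) = pair_force (c i * c j) (x t i - x t j)"
      proof (cases "i \<noteq> j \<and> c i * c j = 1")
        case True
        then have "(i, j) \<in> P" using i j by (simp add: P_def)
        then show ?thesis using range[of t i j] t True by (simp add: g_def G(4))
      next
        case False
        then show ?thesis by (auto simp: g_def G(3))
      qed
      ultimately show "g (c i * c j) (x t i - x t j) =
          pair_force (alive c ?\<theta> t i * alive c ?\<theta> t j) (x t i - x t j)" by simp
    qed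
    finally show "((\<lambda>s. x s i) has_real_derivative force n (alive c ?\<theta> t) (x t) i) (at t)" .
  qed
  text \<open>At the first exit from the region where truncation has no effect, the curve is still a flow, so
    the separation bound and the moment bound apply there with room to spare.\<close>
  have range: "\<bar>x t i - x t j\<bar> \<in> {\<delta> / 2..R}" if "t \<in> {0..T}" "(i, j) \<in> P" for t i j
  proof (rule ccontr)
    assume out: "\<bar>x t i - x t j\<bar> \<notin> {\<delta> / 2..R}"
    \<comment> \<open>The thresholds themselves belong to \<open>Z\<close>, so \<open>Z\<close> is
      closed and has a first element; before it truncated and true forces coincide.\<close>
    define Z where "Z = (\<Union>(i, j)\<in>P. {0..T} \<inter> (\<lambda>t. \<bar>x t i - x t j\<bar>) -` ({..\<delta> / 2} \<union> {R..}))"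
    have cl: "closed ({0..T} \<inter> (\<lambda>t. \<bar>x t i - x t j\<bar>) -` ({..\<delta> / 2} \<union> {R..}))" if "(i, j) \<in> P" for i j
      by (rule continuous_closed_preimage) (use that in \<open>auto simp: P_def intro!: continuous_intros x(1)\<close>)
    have "closed Z" unfolding Z_def
    proof (intro closed_UN ballI \<open>finite P\<close>)
      fix p assume "p \<in> P"
      then show "closed (case p of (i, j) \<Rightarrow> {0..T} \<inter> (\<lambda>t. \<bar>x t i - x t j\<bar>) -` ({..\<delta> / 2} \<union> {R..}))"
        using cl by (cases p) (simp only: prod.case)
    qed
    moreover have "Z \<subseteq> {0..T}" by (auto simp: Z_def)
    ultimately have "compact Z" using compact_Int_closed[OF compact_Icc, of Z 0 T] by (simp add: Int_absorb1)
    moreover have "Z \<noteq> {}" using out that by (force simp: Z_def)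
    ultimately obtain s where s: "s \<in> Z" "\<And>r. r \<in> Z \<Longrightarrow> s \<le> r"
      using compact_attains_inf[of Z] by blast
    have sT: "0 \<le> s" "s \<le> T" using s(1) \<open>Z \<subseteq> _\<close> by auto
    have fl: "flow n s ?\<theta> c x"
    proof (rule flow[OF sT(2)])
      fix r i j assume r: "r \<in> {0<..<s}" and ij: "(i, j) \<in> P"
      have "r \<notin> Z" using s(2)[of r] r by auto
      then show "\<bar>x r i - x r j\<bar> \<in> {\<delta> / 2..R}"
        using r ij sT by (auto simp: Z_def)
    qed
    obtain i j where ij: "(i, j) \<in> P" "\<bar>x s i - x s j\<bar> \<le> \<delta> / 2 \<or> R \<le> \<bar>x s i - x s j\<bar>"
      using s(1) by (auto simp: Z_def)
    then have ij': "i \<in> {1..n}" "j \<in> {1..n}" "i \<noteq> j" "c i * c j = 1" by (auto simp: P_def)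
    have g: "gap x ?\<theta> i j s = x s i - x s j" using sT by (simp add: gap_def)
    have "\<delta> \<le> \<bar>x s i - x s j\<bar>"
      using sep[OF sT(2) fl _ _ ij', of s] x(2) sT unfolding g by auto
    moreover have "\<bar>x s i - x s j\<bar> < R"
    proof -
      have "moment n 2 (x 0) = moment n 2 x0"
        using x(2) by (auto simp: moment_def intro!: sum.cong arg_cong2[of _ _ _ _ "(*)"])
      then have "(x s i - x s j)\<^sup>2 \<le> 4 * real n * (B * s + moment n 2 x0)"
        using gap_sq_le[OF fl \<theta> n sT(1) order_refl ij'(1,2)] unfolding g by simp
      also have "\<dots> \<le> 4 * real n * (B * T + moment n 2 x0)"
        using mult_left_mono[OF sT(2) B_nonneg] by (intro mult_left_mono) auto
      finally have "\<bar>x s i - x s j\<bar> \<le> sqrt (4 * real n * (B * T + moment n 2 x0))"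
        by (intro real_le_rsqrt) simp
      then show ?thesis using \<delta> by (simp add: R_def)
    qed
    ultimately show False using ij(2) \<delta> by auto
  qed
  have "flow n T ?\<theta> c x" by (rule flow) (use range in auto)
  then show ?thesis using x(2) by blast
qed

text \<open>Run the flow with fixed charges until the first meeting of opposite charges, delete the
  particles which meet, and continue with fewer charges.\<close>

lemma annihilating_exists:
  assumes n: "n \<ge> 1" and "T > 0"
    and "\<And>i j. i \<in> {1..n} \<Longrightarrow> j \<in> {1..n} \<Longrightarrow> i \<noteq> j \<Longrightarrow> c i \<noteq> 0 \<Longrightarrow> c j \<noteq> 0 \<Longrightarrow> x0 i \<noteq> x0 j"
    and "\<And>i. i \<in> {1..n} \<Longrightarrow> c i \<in> {- 1, 0, 1}"
  shows "\<exists>\<theta> x. annihilating n T x0 c \<theta> x \<and> (\<forall>i\<in>{1..n}. c i = 0 \<longrightarrow> \<theta> i = T + 1)"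
  using assms(2-)
\<comment> \<open>Deleted particles remain in the index set with charge 0. The claim therefore
  admits charge 0, and its second half guarantees that the restarted system assigns no death to such
  particles.\<close>
proof (induction "card {i \<in> {1..n}. c i \<noteq> 0}" arbitrary: T x0 c rule: less_induct)
  case less
  note T = less.prems(1) and distinct = less.prems(2) and c = less.prems(3)
  have "0 \<le> T" using T by simp
  let ?\<theta> = "\<lambda>_::nat. T + 1"
  have init: "x0 i \<noteq> x0 j" if "i \<in> {1..n}" "j \<in> {1..n}" "i \<noteq> j" "c i * c j = 1" for i j
    using that by (intro distinct) auto
  obtain z where z: "flow n T ?\<theta> c z" "\<And>i. i \<in> {1..n} \<Longrightarrow> z 0 i = x0 i"
    using flow_exists[of n T c x0, OF n \<open>0 \<le> T\<close> init] by blast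
  define P where "P = {(i, j). i \<in> {1..n} \<and> j \<in> {1..n} \<and> c i * c j = - 1}"
  define Z where "Z = (\<Union>(i, j)\<in>P. {0..T} \<inter> (\<lambda>t. z t i - z t j) -` {0})"
  have Z: "t \<in> Z \<longleftrightarrow> t \<in> {0..T} \<and> (\<exists>i\<in>{1..n}. \<exists>j\<in>{1..n}. c i * c j = - 1 \<and> z t i = z t j)" for t
    by (auto simp: Z_def P_def simp del: One_nat_def atLeastAtMost_iff)
  show ?case
  proof (cases "Z \<inter> {0<..<T} = {}")
    \<comment> \<open>A meeting exactly at the final time \<open>T\<close> does not count as a
      collision.\<close>
    case True
    have "annihilating n T x0 c ?\<theta> z"
      unfolding annihilating_def
    proof (intro conjI ballI impI)
      show "z t i \<noteq> z t j" if "t \<in> {0<..<T}" "i \<in> {1..n}" "j \<in> {1..n}" "c i * c j = - 1" for t i j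
      proof -
        have "t \<notin> Z" "t \<in> {0..T}" using that(1) True by auto
        then show ?thesis using that(2-) unfolding Z by blast
      qed
    qed (use z T in auto)
    then show ?thesis by blast
  next
    case False
    have "finite P" by (rule finite_subset[of _ "{1..n} \<times> {1..n}"]) (auto simp: P_def)
    have cl: "closed ({0..T} \<inter> (\<lambda>t. z t i - z t j) -` {0})" if "(i, j) \<in> P" for i j
      by (rule continuous_closed_preimage)
        (use that in \<open>auto simp: P_def intro!: continuous_intros flow_cont[OF z(1)]\<close>)
    have "closed Z" unfolding Z_def
    proof (intro closed_UN ballI \<open>finite P\<close>)
      fix p assume "p \<in> P"
      then show "closed (case p of (i, j) \<Rightarrow> {0..T} \<inter> (\<lambda>t. z t i - z t j) -` {0})"
        using cl by (cases p) (simp only: prod.case)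
    qed
    moreover have "Z \<subseteq> {0..T}" by (auto simp: Z_def)
    ultimately have "compact Z" using compact_Int_closed[OF compact_Icc, of Z 0 T] by (simp add: Int_absorb1)
    moreover have "Z \<noteq> {}" using False by blast
    ultimately obtain s where s: "s \<in> Z" "\<And>r. r \<in> Z \<Longrightarrow> s \<le> r"
      using compact_attains_inf[of Z] by blast
    have "0 \<notin> Z"
    proof
      assume "0 \<in> Z"
      then obtain i j where ij: "i \<in> {1..n}" "j \<in> {1..n}" "c i * c j = - 1" "z 0 i = z 0 j" by (auto simp: Z)
      have "c i * c i \<noteq> - 1" using zero_le_square[of "c i"] by linarith
      then have "i \<noteq> j" using ij(3) by auto
      moreover have "c i \<noteq> 0" "c j \<noteq> 0" using ij(3) by auto
      ultimately show False using distinct[OF ij(1,2)] ij z(2) by auto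
    qed
    then have "s \<noteq> 0" using s(1) by blast
    then have s_pos: "0 < s" using s(1) \<open>Z \<subseteq> _\<close> by force
    have sT: "s < T" using False s(2) by fastforce
    \<comment> \<open>All particles in contact with an opposite charge at \<open>s\<close>. The
      charged particles outside \<open>D\<close> have distinct positions, opposite ones by this
      choice and equal ones by separation, so the induction hypothesis applies at
      \<open>s\<close>.\<close>
    define D where "D = {i \<in> {1..n}. \<exists>j\<in>{1..n}. c i * c j = - 1 \<and> z s i = z s j}"
    define c' where "c' i = (if i \<in> D then 0 else c i)" for i
    have D_c: "c i \<noteq> 0" if "i \<in> D" for i using that by (auto simp: D_def)
    have "D \<noteq> {}" using s(1) by (auto simp: Z D_def)
    have fewer: "card {i \<in> {1..n}. c' i \<noteq> 0} < card {i \<in> {1..n}. c i \<noteq> 0}"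
    proof (rule psubset_card_mono)
      obtain i where "i \<in> D" using \<open>D \<noteq> {}\<close> by blast
      then have "i \<in> {i \<in> {1..n}. c i \<noteq> 0}" "i \<notin> {i \<in> {1..n}. c' i \<noteq> 0}"
        using D_c by (auto simp: c'_def D_def)
      moreover have "{i \<in> {1..n}. c' i \<noteq> 0} \<subseteq> {i \<in> {1..n}. c i \<noteq> 0}" by (auto simp: c'_def)
      ultimately show "{i \<in> {1..n}. c' i \<noteq> 0} \<subset> {i \<in> {1..n}. c i \<noteq> 0}" by blast
    qed simp
    have \<theta>_pos: "0 < ?\<theta> i" for i using T by simp
    obtain \<delta> where \<delta>: "\<delta> > 0" and sep: "\<And>u z t i j. \<lbrakk>u \<le> T; flow n u ?\<theta> c z; \<forall>i\<in>{1..n}. z 0 i = x0 i; t \<in> {0..u};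
        i \<in> {1..n}; j \<in> {1..n}; i \<noteq> j; c i * c j = 1\<rbrakk> \<Longrightarrow> \<delta> \<le> \<bar>gap z ?\<theta> i j t\<bar>"
      using flow_separation[of n ?\<theta> T c x0, OF \<theta>_pos n \<open>0 \<le> T\<close> init] by blast
    have distinct': "z s i \<noteq> z s j"
      if ij: "i \<in> {1..n}" "j \<in> {1..n}" "i \<noteq> j" "c' i \<noteq> 0" "c' j \<noteq> 0" for i j
    proof -
      have cs: "i \<notin> D" "j \<notin> D" "c i \<noteq> 0" "c j \<noteq> 0" using ij by (auto simp: c'_def split: if_splits)
      then consider "c i * c j = 1" | "c i * c j = - 1" using c[OF ij(1)] c[OF ij(2)] by auto
      then show ?thesis
      proof cases
        case 1
        then have "\<delta> \<le> \<bar>gap z ?\<theta> i j s\<bar>"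
          using z(2) s_pos sT by (intro sep[OF order_refl z(1) _ _ ij(1-3)]) auto
        then show ?thesis using \<delta> sT by (auto simp: gap_def)
      next
        case 2
        then show ?thesis using cs(1) ij by (auto simp: D_def)
      qed
    qed
    have c': "c' i \<in> {- 1, 0, 1}" if "i \<in> {1..n}" for i using c[OF that] by (simp add: c'_def)
    obtain \<theta>' x' where IH: "annihilating n (T - s) (z s) c' \<theta>' x'"
      and IH0: "\<And>i. i \<in> {1..n} \<Longrightarrow> c' i = 0 \<Longrightarrow> \<theta>' i = T - s + 1"
    proof -
      have "0 < T - s" using sT by simp
      from less.hyps[of c' "T - s" "z s", OF fewer this distinct' c'] that show thesis by blast
    qed
    note X = annihilatingD[OF IH]
    \<comment> \<open>Shifted by \<open>s\<close>, the survival value \<open>T - s + 1\<close> of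
      the restarted system becomes \<open>T + 1\<close>. Particles in \<open>D\<close>, which that
      system treats as survivors, get \<open>s\<close> instead.\<close>
    define \<theta> where "\<theta> i = (if i \<in> D then s else if \<theta>' i < T - s then s + \<theta>' i else T + 1)" for i
    define x where "x t i = (if t \<le> s then z t i else x' (t - s) i)" for t i
    have \<theta>_ge: "s \<le> \<theta> i" if "i \<in> {1..n}" for i
      using X(3)[OF that] sT by (auto simp: \<theta>_def)
    have \<theta>_D: "\<theta> i = s" if "i \<in> D" for i using that by (simp add: \<theta>_def)
    have D_I: "i \<in> {1..n}" if "i \<in> D" for i using that by (simp add: D_def)
    have \<theta>'_D: "\<not> \<theta>' i < T - s" if "i \<in> D" for i
      using IH0[OF D_I[OF that]] that by (simp add: c'_def)
    have lt_iff: "t < \<theta> i \<longleftrightarrow> i \<notin> D \<and> t - s < \<theta>' i" if "i \<in> {1..n}" "s < t" "t < T" for t i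
      using X(4)[OF that(1)] that by (auto simp: \<theta>_def)
    have fl: "flow n T \<theta> c x"
      unfolding flow_def
    proof (intro conjI ballI)
      fix i assume i: "i \<in> {1..n}"
      have "continuous_on ({0..s} \<union> {s..T}) (\<lambda>t. if t \<le> s then z t i else x' (t - s) i)"
      proof (rule continuous_on_cases)
        show "continuous_on {0..s} (\<lambda>t. z t i)"
          by (rule continuous_on_subset[OF flow_cont[OF z(1) i]]) (use sT in auto)
        show "continuous_on {s..T} (\<lambda>t. x' (t - s) i)"
          by (rule continuous_on_compose2[OF flow_cont[OF X(1) i]]) (auto intro!: continuous_intros)
        show "\<forall>t. t \<in> {0..s} \<and> \<not> t \<le> s \<or> t \<in> {s..T} \<and> t \<le> s \<longrightarrow> z t i = x' (t - s) i"
          using X(2)[OF i] by auto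
      qed auto
      also have "{0..s} \<union> {s..T} = {0..T}" using s_pos sT by auto
      finally show "continuous_on {0..T} (\<lambda>t. x t i)" unfolding x_def .
    next
      fix t i assume t: "t \<in> {0<..<T} - \<theta> ` {1..n}" and i: "i \<in> {1..n}"
      obtain k where "k \<in> D" using \<open>D \<noteq> {}\<close> by blast
      then have "s \<in> \<theta> ` {1..n}" using \<theta>_D D_I by force
      then consider "t < s" | "s < t" using t by force
      then show "((\<lambda>s. x s i) has_real_derivative force n (alive c \<theta> t) (x t) i) (at t)"
      proof cases
        case 1
        have "((\<lambda>s. z s i) has_real_derivative force n (alive c ?\<theta> t) (z t) i) (at t)"
          using t by (intro flow_deriv[OF z(1) i]) auto
        also have "force n (alive c ?\<theta> t) (z t) i = force n (alive c \<theta> t) (z t) i"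
          using \<theta>_ge 1 t by (intro force_cong i) (force simp: alive_def)
        also have "z t = x t" using 1 by (auto simp: x_def)
        finally show ?thesis
          by (rule has_field_derivative_transform_within_open[of _ _ _ "{..<s}"]) (use 1 in \<open>auto simp: x_def\<close>)
      next
        case 2
        have "t - s \<notin> \<theta>' ` {1..n}"
        proof
          assume "t - s \<in> \<theta>' ` {1..n}"
          then obtain k where k: "k \<in> {1..n}" "\<theta>' k = t - s" by auto
          then have "\<theta>' k < T - s" using t by auto
          then have "\<theta> k = t" using \<theta>'_D[of k] k by (auto simp: \<theta>_def)
          then show False using t k by auto
        qed
        then have "((\<lambda>r. x' r i) has_real_derivative force n (alive c' \<theta>' (t - s)) (x' (t - s)) i) (at (t - s))"
          using t 2 by (intro flow_deriv[OF X(1) i]) auto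
        then have "((\<lambda>r. x' (r - s) i) has_real_derivative force n (alive c' \<theta>' (t - s)) (x' (t - s)) i) (at t)"
          using DERIV_shift[of "\<lambda>r. x' r i" _ t "- s"] by simp
        also have "force n (alive c' \<theta>' (t - s)) (x' (t - s)) i = force n (alive c \<theta> t) (x' (t - s)) i"
        proof (rule force_cong[OF _ i])
          fix j assume "j \<in> {1..n}"
          then show "alive c' \<theta>' (t - s) j = alive c \<theta> t j"
            using lt_iff[of j t] 2 t by (auto simp: alive_def c'_def)
        qed
        also have "x' (t - s) = x t" using 2 by (auto simp: x_def)
        finally show ?thesis
          by (rule has_field_derivative_transform_within_open[of _ _ _ "{s<..}"]) (use 2 in \<open>auto simp: x_def\<close>)
      qed
    qed
    have no_meet: "x t i \<noteq> x t j"
      if t: "t \<in> {0<..<T}" and ij: "i \<in> {1..n}" "j \<in> {1..n}" "c i * c j = - 1" "t < \<theta> i" "t < \<theta> j" for t i j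
    proof -
      consider "t < s" | "t = s" | "s < t" by linarith
      then show ?thesis
      proof cases
        case 1
        then have "t \<notin> Z" using s(2)[of t] by auto
        then show ?thesis using t ij 1 by (auto simp: x_def Z)
      next
        case 2
        then have "i \<notin> D" using ij \<theta>_D by force
        then show ?thesis using 2 ij by (auto simp: x_def D_def)
      next
        case 3
        then have "i \<notin> D" "j \<notin> D" "t - s < \<theta>' i" "t - s < \<theta>' j" using lt_iff t ij by auto
        then show ?thesis using X(5)[of "t - s" i j] t ij 3 by (simp add: x_def c'_def)
      qed
    qed
    have partner: "\<exists>j\<in>{1..n}. c i * c j = - 1 \<and> \<theta> j = \<theta> i \<and> x (\<theta> i) j = x (\<theta> i) i"
      if i: "i \<in> {1..n}" "\<theta> i < T" for i
    proof (cases "i \<in> D")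
      case True
      then obtain j where j: "j \<in> {1..n}" "c i * c j = - 1" "z s i = z s j" by (auto simp: D_def)
      then have "j \<in> D" using i by (auto simp: D_def mult.commute)
      then show ?thesis using True j by (intro bexI[of _ j]) (auto simp: \<theta>_D x_def)
    next
      case False
      then have \<theta>': "\<theta>' i < T - s" "\<theta> i = s + \<theta>' i" using i by (auto simp: \<theta>_def split: if_splits)
      obtain j where j: "j \<in> {1..n}" "c' i * c' j = - 1" "\<theta>' j = \<theta>' i" "x' (\<theta>' i) j = x' (\<theta>' i) i"
        using X(6)[OF i(1) \<theta>'(1)] by blast
      then have "j \<notin> D" by (auto simp: c'_def)
      then show ?thesis using j \<theta>' False X(3)[OF i(1)]
        by (intro bexI[of _ j]) (auto simp: \<theta>_def x_def c'_def)
    qed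
    have "annihilating n T x0 c \<theta> x"
      unfolding annihilating_def
    proof (intro conjI ballI impI)
      show "x 0 i = x0 i" if "i \<in> {1..n}" for i using z(2)[OF that] s_pos by (simp add: x_def)
      show "0 < \<theta> i" if "i \<in> {1..n}" for i using \<theta>_ge[OF that] s_pos by simp
      show "\<theta> i < T \<or> \<theta> i = T + 1" if "i \<in> {1..n}" for i using sT by (simp add: \<theta>_def)
    qed (use fl no_meet partner in blast)+
    moreover have "\<theta> i = T + 1" if "i \<in> {1..n}" "c i = 0" for i
      using IH0[OF that(1)] that D_c[of i] by (auto simp: \<theta>_def c'_def)
    ultimately show ?thesis by blast
  qed
qed

end

section \<open>Intervals of constant charge\<close>

text \<open>Induction from the right: the points below the maximum \<open>x\<close> fit into the
  first \<open>L\<close> pairs of intervals, all to the left of \<open>x\<close>, and one more pair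
  takes \<open>x\<close>; \<open>y\<close> reserves the room to its right. The number of points
  bounds the number of pairs, so \<open>L = n\<close> serves all times simultaneously.\<close>

lemma interlacing_intervals:
  fixes P N :: "real set"
  assumes "finite (P \<union> N)" "card (P \<union> N) \<le> L" "P \<inter> N = {}" "\<And>s. s \<in> P \<union> N \<Longrightarrow> s < y"
  shows "\<exists>a. (\<forall>m<2 * L. a m \<le> a (m + 1)) \<and> a (2 * L) < y \<and>
    P \<subseteq> (\<Union>l\<in>{1..L}. {a (2 * l - 2)<..<a (2 * l - 1)}) \<and>
    N \<subseteq> (\<Union>l\<in>{1..L}. {a (2 * l - 1)<..<a (2 * l)})"
  using assms
proof (induction L arbitrary: P N y)
  case 0
  then show ?case by (intro exI[of _ "\<lambda>_. y - 1"]) auto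
next
  case (Suc L)
  show ?case
  proof (cases "P \<union> N = {}")
    case True
    then show ?thesis by (intro exI[of _ "\<lambda>_. y - 1"]) auto
  next
    case False
    define x where "x = Max (P \<union> N)"
    have x: "x \<in> P \<union> N" "\<And>s. s \<in> P \<union> N \<Longrightarrow> s \<le> x"
      using Max_in[OF Suc.prems(1) False] Max_ge[OF Suc.prems(1)] by (auto simp: x_def)
    have eq: "(P - {x}) \<union> (N - {x}) = P \<union> N - {x}" by blast
    have "\<exists>a. (\<forall>m<2 * L. a m \<le> a (m + 1)) \<and> a (2 * L) < x \<and>
      P - {x} \<subseteq> (\<Union>l\<in>{1..L}. {a (2 * l - 2)<..<a (2 * l - 1)}) \<and>
      N - {x} \<subseteq> (\<Union>l\<in>{1..L}. {a (2 * l - 1)<..<a (2 * l)})"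
    proof (rule Suc.IH)
      show "card (P - {x} \<union> (N - {x})) \<le> L"
        unfolding eq using card_Diff_singleton[OF x(1)] Suc.prems(2) by simp
      show "s < x" if "s \<in> P - {x} \<union> (N - {x})" for s
        using x(2)[of s] that by auto
    qed (use Suc.prems(1,3) in auto)
    then obtain a where a: "\<forall>m<2 * L. a m \<le> a (m + 1)" "a (2 * L) < x"
      "P - {x} \<subseteq> (\<Union>l\<in>{1..L}. {a (2 * l - 2)<..<a (2 * l - 1)})"
      "N - {x} \<subseteq> (\<Union>l\<in>{1..L}. {a (2 * l - 1)<..<a (2 * l)})" by blast
    obtain z where z: "x < z" "z < y" using dense[OF Suc.prems(4)[OF x(1)]] by blast
    \<comment> \<open>Of the two new intervals one is collapsed and hence empty: the first if
      \<open>x\<close> is in \<open>N\<close>, the second otherwise.\<close>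
    define a' where "a' m = (if m \<le> 2 * L then a m else if m = 2 * L + 1 \<and> x \<in> N then a (2 * L) else z)" for m
    have old: "(\<Union>l\<in>{1..L}. {a (2 * l - 2)<..<a (2 * l - 1)}) \<subseteq> (\<Union>l\<in>{1..Suc L}. {a' (2 * l - 2)<..<a' (2 * l - 1)})"
      "(\<Union>l\<in>{1..L}. {a (2 * l - 1)<..<a (2 * l)}) \<subseteq> (\<Union>l\<in>{1..Suc L}. {a' (2 * l - 1)<..<a' (2 * l)})"
      by (intro UN_mono; force simp: a'_def)+
    have "x \<in> {a' (2 * Suc L - 2)<..<a' (2 * Suc L - 1)}" if "x \<in> P"
      using that Suc.prems(3) a(2) z by (auto simp: a'_def)
    then have "x \<in> (\<Union>l\<in>{1..Suc L}. {a' (2 * l - 2)<..<a' (2 * l - 1)})" if "x \<in> P"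
      using that by (intro UN_I[of "Suc L"]) auto
    moreover have "x \<in> {a' (2 * Suc L - 1)<..<a' (2 * Suc L)}" if "x \<in> N"
      using that a(2) z by (auto simp: a'_def)
    then have "x \<in> (\<Union>l\<in>{1..Suc L}. {a' (2 * l - 1)<..<a' (2 * l)})" if "x \<in> N"
      using that by (intro UN_I[of "Suc L"]) auto
    moreover have "a' m \<le> a' (m + 1)" if "m < 2 * Suc L" for m
    proof -
      consider "m < 2 * L" | "m = 2 * L" | "m = 2 * L + 1" using \<open>m < 2 * Suc L\<close> by fastforce
      then show ?thesis using a(1,2) z by cases (auto simp: a'_def)
    qed
    moreover have "a' (2 * Suc L) < y" using z by (simp add: a'_def)
    ultimately show ?thesis
      using a(3,4) old by (intro exI[of _ a'] conjI) blast+
  qed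
qed

text \<open>The form guards against default values: finiteness of the energy is asserted because
  \<open>energy_path\<close> would read \<infinity> as 0, existence of left limits because
  \<open>jump\<close> uses \<open>Lim\<close>, integrability because the integral of a
  non-integrable function is 0. The infimum in (ii) lives in the extended reals, where an empty
  family of pairs gives \<infinity>. Stating (i) to (v) for every solution with its
  \<open>\<tau>\<close> keeps them free of a particular construction.\<close>

theorem proposition4p5:
  fixes V W :: "real \<Rightarrow> real"
  assumes "admissible_potentials V W"
  shows "\<exists>C>0. \<forall>(n::nat) (T::real) (x0 :: nat \<Rightarrow> real) (b0 :: nat \<Rightarrow> int).
    n \<ge> 2 \<longrightarrow> T > 0 \<longrightarrow> (\<forall>i\<in>{1..n}. b0 i \<in> {- 1, 1}) \<longrightarrow> strict_mono_on {1..n} x0 \<longrightarrow>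
    (\<exists>x b. annihilation_solution V W n T x0 b0 x b \<and>
       (\<forall>y c. annihilation_solution V W n T x0 b0 y c \<longrightarrow>
          (\<forall>t\<in>{0..T}. \<forall>i\<in>{1..n}. y t i = x t i \<and> c t i = b t i))) \<and>
    (\<forall>\<tau> x b. annihilation_solution_with V W n T x0 b0 \<tau> x b \<longrightarrow>
       (\<forall>t\<in>{0..T}.
          moment n 2 (x t) \<le> C * t + moment n 2 x0 \<and>
          moment n 4 (x t) \<le> C * t * (moment n 2 x0 + t) + moment n 4 x0) \<and>
       0 < (INF t\<in>{0<..<T}.
              INF (i, j)\<in>{(i, j). i \<in> {1..n} \<and> j \<in> {1..n} \<and> i \<noteq> j \<and> b t i * b t j = 1}.
                ereal \<bar>x t i - x t j\<bar>) \<and>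
       (\<forall>t\<in>{0..<T}. \<bar>energy V W n (x t) (b t)\<bar> \<noteq> \<infinity>) \<and>
       (\<forall>t\<in>{0..<T}. continuous (at_right t) (energy_path V W n x b)) \<and>
       (\<forall>t\<in>{0<..<T} - collision_set n \<tau>.
          energy_path V W n x b differentiable (at t) \<and> deriv (energy_path V W n x b) t \<le> 0) \<and>
       (\<forall>k\<in>{1..num_collisions n \<tau>}.
          (\<exists>l. (energy_path V W n x b \<longlongrightarrow> l) (at_left (collision_time n \<tau> k))) \<and>
          jump (energy_path V W n x b) (collision_time n \<tau> k) \<le>
            C / real n *
              (real (card (annihilated_at n \<tau> k)) * moment n 2 (x (collision_time n \<tau> k)) +
               real (card (annihilated_at n \<tau> k)) +
               (\<Sum>i\<in>annihilated_at n \<tau> k. (x (collision_time n \<tau> k) i)\<^sup>2))) \<and>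
       (\<Sum>k\<in>{1..num_collisions n \<tau>}. jump (energy_path V W n x b) (collision_time n \<tau> k))
          \<le> C * (T + moment n 2 x0 + 1) \<and>
       (\<forall>t\<in>{0<..T}.
          speed_sq n x integrable_on {0..t} \<and>
          energy V W n (x t) (b t) - energy V W n x0 b0 \<le>
            ereal (C * (t + moment n 2 x0 + 1) - 1 / real n * integral {0..t} (speed_sq n x))) \<and>
       (\<exists>L::nat. \<forall>t\<in>{0..<T}. \<exists>a :: nat \<Rightarrow> real.
          (\<forall>m<2 * L. a m \<le> a (m + 1)) \<and>
          {x t i | i. i \<in> {1..n} \<and> b t i = 1} \<subseteq> (\<Union>l\<in>{1..L}. {a (2 * l - 2)<..<a (2 * l - 1)}) \<and>
          {x t i | i. i \<in> {1..n} \<and> b t i = - 1} \<subseteq> (\<Union>l\<in>{1..L}. {a (2 * l - 1)<..<a (2 * l)})))"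
proof -
  obtain B K where BK: "pair_potentials V W B K" using pair_potentials_exist[OF assms] by blast
  interpret pair_potentials V W B K by (rule BK)
  \<comment> \<open>The constants of the total jump, the fourth moment, the second moment and a
    single jump, with 1 added for positivity.\<close>
  define C where "C = 4 * K * (B + 1) + 6 * B * (B + 1) + B + 2 * K + 1"
  have C: "0 < C" "4 * K * (B + 1) \<le> C" "6 * B * (B + 1) \<le> C" "B \<le> C" "2 * K \<le> C"
  proof -
    have "0 \<le> 4 * K * (B + 1)" "0 \<le> 6 * B * (B + 1)" using B_nonneg K_nonneg by simp_all
    then show "0 < C" "4 * K * (B + 1) \<le> C" "6 * B * (B + 1) \<le> C" "B \<le> C" "2 * K \<le> C"
      using B_nonneg K_nonneg unfolding C_def by linarith+
  qed
  show ?thesis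
  proof (intro exI[of _ C] conjI C(1) allI impI)
    fix n :: nat and T :: real and x0 :: "nat \<Rightarrow> real" and b0 :: "nat \<Rightarrow> int"
    assume n2: "n \<ge> 2" and T: "T > 0" and b0: "\<forall>i\<in>{1..n}. b0 i \<in> {- 1, 1}" and x0: "strict_mono_on {1..n} x0"
    have n: "n \<ge> 1" using n2 by simp
    have distinct: "x0 i \<noteq> x0 j" if "i \<in> {1..n}" "j \<in> {1..n}" "i \<noteq> j" for i j
      using inj_on_contraD[OF strict_mono_on_imp_inj_on[OF x0] that(3,1,2)] .
    obtain \<theta> x where ann: "annihilating n T x0 b0 \<theta> x"
      using annihilating_exists[of n T b0 x0, OF n T distinct] b0 by blast
    have "annihilation_solution V W n T x0 b0 x (alive b0 \<theta>)"
      using ann n T b0 distinct by (rule annihilating_solution)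
    moreover have "y t i = x t i \<and> c t i = alive b0 \<theta> t i"
      if "annihilation_solution V W n T x0 b0 y c" "t \<in> {0..T}" "i \<in> {1..n}" for y c t i
    proof -
      obtain \<tau> where \<tau>: "annihilation_solution_with V W n T x0 b0 \<tau> y c"
        using \<open>annihilation_solution V W n T x0 b0 y c\<close> by (auto simp: annihilation_solution_def)
      note uniq = annihilating_unique[OF solution_annihilating[OF \<tau> T b0] ann n distinct that(3)]
      have "y t i = x t i" using uniq(2) that(2) by blast
      moreover have "death_time T \<tau> i = \<theta> i" using uniq(1) by blast
      ultimately show ?thesis
        using solution_alive[OF \<tau> that(2,3)] by (simp add: alive_def)
    qed
    ultimately show "\<exists>x b. annihilation_solution V W n T x0 b0 x b \<and>
       (\<forall>y c. annihilation_solution V W n T x0 b0 y c \<longrightarrow>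
          (\<forall>t\<in>{0..T}. \<forall>i\<in>{1..n}. y t i = x t i \<and> c t i = b t i))"
      by blast
  next
    fix n :: nat and T :: real and x0 :: "nat \<Rightarrow> real" and b0 :: "nat \<Rightarrow> int"
      and \<tau> :: "nat \<Rightarrow> ereal" and x :: "real \<Rightarrow> nat \<Rightarrow> real" and b :: "real \<Rightarrow> nat \<Rightarrow> int"
    assume n2: "n \<ge> 2" and T: "T > 0" and b0: "\<forall>i\<in>{1..n}. b0 i \<in> {- 1, 1}" and x0: "strict_mono_on {1..n} x0"
      and sol: "annihilation_solution_with V W n T x0 b0 \<tau> x b"
    have n: "n \<ge> 1" using n2 by simp
    have T0: "0 \<le> T" using T by simp
    have distinct: "x0 i \<noteq> x0 j" if "i \<in> {1..n}" "j \<in> {1..n}" "i \<noteq> j" for i j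
      using inj_on_contraD[OF strict_mono_on_imp_inj_on[OF x0] that(3,1,2)] .
    define \<theta> where "\<theta> = death_time T \<tau>"
    have X: "flow n T \<theta> b0 x" "\<And>i. i \<in> {1..n} \<Longrightarrow> x 0 i = x0 i" "\<And>i. i \<in> {1..n} \<Longrightarrow> 0 < \<theta> i"
      "\<And>i. i \<in> {1..n} \<Longrightarrow> \<theta> i < T \<or> \<theta> i = T + 1"
      "\<And>t i j. t \<in> {0<..<T} \<Longrightarrow> i \<in> {1..n} \<Longrightarrow> j \<in> {1..n} \<Longrightarrow> b0 i * b0 j = - 1 \<Longrightarrow> t < \<theta> i \<Longrightarrow> t < \<theta> j \<Longrightarrow>
         x t i \<noteq> x t j"
      using annihilatingD[OF solution_annihilating[OF sol T b0]] unfolding \<theta>_def by blast+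
    have b: "b t i = alive b0 \<theta> t i" if "t \<in> {0..T}" "i \<in> {1..n}" for t i
      using solution_alive[OF sol that] by (simp add: \<theta>_def)
    have \<tau>: "\<forall>i\<in>{1..n}. \<tau> i \<in> ereal ` {0<..<T} \<union> {\<infinity>}"
      using sol by (simp add: annihilation_solution_with_def)
    \<comment> \<open>Intersecting with \<open>{..T}\<close> discards exactly the value
      \<open>T + 1\<close> of the survivors.\<close>
    have coll: "collision_set n \<tau> = \<theta> ` {1..n} \<inter> {..T}"
      using collision_set_iff[OF \<tau>] X(4) unfolding \<theta>_def[symmetric] by force
    have M0: "moment n k (x 0) = moment n k x0" for k
      using X(2) by (auto simp: moment_def intro!: sum.cong arg_cong2[of _ _ _ _ "(*)"])
    obtain \<delta> where \<delta>: "\<delta> > 0" and sep: "\<And>u z t i j. \<lbrakk>u \<le> T; flow n u \<theta> b0 z; \<forall>i\<in>{1..n}. z 0 i = x0 i; t \<in> {0..u};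
        i \<in> {1..n}; j \<in> {1..n}; i \<noteq> j; b0 i * b0 j = 1\<rbrakk> \<Longrightarrow> \<delta> \<le> \<bar>gap z \<theta> i j t\<bar>"
      using flow_separation[of n \<theta> T b0 x0, OF X(3) n T0 distinct] by blast
    have gap: "\<delta> \<le> \<bar>gap x \<theta> i j t\<bar>"
      if "t \<in> {0..T}" "i \<in> {1..n}" "j \<in> {1..n}" "i \<noteq> j" "b0 i * b0 j = 1" for t i j
      using X(2) by (intro sep[OF order_refl X(1) _ that]) blast
    have separated: "separated n \<theta> b0 x t" if "t \<in> {0..T}" for t
      using gap[OF that] \<delta> unfolding separated_def by fastforce
    have dist: "\<delta> \<le> \<bar>x t i - x t j\<bar>"
      if "t \<in> {0..T}" "i \<in> {1..n}" "j \<in> {1..n}" "i \<noteq> j" "alive b0 \<theta> t i * alive b0 \<theta> t j = 1" for t i j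
    proof -
      have "t < \<theta> i" "t < \<theta> j" "b0 i * b0 j = 1"
        using that(5) by (auto simp: alive_def split: if_splits)
      then show ?thesis using gap[OF that(1-4)] by (simp add: gap_def)
    qed
    have energy: "energy V W n (x t) (b t) = ereal (live_energy n (x t) (alive b0 \<theta> t))" if "t \<in> {0..T}" for t
    proof (rule energy_eq_live_energy)
      show "x t i \<noteq> x t j" if "i \<in> {1..n}" "j \<in> {1..n}" "i \<noteq> j" "alive b0 \<theta> t i * alive b0 \<theta> t j = 1" for i j
        using dist[OF \<open>t \<in> {0..T}\<close> that] \<delta> by auto
    qed (rule b[OF that])
    have energy_0: "energy V W n x0 b0 = energy V W n (x 0) (b 0)"
    proof -
      have "energy V W n x0 b0 = ereal (live_energy n x0 (alive b0 \<theta> 0))"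
        by (rule energy_eq_live_energy) (use distinct X(3) in \<open>auto simp: alive_def\<close>)
      also have "live_energy n x0 (alive b0 \<theta> 0) = live_energy n (x 0) (alive b0 \<theta> 0)"
        unfolding live_energy_def using X(2) by (intro arg_cong2[of _ _ _ _ "(*)"] sum.cong refl) auto
      finally show ?thesis using energy[of 0] T by simp
    qed
    define e where "e = energy_path V W n x b"
    have e: "e t = live_energy n (x t) (alive b0 \<theta> t)" if "t \<in> {0..T}" for t
      using energy[OF that] by (simp add: e_def energy_path_def)
    note E = X(1) X(3) n separated e
    have jump: "jump e s = death_jump n \<theta> b0 x s" if "s \<in> collision_set n \<tau>" for s
    proof (rule flow_energy_jump[OF E])
      show "s \<in> {0<..T}" "s \<in> \<theta> ` {1..n}" using that X(3) by (auto simp: coll)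
    qed
    have coll_time: "collision_time n \<tau> k \<in> collision_set n \<tau>" if "k \<in> {1..num_collisions n \<tau>}" for k
      using that collision_time_image by blast
    have coll_pos: "s \<in> {0<..T}" if "s \<in> collision_set n \<tau>" for s
      using that X(3) by (auto simp: coll)
    show "\<forall>t\<in>{0..T}.
          moment n 2 (x t) \<le> C * t + moment n 2 x0 \<and>
          moment n 4 (x t) \<le> C * t * (moment n 2 x0 + t) + moment n 4 x0"
    proof (intro ballI conjI)
      fix t assume t: "t \<in> {0..T}"
      have "moment n 2 (x t) \<le> B * t + moment n 2 x0"
        using flow_moment2[OF X(1) n, of t] t by (simp add: M0)
      also have "B * t \<le> C * t" using t C by (intro mult_right_mono) auto
      finally show "moment n 2 (x t) \<le> C * t + moment n 2 x0" by simp
      have "moment n 4 (x t) \<le> 6 * B * (B * t + moment n 2 x0) * t + moment n 4 x0"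
        using flow_moment4[OF X(1) n, of t] t by (simp add: M0)
      also have "6 * B * (B * t + moment n 2 x0) * t \<le> 6 * B * ((B + 1) * (moment n 2 x0 + t)) * t"
        using t B_nonneg moment_nonneg[of n 2 x0]
        by (intro mult_right_mono mult_left_mono) (simp_all add: algebra_simps)
      also have "\<dots> = (6 * B * (B + 1)) * ((moment n 2 x0 + t) * t)" by simp
      also have "\<dots> \<le> C * ((moment n 2 x0 + t) * t)"
        using t C moment_nonneg[of n 2 x0] by (intro mult_right_mono) auto
      finally show "moment n 4 (x t) \<le> C * t * (moment n 2 x0 + t) + moment n 4 x0"
        by (simp add: mult_ac)
    qed
    show "0 < (INF t\<in>{0<..<T}.
              INF (i, j)\<in>{(i, j). i \<in> {1..n} \<and> j \<in> {1..n} \<and> i \<noteq> j \<and> b t i * b t j = 1}.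
                ereal \<bar>x t i - x t j\<bar>)"
    proof (rule less_le_trans)
      show "0 < ereal \<delta>" using \<delta> by simp
      show "ereal \<delta> \<le> (INF t\<in>{0<..<T}.
              INF (i, j)\<in>{(i, j). i \<in> {1..n} \<and> j \<in> {1..n} \<and> i \<noteq> j \<and> b t i * b t j = 1}.
                ereal \<bar>x t i - x t j\<bar>)"
      proof (intro INF_greatest, clarify)
        fix t i j assume t: "t \<in> {0<..<T}" and ij: "i \<in> {1..n}" "j \<in> {1..n}" "i \<noteq> j" "b t i * b t j = 1"
        have t': "t \<in> {0..T}" using t by auto
        show "ereal \<delta> \<le> ereal \<bar>x t i - x t j\<bar>"
          using dist[OF t' ij(1-3)] ij(4) b[OF t' ij(1)] b[OF t' ij(2)] by simp
      qed
    qed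
    show "\<forall>t\<in>{0..<T}. \<bar>energy V W n (x t) (b t)\<bar> \<noteq> \<infinity>"
      using energy by auto
    show "\<forall>t\<in>{0..<T}. continuous (at_right t) (energy_path V W n x b)"
      unfolding e_def[symmetric] using flow_energy_right[OF E] by blast
    show "\<forall>t\<in>{0<..<T} - collision_set n \<tau>.
          energy_path V W n x b differentiable (at t) \<and> deriv (energy_path V W n x b) t \<le> 0"
      unfolding e_def[symmetric]
    proof
      fix t assume "t \<in> {0<..<T} - collision_set n \<tau>"
      then have t: "t \<in> {0<..<T} - \<theta> ` {1..n}" by (auto simp: coll)
      have d: "(e has_real_derivative - (1 / real n) * force_sq n \<theta> b0 x t) (at t)"
        by (rule flow_energy_deriv[OF E]) (rule t | assumption)+
      have "0 \<le> force_sq n \<theta> b0 x t" by (simp add: force_sq_def sum_nonneg)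
      then show "e differentiable (at t) \<and> deriv e t \<le> 0"
        using d DERIV_imp_deriv[OF d] by (auto simp: real_differentiable_def)
    qed
    show "\<forall>k\<in>{1..num_collisions n \<tau>}.
          (\<exists>l. (energy_path V W n x b \<longlongrightarrow> l) (at_left (collision_time n \<tau> k))) \<and>
          jump (energy_path V W n x b) (collision_time n \<tau> k) \<le>
            C / real n *
              (real (card (annihilated_at n \<tau> k)) * moment n 2 (x (collision_time n \<tau> k)) +
               real (card (annihilated_at n \<tau> k)) +
               (\<Sum>i\<in>annihilated_at n \<tau> k. (x (collision_time n \<tau> k) i)\<^sup>2))"
      unfolding e_def[symmetric]
    proof (intro ballI conjI)
      fix k assume k: "k \<in> {1..num_collisions n \<tau>}"
      let ?s = "collision_time n \<tau> k"
      note s = coll_time[OF k]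
      show "\<exists>l. (e \<longlongrightarrow> l) (at_left ?s)" by (rule exI, rule flow_energy_left[OF E]) (rule coll_pos[OF s] | assumption)+
      have "?s < T" using s collision_set_iff[OF \<tau>] by blast
      have "\<tau> i = ereal ?s \<longleftrightarrow> \<theta> i = ?s" if "i \<in> {1..n}" for i
        using \<tau>[rule_format, OF that] \<open>?s < T\<close> unfolding \<theta>_def by (elim death_time_cases) auto
      then have \<Gamma>: "annihilated_at n \<tau> k = {i \<in> {1..n}. \<theta> i = ?s}"
        unfolding annihilated_at_def by blast
      have "jump e ?s \<le> 2 * K / real n *
              (real (card (annihilated_at n \<tau> k)) * moment n 2 (x ?s) +
               real (card (annihilated_at n \<tau> k)) + (\<Sum>i\<in>annihilated_at n \<tau> k. (x ?s i)\<^sup>2))"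
        unfolding jump[OF s] \<Gamma> by (rule death_jump_le[OF n])
      also have "\<dots> \<le> C / real n *
              (real (card (annihilated_at n \<tau> k)) * moment n 2 (x ?s) +
               real (card (annihilated_at n \<tau> k)) + (\<Sum>i\<in>annihilated_at n \<tau> k. (x ?s i)\<^sup>2))"
        using C moment_nonneg[of n 2 "x ?s"]
        by (intro mult_right_mono divide_right_mono add_nonneg_nonneg sum_nonneg mult_nonneg_nonneg) auto
      finally show "jump e ?s \<le> C / real n *
              (real (card (annihilated_at n \<tau> k)) * moment n 2 (x ?s) +
               real (card (annihilated_at n \<tau> k)) + (\<Sum>i\<in>annihilated_at n \<tau> k. (x ?s i)\<^sup>2))" .
    qed
    have sum_le: "(\<Sum>s\<in>\<theta> ` {1..n} \<inter> {..t}. death_jump n \<theta> b0 x s) \<le> C * (t + moment n 2 x0 + 1)"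
      if "t \<in> {0..T}" for t
    proof -
      have "(\<Sum>s\<in>\<theta> ` {1..n} \<inter> {..t}. death_jump n \<theta> b0 x s) \<le> 4 * K * (B + 1) * (t + moment n 2 x0 + 1)"
        using sum_death_jump_le[OF X(1) X(3) n, of t] that by (simp add: M0)
      also have "\<dots> \<le> C * (t + moment n 2 x0 + 1)"
        using C that moment_nonneg[of n 2 x0] by (intro mult_right_mono) auto
      finally show ?thesis .
    qed
    have "(\<Sum>k\<in>{1..num_collisions n \<tau>}. jump e (collision_time n \<tau> k)) = (\<Sum>s\<in>collision_set n \<tau>. jump e s)"
      unfolding collision_time_image[symmetric] sum.reindex[OF collision_time_inj] comp_def by (rule refl)
    also have "\<dots> = (\<Sum>s\<in>\<theta> ` {1..n} \<inter> {..T}. death_jump n \<theta> b0 x s)"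
      using jump by (intro sum.cong coll) (auto simp: coll)
    also have "\<dots> \<le> C * (T + moment n 2 x0 + 1)" using T by (intro sum_le) auto
    finally show "(\<Sum>k\<in>{1..num_collisions n \<tau>}. jump (energy_path V W n x b) (collision_time n \<tau> k))
          \<le> C * (T + moment n 2 x0 + 1)" unfolding e_def .
    show "\<forall>t\<in>{0<..T}.
          speed_sq n x integrable_on {0..t} \<and>
          energy V W n (x t) (b t) - energy V W n x0 b0 \<le>
            ereal (C * (t + moment n 2 x0 + 1) - 1 / real n * integral {0..t} (speed_sq n x))"
    proof (intro ballI conjI)
      fix t assume "t \<in> {0<..T}"
      then have t: "t \<in> {0..T}" by simp
      show "speed_sq n x integrable_on {0..t}" by (rule flow_speed_sq(1)[OF E]) (rule t | assumption)+
      have "e t - e 0 = - (1 / real n) * integral {0..t} (speed_sq n x) +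
          (\<Sum>s\<in>\<theta> ` {1..n} \<inter> {..t}. death_jump n \<theta> b0 x s)"
        by (rule flow_speed_sq(2)[OF E]) (rule t | assumption)+
      then have "e t - e 0 \<le> C * (t + moment n 2 x0 + 1) - 1 / real n * integral {0..t} (speed_sq n x)"
        using sum_le[OF t] by simp
      then show "energy V W n (x t) (b t) - energy V W n x0 b0 \<le>
            ereal (C * (t + moment n 2 x0 + 1) - 1 / real n * integral {0..t} (speed_sq n x))"
        unfolding energy_0 using energy[OF t] energy[of 0] e[OF t] e[of 0] T by simp
    qed
    show "\<exists>L::nat. \<forall>t\<in>{0..<T}. \<exists>a :: nat \<Rightarrow> real.
          (\<forall>m<2 * L. a m \<le> a (m + 1)) \<and>
          {x t i | i. i \<in> {1..n} \<and> b t i = 1} \<subseteq> (\<Union>l\<in>{1..L}. {a (2 * l - 2)<..<a (2 * l - 1)}) \<and>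
          {x t i | i. i \<in> {1..n} \<and> b t i = - 1} \<subseteq> (\<Union>l\<in>{1..L}. {a (2 * l - 1)<..<a (2 * l)})"
    proof (intro exI[of _ n] ballI)
      fix t assume t: "t \<in> {0..<T}"
      let ?P = "{x t i | i. i \<in> {1..n} \<and> b t i = 1}" and ?N = "{x t i | i. i \<in> {1..n} \<and> b t i = - 1}"
      have sub: "?P \<union> ?N \<subseteq> x t ` {1..n}" by blast
      then have fin: "finite (?P \<union> ?N)" by (rule finite_subset) simp
      have card: "card (?P \<union> ?N) \<le> n"
        using card_mono[OF _ sub] card_image_le[of "{1..n}" "x t"] by simp
      have disj: "?P \<inter> ?N = {}"
      proof (rule equals0I)
        fix r assume "r \<in> ?P \<inter> ?N"
        then obtain i j where ij: "i \<in> {1..n}" "b t i = 1" "j \<in> {1..n}" "b t j = - 1" "x t i = x t j"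
          by auto
        then have a: "b0 i = 1" "b0 j = - 1" "t < \<theta> i" "t < \<theta> j"
          using b[of t i] b[of t j] t by (auto simp: alive_def split: if_splits)
        have "i \<noteq> j" using a by auto
        show False
        proof (cases "t = 0")
          case True
          then show False using distinct[OF ij(1,3) \<open>i \<noteq> j\<close>] ij X(2) by simp
        next
          case False
          then show False using X(5)[of t i j] a ij t by simp
        qed
      qed
      have "s < Max (?P \<union> ?N) + 1" if "s \<in> ?P \<union> ?N" for s
        using Max_ge[OF fin that] by linarith
      from interlacing_intervals[OF fin card disj this]
      show "\<exists>a :: nat \<Rightarrow> real. (\<forall>m<2 * n. a m \<le> a (m + 1)) \<and>
          ?P \<subseteq> (\<Union>l\<in>{1..n}. {a (2 * l - 2)<..<a (2 * l - 1)}) \<and>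
          ?N \<subseteq> (\<Union>l\<in>{1..n}. {a (2 * l - 1)<..<a (2 * l)})"
        by blast
    qed
  qed
qed

end
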